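(* For every integer $n\ge 1$, let $B_n$ be the Weyl group of type $B_n$. Then $$C(B_n)\le n(2n-1)\,|B_n| .$$
   Context: For a finite group $G$, a complex-valued function $f$ on $G$ and a (complex) matrix representation $\rho$ of $G$, the Fourier transform of $f$ at $\rho$ is $\hat f(\rho)=\sum_{s\in G}f(s)\rho(s)$. For a set $R$ of matrix representations, the Fourier transform of $f$ on $R$ is $\mathcal F_R(f)=\bigoplus_{\rho\in R}\hat f(\rho)$. A straight-line program is a list of instructions performing the operations $\times,\div,+,-$ on inputs and precomputed values (complex numbers). Let $+_G(R)$ (respectively $\times_G(R)$) be the minimum number of complex additions (respectively multiplications) needed to compute $\mathcal F_R(f)$ by a straight-line program for an arbitrary complex-valued function $f$ on $G$ (the inputs being the values of $f$). The arithmetic complexity is $T_G(R)=\max(+_G(R),\times_G(R))$. The complexity of the group is $C(G)=\min_R T_G(R)$, where $R$ ranges over all complete sets of inequivalent irreducible complex matrix representations of $G$. $B_n$ is the hyperoctahedral group (signed permutations of $n$ letters), $|B_n|=2^n n!$. *)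

theory Defs
  imports
    "HOL-Library.Extended_Nat"
    "HOL-Combinatorics.Permutations"
    "Jordan_Normal_Form.VS_Connect"
begin

section \<open>Complex matrix representations\<close>

abbreviation GL :: "nat \<Rightarrow> complex mat monoid" where
  "GL d \<equiv> units_of (ring_mat TYPE(complex) d ())"

definition matrix_rep :: "('g, 'b) monoid_scheme \<Rightarrow> ('g \<Rightarrow> complex mat) \<Rightarrow> bool" where
  "matrix_rep G \<rho> \<longleftrightarrow> (\<exists>d. \<rho> \<in> hom G (GL d))"

definition rep_degree :: "('g, 'b) monoid_scheme \<Rightarrow> ('g \<Rightarrow> complex mat) \<Rightarrow> nat" where
  "rep_degree G \<rho> = dim_row (\<rho> \<one>\<^bsub>G\<^esub>)"

definition invariant_subspace ::
  "('g, 'b) monoid_scheme \<Rightarrow> ('g \<Rightarrow> complex mat) \<Rightarrow> complex vec set \<Rightarrow> bool" where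
  "invariant_subspace G \<rho> W \<longleftrightarrow>
     VectorSpace.subspace class_ring W (module_vec TYPE(complex) (rep_degree G \<rho>)) \<and>
     (\<forall>g\<in>carrier G. \<forall>w\<in>W. \<rho> g *\<^sub>v w \<in> W)"

definition irreducible_rep :: "('g, 'b) monoid_scheme \<Rightarrow> ('g \<Rightarrow> complex mat) \<Rightarrow> bool" where
  "irreducible_rep G \<rho> \<longleftrightarrow>
     matrix_rep G \<rho> \<and> rep_degree G \<rho> > 0 \<and>
     (\<forall>W. invariant_subspace G \<rho> W \<longrightarrow>
        W = {0\<^sub>v (rep_degree G \<rho>)} \<or> W = carrier_vec (rep_degree G \<rho>))"

text \<open>One pair \<open>P\<close>, \<open>Q = P\<^sup>-\<^sup>1\<close> conjugates all the matrices simultaneously.\<close>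

definition equivalent_reps ::
  "('g, 'b) monoid_scheme \<Rightarrow> ('g \<Rightarrow> complex mat) \<Rightarrow> ('g \<Rightarrow> complex mat) \<Rightarrow> bool" where
  "equivalent_reps G \<rho> \<sigma> \<longleftrightarrow> (\<exists>P Q. \<forall>g\<in>carrier G. similar_mat_wit (\<rho> g) (\<sigma> g) P Q)"

definition complete_irreps :: "('g, 'b) monoid_scheme \<Rightarrow> ('g \<Rightarrow> complex mat) set \<Rightarrow> bool" where
  "complete_irreps G R \<longleftrightarrow>
     (\<forall>\<rho>\<in>R. irreducible_rep G \<rho>) \<and>
     (\<forall>\<rho>\<in>R. \<forall>\<sigma>\<in>R. \<rho> \<noteq> \<sigma> \<longrightarrow> \<not> equivalent_reps G \<rho> \<sigma>) \<and>
     (\<forall>\<sigma>. irreducible_rep G \<sigma> \<longrightarrow> (\<exists>\<rho>\<in>R. equivalent_reps G \<sigma> \<rho>))"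


section \<open>The Fourier transform\<close>

definition fourier_at ::
  "('g, 'b) monoid_scheme \<Rightarrow> ('g \<Rightarrow> complex) \<Rightarrow> ('g \<Rightarrow> complex mat) \<Rightarrow> complex mat" where
  "fourier_at G f \<rho> =
     finsum (ring_mat TYPE(complex) (rep_degree G \<rho>) ()) (\<lambda>s. f s \<cdot>\<^sub>m \<rho> s) (carrier G)"

text \<open>The direct sum over \<open>R\<close> is represented by the family of its blocks, indexed by \<open>R\<close>.\<close>

definition fourier ::
  "('g, 'b) monoid_scheme \<Rightarrow> ('g \<Rightarrow> complex mat) set \<Rightarrow> ('g \<Rightarrow> complex) \<Rightarrow>
   (('g \<Rightarrow> complex mat) \<Rightarrow> complex mat)" where
  "fourier G R f = (\<lambda>\<rho>\<in>R. fourier_at G f \<rho>)"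


section \<open>Straight-line programs\<close>

text \<open>An operand is an input, a complex constant, or the result of the instruction with the
  given number (counted from 0).\<close>

datatype 'x operand = Input 'x | Const complex | Result nat

datatype arith_op = Add | Sub | Mul | Div

type_synonym 'x instr = "arith_op \<times> 'x operand \<times> 'x operand"

fun operand_val ::
  "('x \<Rightarrow> complex option) \<Rightarrow> complex list \<Rightarrow> 'x operand \<Rightarrow> complex option" where
  "operand_val inp vs (Input x) = inp x"
| "operand_val inp vs (Const c) = Some c"
| "operand_val inp vs (Result k) = (if k < length vs then Some (vs ! k) else None)"

text \<open>Division by zero is an error here, not 0 as in HOL.\<close>

fun arith_val :: "arith_op \<Rightarrow> complex \<Rightarrow> complex \<Rightarrow> complex option" where
  "arith_val Add x y = Some (x + y)"
| "arith_val Sub x y = Some (x - y)"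
| "arith_val Mul x y = Some (x * y)"
| "arith_val Div x y = (if y = 0 then None else Some (x / y))"

text \<open>The list argument holds the results of the instructions executed so far.\<close>

fun run ::
  "('x \<Rightarrow> complex option) \<Rightarrow> complex list \<Rightarrow> 'x instr list \<Rightarrow> complex list option" where
  "run inp vs [] = Some vs"
| "run inp vs ((c, a, b) # p) =
     Option.bind (operand_val inp vs a) (\<lambda>x.
     Option.bind (operand_val inp vs b) (\<lambda>y.
     Option.bind (arith_val c x y) (\<lambda>z. run inp (vs @ [z]) p)))"

definition additions :: "'x instr list \<Rightarrow> nat" where
  "additions p = length (filter (\<lambda>(c, _, _). c = Add \<or> c = Sub) p)"

definition multiplications :: "'x instr list \<Rightarrow> nat" where
  "multiplications p = length (filter (\<lambda>(c, _, _). c = Mul \<or> c = Div) p)"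

text \<open>The places \<open>out \<rho> i j\<close> where the entries of the transform are found do not depend on \<open>f\<close>,
  and the program has to run without error for every \<open>f\<close>.  Only the values of \<open>f\<close> on
  the group are available as inputs.\<close>

definition computes_fourier ::
  "('g, 'b) monoid_scheme \<Rightarrow> ('g \<Rightarrow> complex mat) set \<Rightarrow> 'g instr list \<Rightarrow> bool" where
  "computes_fourier G R p \<longleftrightarrow>
     (\<exists>out :: ('g \<Rightarrow> complex mat) \<Rightarrow> nat \<Rightarrow> nat \<Rightarrow> 'g operand. \<forall>f :: 'g \<Rightarrow> complex.
        let inp = (Some \<circ> f) |` carrier G in
        \<exists>vs. run inp [] p = Some vs \<and>
          (\<forall>\<rho>\<in>R. \<forall>i < rep_degree G \<rho>. \<forall>j < rep_degree G \<rho>.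
             operand_val inp vs (out \<rho> i j) = Some (fourier G R f \<rho> $$ (i, j))))"


section \<open>Complexity of the Fourier transform\<close>

text \<open>The minima are infima in \<^typ>\<open>enat\<close>, so they are attained, or \<open>\<infinity>\<close> when nothing is
  minimised over; a finite upper bound thus includes existence.  Additions
  and multiplications are minimised separately.\<close>

definition min_additions :: "('g, 'b) monoid_scheme \<Rightarrow> ('g \<Rightarrow> complex mat) set \<Rightarrow> enat" where
  "min_additions G R = (INF p \<in> {p. computes_fourier G R p}. enat (additions p))"

definition min_multiplications :: "('g, 'b) monoid_scheme \<Rightarrow> ('g \<Rightarrow> complex mat) set \<Rightarrow> enat" where
  "min_multiplications G R = (INF p \<in> {p. computes_fourier G R p}. enat (multiplications p))"

definition arith_complexity :: "('g, 'b) monoid_scheme \<Rightarrow> ('g \<Rightarrow> complex mat) set \<Rightarrow> enat" where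
  "arith_complexity G R = max (min_additions G R) (min_multiplications G R)"

definition group_complexity :: "('g, 'b) monoid_scheme \<Rightarrow> enat" where
  "group_complexity G = (INF R \<in> {R. complete_irreps G R}. arith_complexity G R)"


section \<open>The hyperoctahedral group\<close>

text \<open>Signed permutations of \<open>n\<close> letters: the permutations \<open>p\<close> of \<open>{-n, \<dots>, -1, 1, \<dots>, n}\<close> with
  \<open>p (-i) = - p i\<close>, extended by the identity to all integers.\<close>

definition hyperoctahedral :: "nat \<Rightarrow> (int \<Rightarrow> int) monoid" where
  "hyperoctahedral n =
     \<lparr>carrier = {p. p permutes {i. i \<noteq> 0 \<and> \<bar>i\<bar> \<le> int n} \<and> (\<forall>i. p (- i) = - p i)},
      mult = (\<circ>), one = id\<rparr>"

lemma group_hyperoctahedral: "group (hyperoctahedral n)"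
proof (rule groupI)
  fix p assume p: "p \<in> carrier (hyperoctahedral n)"
  let ?S = "{i. i \<noteq> 0 \<and> \<bar>i\<bar> \<le> int n}"
  have perm: "p permutes ?S" and odd: "p (- i) = - p i" for i
    using p by (auto simp: hyperoctahedral_def)
  have "inv_into UNIV p (- i) = - inv_into UNIV p i" for i
    using perm odd by (metis permutes_inverses(1,2))
  then have "inv_into UNIV p \<in> carrier (hyperoctahedral n)"
    using permutes_inv[OF perm] by (auto simp: hyperoctahedral_def)
  moreover have "inv_into UNIV p \<circ> p = id"
    using permutes_inv_o(2)[OF perm] .
  ultimately show "\<exists>q\<in>carrier (hyperoctahedral n).
      q \<otimes>\<^bsub>hyperoctahedral n\<^esub> p = \<one>\<^bsub>hyperoctahedral n\<^esub>"
    by (auto simp: hyperoctahedral_def)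
qed (auto simp: hyperoctahedral_def permutes_compose permutes_id[unfolded id_def] comp_assoc)

end

(*
The bound is achieved by a fast Fourier transform along the tower B_0 < B_1 < ... < B_n.

Choose the irreducible representations of all B_m so that the restriction to B_(m-1) of each one is literally a direct
sum of chosen ones ("children"). No child is repeated, because every element of B_m is conjugate to its inverse under
B_(m-1). Splitting a Fourier sum over B_(m+1) into the cosets of B_m leaves 2(m+1) transforms on B_m, followed for
every irreducible kappa of B_m and every column of kappa by the transform "induced" of a kappa-valued function on the
cosets, whose output is a vector in every "parent" of kappa.

The representative of a coset of B_m in B_(m+1) is 1, the last sign change, or c s, where c is the corresponding
representative one level lower and s is the last adjacent transposition. As s commutes with B_(m-1), its matrix is
given by scalars attached to kappa, mu (children of rho) and a common child theta, and "induced" on level m is obtained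
from "induced" for the children theta of kappa. By independence of matrix coefficients, kappa and mu share exactly one
child if they differ, and kappa has at most c + 2 parents if it has c children. So a coordinate in the summand mu of rho
costs one operation, or c + 1 operations if mu = kappa.

The eigenvalues of the last sign change and of the Jucys-Murphy element behave like the contents of boxes in pairs of
Young diagrams with m boxes, which gives c^2 + 4 c <= 8 m. Hence one level costs (10 m + 2) deg kappa, all levels cost
(m + 1) (5 m + 2) deg kappa, and the recursion for the whole transform solves to m (2 m - 1) |B_m|.
*)

theory Submission
  imports Defs "Jordan_Normal_Form.Spectral_Radius" "HOL-Library.Multiset" "HOL-Combinatorics.Cycles"
begin

section \<open>Irreducible representations of finite groups\<close>

text \<open>The irreducible representations are never classified: no Young diagram, tableau or
  seminormal form is constructed. The numbers of children, of parents and of common children are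
  extracted, in the manner of Okounkov and Vershik, from Schur's lemma, from the independence of
  matrix coefficients and from the relations between \<open>last_flip\<close>,
  \<open>adjacent_swap\<close> and the Jucys-Murphy sum. All dimension counts are inequalities
  obtained from linear independence. The obstacle is the diagonal block mu = kappa. With up to c + 2
  parents its recursive terms cost c (c + 2) deg kappa, which fits into a level cost linear in m
  only if c is of order sqrt m; this is why contents are studied at all. The other terms of a level
  number at most the sum of the degrees of the parents, which is at most the degree 2 (m + 1) deg
  kappa of the induced representation. Since c^2 + 2 c <= 8 m, this gives 10 m + 2, and the sum of
  10 k + 2 over k <= m is (m + 1) (5 m + 2).\<close>

definition rep :: "('g, 'b) monoid_scheme \<Rightarrow> nat \<Rightarrow> ('g \<Rightarrow> complex mat) \<Rightarrow> bool" where
  "rep G d \<rho> \<longleftrightarrow> (\<forall>g\<in>carrier G. \<rho> g \<in> carrier_mat d d) \<and>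
     (\<forall>g\<in>carrier G. \<forall>h\<in>carrier G. \<rho> (g \<otimes>\<^bsub>G\<^esub> h) = \<rho> g * \<rho> h) \<and> \<rho> \<one>\<^bsub>G\<^esub> = 1\<^sub>m d"

lemma subspace_module_vec_iff:
  "VectorSpace.subspace class_ring W (module_vec TYPE(complex) d) \<longleftrightarrow>
     W \<subseteq> carrier_vec d \<and> 0\<^sub>v d \<in> W \<and> (\<forall>v\<in>W. \<forall>w\<in>W. v + w \<in> W) \<and> (\<forall>c. \<forall>v\<in>W. c \<cdot>\<^sub>v v \<in> W)"
  unfolding VectorSpace.subspace_def LinearCombinations.submodule_def
  using vec_vs[where 'a=complex] vec_module[where 'a=complex] by (auto simp: module_vec_simps)

lemma mat_mult_entry:
  assumes "A \<in> carrier_mat a b" "B \<in> carrier_mat b c" "i < a" "j < c"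
  shows "(A * B) $$ (i, j) = (\<Sum>k<b. A $$ (i, k) * B $$ (k, j))"
  using assms by (auto simp: scalar_prod_def atLeast0LessThan intro!: sum.cong)

lemma mult_mat_vec_entry:
  assumes "A \<in> carrier_mat a b" "v \<in> carrier_vec b" "i < a"
  shows "(A *\<^sub>v v) $ i = (\<Sum>k<b. A $$ (i, k) * v $ k)"
  using assms by (auto simp: scalar_prod_def atLeast0LessThan intro!: sum.cong)

context group begin

lemma repD:
  assumes "rep G d \<rho>"
  shows "g \<in> carrier G \<Longrightarrow> \<rho> g \<in> carrier_mat d d"
    and "g \<in> carrier G \<Longrightarrow> h \<in> carrier G \<Longrightarrow> \<rho> (g \<otimes> h) = \<rho> g * \<rho> h"
    and "\<rho> \<one> = 1\<^sub>m d" and "rep_degree G \<rho> = d"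
  using assms by (auto simp: rep_def rep_degree_def)

lemma rep_mult_entry:
  assumes "rep G d \<rho>" "g \<in> carrier G" "h \<in> carrier G" "i < d" "j < d"
  shows "\<rho> (g \<otimes> h) $$ (i, j) = (\<Sum>k<d. \<rho> g $$ (i, k) * \<rho> h $$ (k, j))"
  using repD(1)[OF assms(1)] repD(2)[OF assms(1)] assms(2-) by (simp add: mat_mult_entry[of "\<rho> g" d d "\<rho> h" d i j])

lemma rep_inv_mult:
  assumes "rep G d \<rho>" "g \<in> carrier G"
  shows "\<rho> (inv g) * \<rho> g = 1\<^sub>m d" "\<rho> g * \<rho> (inv g) = 1\<^sub>m d"
  using repD(2,3)[OF assms(1)] assms(2) by (metis inv_closed l_inv r_inv)+

lemma rep_imp_matrix_rep:
  assumes "rep G d \<rho>"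
  shows "matrix_rep G \<rho>"
proof -
  have "\<rho> \<in> hom G (GL d)"
  proof (rule homI)
    fix g assume g: "g \<in> carrier G"
    show "\<rho> g \<in> carrier (GL d)"
      unfolding units_of_carrier Units_def
      using repD(1)[OF assms] rep_inv_mult[OF assms g] g by (auto simp: ring_mat_simps)
  next
    fix g h assume "g \<in> carrier G" "h \<in> carrier G"
    then show "\<rho> (g \<otimes> h) = \<rho> g \<otimes>\<^bsub>GL d\<^esub> \<rho> h"
      using repD(2)[OF assms] by (simp add: units_of_mult ring_mat_simps)
  qed
  then show ?thesis unfolding matrix_rep_def by blast
qed

lemma matrix_rep_imp_rep:
  assumes "matrix_rep G \<rho>"
  shows "rep G (rep_degree G \<rho>) \<rho>"
proof -
  obtain d where hom: "\<rho> \<in> hom G (GL d)" using assms by (auto simp: matrix_rep_def)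
  have un: "\<rho> g \<in> Units (ring_mat TYPE(complex) d ())" if "g \<in> carrier G" for g
    using hom_in_carrier[OF hom that] by (simp add: units_of_carrier)
  then have c: "\<rho> g \<in> carrier_mat d d" if "g \<in> carrier G" for g
    using that by (force simp: Units_def ring_mat_simps)
  have m: "\<rho> (g \<otimes> h) = \<rho> g * \<rho> h" if "g \<in> carrier G" "h \<in> carrier G" for g h
    using hom_mult[OF hom that] by (simp add: units_of_mult ring_mat_simps)
  \<comment> \<open>Membership in \<open>hom\<close> does not mention the unit. The matrix
    \<open>\<rho> \<one>\<close> is idempotent and has a left inverse, so it is the
    identity.\<close>
  obtain B where B: "B \<in> carrier_mat d d" "B * \<rho> \<one> = 1\<^sub>m d"
    using un[OF one_closed] by (auto simp: Units_def ring_mat_simps)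
  have "\<rho> \<one> = (B * \<rho> \<one>) * \<rho> \<one>" using B c[OF one_closed] by simp
  also have "\<dots> = B * (\<rho> \<one> * \<rho> \<one>)" using B(1) c[OF one_closed] by simp
  also have "\<dots> = 1\<^sub>m d" using m[of \<one> \<one>] B by simp
  finally have "\<rho> \<one> = 1\<^sub>m d" .
  then show ?thesis using c m by (auto simp: rep_def rep_degree_def)
qed

lemma invariant_subspaceD:
  assumes "invariant_subspace G \<rho> W" "rep G d \<rho>"
  shows "W \<subseteq> carrier_vec d" "0\<^sub>v d \<in> W" "v \<in> W \<Longrightarrow> w \<in> W \<Longrightarrow> v + w \<in> W"
    "v \<in> W \<Longrightarrow> c \<cdot>\<^sub>v v \<in> W" "g \<in> carrier G \<Longrightarrow> v \<in> W \<Longrightarrow> \<rho> g *\<^sub>v v \<in> W"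
  using assms(1) unfolding invariant_subspace_def repD(4)[OF assms(2)] subspace_module_vec_iff
  by auto

lemma irreducible_repD:
  assumes "irreducible_rep G \<rho>"
  shows "rep G (rep_degree G \<rho>) \<rho>" "rep_degree G \<rho> > 0"
    "invariant_subspace G \<rho> W \<Longrightarrow> W = {0\<^sub>v (rep_degree G \<rho>)} \<or> W = carrier_vec (rep_degree G \<rho>)"
  using assms matrix_rep_imp_rep by (auto simp: irreducible_rep_def)

text \<open>Over the complex numbers \<open>T\<close> has an eigenvalue; its eigenspace is invariant
  and not 0, hence the whole space.\<close>

lemma schur_scalar:
  assumes irr: "irreducible_rep G \<rho>" and d: "d = rep_degree G \<rho>"
    and T: "T \<in> carrier_mat d d" and comm: "\<And>g. g \<in> carrier G \<Longrightarrow> T * \<rho> g = \<rho> g * T"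
  obtains c where "T = c \<cdot>\<^sub>m 1\<^sub>m d"
proof -
  have r: "rep G d \<rho>" and pos: "d > 0" using irreducible_repD[OF irr] d by auto
  obtain c where c: "eigenvalue T c"
    using spectrum_non_empty[OF T] pos by (auto simp: spectrum_def)
  define W where "W = {v \<in> carrier_vec d. T *\<^sub>v v = c \<cdot>\<^sub>v v}"
  have inv: "invariant_subspace G \<rho> W"
    unfolding invariant_subspace_def repD(4)[OF r] subspace_module_vec_iff
  proof (intro conjI ballI allI)
    show "W \<subseteq> carrier_vec d" by (auto simp: W_def)
    show "0\<^sub>v d \<in> W" using T by (auto simp: W_def)
    show "v + w \<in> W" if "v \<in> W" "w \<in> W" for v w
      using that T by (auto simp: W_def mult_add_distrib_mat_vec smult_add_distrib_vec)
    show "a \<cdot>\<^sub>v v \<in> W" if "v \<in> W" for a v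
      using that T by (auto simp: W_def mult_mat_vec smult_smult_assoc mult.commute)
    fix g v assume g: "g \<in> carrier G" and v: "v \<in> W"
    note rg = repD(1)[OF r g]
    have "T *\<^sub>v (\<rho> g *\<^sub>v v) = (T * \<rho> g) *\<^sub>v v" using v rg T by (simp add: W_def)
    also have "\<dots> = \<rho> g *\<^sub>v (T *\<^sub>v v)" unfolding comm[OF g] using v rg T by (simp add: W_def)
    also have "\<dots> = c \<cdot>\<^sub>v (\<rho> g *\<^sub>v v)" using v rg by (simp add: W_def mult_mat_vec)
    finally show "\<rho> g *\<^sub>v v \<in> W" using v rg by (auto simp: W_def)
  qed
  obtain v where "v \<in> carrier_vec d" "v \<noteq> 0\<^sub>v d" "T *\<^sub>v v = c \<cdot>\<^sub>v v"
    using c T by (auto simp: eigenvalue_def eigenvector_def)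
  then have "W \<noteq> {0\<^sub>v d}" by (auto simp: W_def)
  then have W: "W = carrier_vec d" using irreducible_repD(3)[OF irr inv] d by auto
  have "T = c \<cdot>\<^sub>m 1\<^sub>m d"
  proof (rule eq_matI)
    fix i j assume "i < dim_row (c \<cdot>\<^sub>m 1\<^sub>m d)" "j < dim_col (c \<cdot>\<^sub>m 1\<^sub>m d)"
    then have ij: "i < d" "j < d" by auto
    have "unit_vec d j \<in> W" unfolding W by simp
    then have "(T *\<^sub>v unit_vec d j) $ i = (c \<cdot>\<^sub>v unit_vec d j) $ i" by (simp add: W_def)
    then show "T $$ (i, j) = (c \<cdot>\<^sub>m 1\<^sub>m d) $$ (i, j)" using ij T by auto
  qed (use T in auto)
  then show ?thesis by (rule that)
qed

section \<open>Averaging over the group and the orthogonality relations\<close>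

lemma sum_left_translate:
  assumes "h \<in> carrier G"
  shows "(\<Sum>g\<in>carrier G. F (h \<otimes> g)) = (\<Sum>g\<in>carrier G. F g :: 'c :: comm_monoid_add)"
  using assms
  by (intro sum.reindex_bij_witness[of _ "\<lambda>g. inv h \<otimes> g" "\<lambda>g. h \<otimes> g"])
    (auto simp: m_assoc[symmetric])

lemma sum_right_translate:
  assumes "h \<in> carrier G"
  shows "(\<Sum>g\<in>carrier G. F (g \<otimes> h)) = (\<Sum>g\<in>carrier G. F g :: 'c :: comm_monoid_add)"
  using assms
  by (intro sum.reindex_bij_witness[of _ "\<lambda>g. g \<otimes> inv h" "\<lambda>g. g \<otimes> h"])
    (auto simp: m_assoc)

lemma sum_inv:
  "(\<Sum>g\<in>carrier G. F (inv g)) = (\<Sum>g\<in>carrier G. F g :: 'c :: comm_monoid_add)"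
  by (intro sum.reindex_bij_witness[of _ "\<lambda>g. inv g" "\<lambda>g. inv g"]) auto

text \<open>This is the sum over g of \<open>\<rho> g * E * \<sigma> (inv g)\<close>, where E is the
  matrix unit with its 1 in row \<open>l\<close> and column \<open>k\<close>.\<close>

definition averaged :: "('a \<Rightarrow> complex mat) \<Rightarrow> ('a \<Rightarrow> complex mat) \<Rightarrow> nat \<Rightarrow> nat \<Rightarrow> complex mat" where
  "averaged \<rho> \<sigma> l k = mat (rep_degree G \<rho>) (rep_degree G \<sigma>)
     (\<lambda>(i, j). \<Sum>g\<in>carrier G. \<rho> g $$ (i, l) * \<sigma> (inv g) $$ (k, j))"

lemma averaged_intertwines:
  assumes r: "rep G d \<rho>" and s: "rep G e \<sigma>" and l: "l < d" and k: "k < e" and h: "h \<in> carrier G"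
  shows "\<rho> h * averaged \<rho> \<sigma> l k = averaged \<rho> \<sigma> l k * \<sigma> h"
proof (rule eq_matI)
  let ?S = "averaged \<rho> \<sigma> l k"
  have S: "?S \<in> carrier_mat d e" by (simp add: averaged_def repD(4)[OF r] repD(4)[OF s])
  note rh = repD(1)[OF r h] and sh = repD(1)[OF s h]
  fix i j assume "i < dim_row (?S * \<sigma> h)" "j < dim_col (?S * \<sigma> h)"
  then have i: "i < d" and j: "j < e" using S sh by auto
  have "(\<rho> h * ?S) $$ (i, j) = (\<Sum>x<d. \<rho> h $$ (i, x) * ?S $$ (x, j))"
    by (rule mat_mult_entry[OF rh S i j])
  also have "\<dots> = (\<Sum>x<d. \<Sum>g\<in>carrier G. \<rho> h $$ (i, x) * \<rho> g $$ (x, l) * \<sigma> (inv g) $$ (k, j))"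
    using j by (intro sum.cong) (auto simp: averaged_def repD(4)[OF r] repD(4)[OF s] sum_distrib_left mult.assoc)
  also have "\<dots> = (\<Sum>g\<in>carrier G. (\<Sum>x<d. \<rho> h $$ (i, x) * \<rho> g $$ (x, l)) * \<sigma> (inv g) $$ (k, j))"
    by (subst sum.swap) (simp add: sum_distrib_right)
  also have "\<dots> = (\<Sum>g\<in>carrier G. \<rho> (h \<otimes> g) $$ (i, l) * \<sigma> (inv g) $$ (k, j))"
    by (intro sum.cong refl) (simp add: rep_mult_entry[OF r h _ i l])
  \<comment> \<open>Writing \<open>inv g\<close> as \<open>inv (h \<otimes> g) \<otimes> h\<close>
    makes the summand a function of \<open>h \<otimes> g\<close> alone; the translation can then be
    removed, and a factor \<open>\<sigma> h\<close> remains on the right.\<close>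
  also have "\<dots> = (\<Sum>g\<in>carrier G. \<rho> (h \<otimes> g) $$ (i, l) * \<sigma> (inv (h \<otimes> g) \<otimes> h) $$ (k, j))"
    using h by (intro sum.cong refl) (simp add: inv_mult_group m_assoc)
  also have "\<dots> = (\<Sum>g\<in>carrier G. \<rho> g $$ (i, l) * \<sigma> (inv g \<otimes> h) $$ (k, j))"
    by (rule sum_left_translate[OF h, where F = "\<lambda>g. \<rho> g $$ (i, l) * \<sigma> (inv g \<otimes> h) $$ (k, j)"])
  also have "\<dots> = (\<Sum>g\<in>carrier G. \<Sum>x<e. \<rho> g $$ (i, l) * \<sigma> (inv g) $$ (k, x) * \<sigma> h $$ (x, j))"
    by (intro sum.cong refl) (simp add: rep_mult_entry[OF s _ h k j] sum_distrib_left mult.assoc)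
  also have "\<dots> = (\<Sum>x<e. ?S $$ (i, x) * \<sigma> h $$ (x, j))"
    using i by (subst sum.swap)
      (auto intro!: sum.cong simp: averaged_def repD(4)[OF r] repD(4)[OF s] sum_distrib_right)
  also have "\<dots> = (?S * \<sigma> h) $$ (i, j)" by (rule mat_mult_entry[OF S sh i j, symmetric])
  finally show "(\<rho> h * ?S) $$ (i, j) = (?S * \<sigma> h) $$ (i, j)" .
qed (use repD(1)[OF r h] repD(1)[OF s h] in \<open>auto simp: averaged_def repD(4)[OF r] repD(4)[OF s]\<close>)

text \<open>A nonzero intertwiner \<open>T\<close> is invertible: for a suitable averaged matrix unit \<open>S\<close> both
  \<open>S T\<close> and \<open>T S\<close> are scalar, and \<open>tr (S T) \<noteq> 0\<close>.\<close>

lemma intertwiner_imp_equivalent: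
  assumes r: "irreducible_rep G \<rho>" and s: "irreducible_rep G \<sigma>" and fin: "finite (carrier G)"
    and T: "T \<in> carrier_mat (rep_degree G \<sigma>) (rep_degree G \<rho>)"
    and comm: "\<And>g. g \<in> carrier G \<Longrightarrow> \<sigma> g * T = T * \<rho> g"
    and nz: "k < rep_degree G \<sigma>" "l < rep_degree G \<rho>" "T $$ (k, l) \<noteq> 0"
  shows "equivalent_reps G \<rho> \<sigma>"
proof -
  define d e where "d = rep_degree G \<rho>" and "e = rep_degree G \<sigma>"
  have rr: "rep G d \<rho>" and ss: "rep G e \<sigma>"
    using irreducible_repD[OF r] irreducible_repD[OF s] by (auto simp: d_def e_def)
  have T': "T \<in> carrier_mat e d" and k: "k < e" and l: "l < d" using T nz by (auto simp: d_def e_def)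
  define S where "S = averaged \<rho> \<sigma> l k"
  have S: "S \<in> carrier_mat d e" by (simp add: S_def averaged_def d_def e_def)
  have Sint: "\<rho> g * S = S * \<sigma> g" if "g \<in> carrier G" for g
    unfolding S_def by (rule averaged_intertwines[OF rr ss l k that])
  obtain c where c: "S * T = c \<cdot>\<^sub>m 1\<^sub>m d"
  proof (rule schur_scalar[OF r d_def])
    fix g assume g: "g \<in> carrier G"
    note rg = repD(1)[OF rr g] and sg = repD(1)[OF ss g]
    have "S * T * \<rho> g = S * (T * \<rho> g)" using S T' rg by (simp add: assoc_mult_mat)
    also have "\<dots> = (S * \<sigma> g) * T" using S T' sg comm[OF g, symmetric] by (simp add: assoc_mult_mat)
    also have "\<dots> = \<rho> g * (S * T)" using S T' rg Sint[OF g, symmetric] by (simp add: assoc_mult_mat)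
    finally show "S * T * \<rho> g = \<rho> g * (S * T)" .
  qed (use S T' in auto)
  obtain c' where c': "T * S = c' \<cdot>\<^sub>m 1\<^sub>m e"
  proof (rule schur_scalar[OF s e_def])
    fix g assume g: "g \<in> carrier G"
    note rg = repD(1)[OF rr g] and sg = repD(1)[OF ss g]
    have "T * S * \<sigma> g = T * (S * \<sigma> g)" using S T' sg by (simp add: assoc_mult_mat)
    also have "\<dots> = (T * \<rho> g) * S" using S T' rg Sint[OF g, symmetric] by (simp add: assoc_mult_mat)
    also have "\<dots> = \<sigma> g * (T * S)" using S T' sg comm[OF g, symmetric] by (simp add: assoc_mult_mat)
    finally show "T * S * \<sigma> g = \<sigma> g * (T * S)" .
  qed (use S T' in auto)
  have ent1: "(S * T) $$ (i, i) = (\<Sum>x<e. S $$ (i, x) * T $$ (x, i))" if "i < d" for i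
    by (rule mat_mult_entry[OF S T' that that])
  have ent2: "(T * S) $$ (x, x) = (\<Sum>i<d. T $$ (x, i) * S $$ (i, x))" if "x < e" for x
    by (rule mat_mult_entry[OF T' S that that])
  have "of_nat d * c = (\<Sum>i<d. (S * T) $$ (i, i))" unfolding c by simp
  also have "\<dots> = (\<Sum>i<d. \<Sum>x<e. S $$ (i, x) * T $$ (x, i))" by (intro sum.cong) (auto simp: ent1)
  finally have tr1: "of_nat d * c = (\<Sum>i<d. \<Sum>x<e. S $$ (i, x) * T $$ (x, i))" .
  have "of_nat e * c' = (\<Sum>x<e. (T * S) $$ (x, x))" unfolding c' by simp
  also have "\<dots> = (\<Sum>x<e. \<Sum>i<d. T $$ (x, i) * S $$ (i, x))" by (intro sum.cong) (auto simp: ent2)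
  finally have "of_nat e * c' = of_nat d * c" unfolding tr1 by (subst sum.swap) (simp add: mult.commute)
  \<comment> \<open>Expanding the trace of \<open>S * T\<close> gives the sum over g of the entry
    (k, l) of \<open>\<sigma> (inv g) * T * \<rho> g\<close>, and each of these matrices is
    \<open>T\<close> because \<open>T\<close> intertwines. The entry is nonzero by the choice of k
    and l.\<close>
  moreover have "of_nat d * c = of_nat (card (carrier G)) * T $$ (k, l)"
  proof -
    have "of_nat d * c = (\<Sum>i<d. \<Sum>x<e. \<Sum>g\<in>carrier G. \<rho> g $$ (i, l) * \<sigma> (inv g) $$ (k, x) * T $$ (x, i))"
      unfolding tr1 by (intro sum.cong refl)
        (auto simp: S_def averaged_def d_def[symmetric] e_def[symmetric] sum_distrib_right)
    also have "\<dots> = (\<Sum>i<d. \<Sum>g\<in>carrier G. \<Sum>x<e. \<rho> g $$ (i, l) * \<sigma> (inv g) $$ (k, x) * T $$ (x, i))"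
      by (intro sum.cong refl sum.swap)
    also have "\<dots> = (\<Sum>g\<in>carrier G. \<Sum>i<d. \<Sum>x<e. \<rho> g $$ (i, l) * \<sigma> (inv g) $$ (k, x) * T $$ (x, i))"
      by (rule sum.swap)
    also have "\<dots> = (\<Sum>g\<in>carrier G. T $$ (k, l))"
    proof (intro sum.cong refl)
      fix g assume g: "g \<in> carrier G"
      note rg = repD(1)[OF rr g] and sg = repD(1)[OF ss inv_closed[OF g]]
      have "(\<Sum>i<d. \<Sum>x<e. \<rho> g $$ (i, l) * \<sigma> (inv g) $$ (k, x) * T $$ (x, i))
          = (\<Sum>i<d. (\<sigma> (inv g) * T) $$ (k, i) * \<rho> g $$ (i, l))"
        by (intro sum.cong refl) (simp add: mat_mult_entry[OF sg T' k] sum_distrib_left mult_ac)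
      also have "\<dots> = (\<sigma> (inv g) * T * \<rho> g) $$ (k, l)"
        by (rule mat_mult_entry[symmetric]) (use sg T' rg k l in auto)
      also have "\<sigma> (inv g) * T * \<rho> g = \<sigma> (inv g) * (\<sigma> g * T)"
        using sg T' rg comm[OF g] by (simp add: assoc_mult_mat)
      also have "\<dots> = T"
        using sg T' repD(1)[OF ss g] rep_inv_mult(1)[OF ss g]
        by (subst assoc_mult_mat[symmetric, where n\<^sub>2 = e and n\<^sub>3 = e]) auto
      finally show "(\<Sum>i<d. \<Sum>x<e. \<rho> g $$ (i, l) * \<sigma> (inv g) $$ (k, x) * T $$ (x, i)) = T $$ (k, l)" .
    qed
    finally show ?thesis by simp
  qed
  moreover have "card (carrier G) > 0" using fin one_closed card_gt_0_iff by blast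
  ultimately have ec': "of_nat e * c' = of_nat d * c" and cnz: "c \<noteq> 0" using nz(3) by auto
  \<comment> \<open>Evaluating \<open>T * S * T\<close> in both ways gives c = c'. The traces of
    \<open>S * T\<close> and \<open>T * S\<close> agree, so d c = e c', and the two degrees
    coincide.\<close>
  have "T * (S * T) = T * S * T" using S T' by (simp add: assoc_mult_mat)
  then have "(T * (c \<cdot>\<^sub>m 1\<^sub>m d)) $$ (k, l) = ((c' \<cdot>\<^sub>m 1\<^sub>m e) * T) $$ (k, l)" unfolding c c' by simp
  then have "c * T $$ (k, l) = c' * T $$ (k, l)"
    using T' k l by (auto simp: mult_smult_distrib[OF T' one_carrier_mat] mult_smult_assoc_mat[OF one_carrier_mat T'])
  then have cc: "c' = c" using nz(3) by simp
  then have de: "e = d" using ec' cnz by simp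
  define P where "P = inverse c \<cdot>\<^sub>m S"
  have P: "P \<in> carrier_mat d d" using S de by (simp add: P_def)
  have TT: "T \<in> carrier_mat d d" using T' de by simp
  have SS: "S \<in> carrier_mat d d" using S de by simp
  have PT: "P * T = 1\<^sub>m d"
    unfolding P_def mult_smult_assoc_mat[OF SS TT] c using cnz by (auto intro!: eq_matI)
  have TP: "T * P = 1\<^sub>m d"
    unfolding P_def mult_smult_distrib[OF TT SS] c' using cnz cc de by (auto intro!: eq_matI)
  have "similar_mat_wit (\<rho> g) (\<sigma> g) P T" if g: "g \<in> carrier G" for g
  proof (rule similar_mat_witI[OF PT TP _ _ _ P TT])
    show "\<rho> g \<in> carrier_mat d d" "\<sigma> g \<in> carrier_mat d d" using repD(1)[OF rr g] repD(1)[OF ss g] de by auto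
    then have "P * \<sigma> g * T = P * (T * \<rho> g)" using P TT comm[OF g] by (simp add: assoc_mult_mat)
    also have "\<dots> = \<rho> g" using P TT repD(1)[OF rr g] PT by (subst assoc_mult_mat[symmetric]) auto
    finally show "\<rho> g = P * \<sigma> g * T" ..
  qed
  then show ?thesis unfolding equivalent_reps_def by blast
qed

text \<open>A nonzero value would be a nonzero entry of \<open>averaged \<rho> \<sigma> l k\<close>.
  This matrix satisfies \<open>\<rho> h * S = S * \<sigma> h\<close>, so it leads from
  \<open>\<sigma>\<close> to \<open>\<rho>\<close>, which fixes the direction of the
  inequivalence.\<close>

lemma orthogonality_inequivalent:
  assumes "irreducible_rep G \<rho>" "irreducible_rep G \<sigma>" "finite (carrier G)" "\<not> equivalent_reps G \<sigma> \<rho>"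
    "i < rep_degree G \<rho>" "l < rep_degree G \<rho>" "k < rep_degree G \<sigma>" "j < rep_degree G \<sigma>"
  shows "(\<Sum>g\<in>carrier G. \<rho> g $$ (i, l) * \<sigma> (inv g) $$ (k, j)) = 0"
proof (rule ccontr)
  assume "\<not> ?thesis"
  then have "averaged \<rho> \<sigma> l k $$ (i, j) \<noteq> 0" using assms by (simp add: averaged_def)
  then have "equivalent_reps G \<sigma> \<rho>"
    using assms averaged_intertwines[OF irreducible_repD(1)[OF assms(1)] irreducible_repD(1)[OF assms(2)] assms(6,7)]
    by (intro intertwiner_imp_equivalent[where T = "averaged \<rho> \<sigma> l k" and k = i and l = j])
      (simp_all add: averaged_def)
  then show False using assms by simp
qed

text \<open>By Schur's lemma \<open>averaged \<rho> \<rho> l k\<close> is scalar. Its trace is the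
  sum over g of \<open>\<rho> (inv g \<otimes> g) $$ (k, l)\<close>, which determines the
  scalar.\<close>

lemma orthogonality_same:
  assumes irr: "irreducible_rep G \<rho>" and d: "d = rep_degree G \<rho>"
    and ij: "i < d" "l < d" "k < d" "j < d"
  shows "(\<Sum>g\<in>carrier G. \<rho> g $$ (i, l) * \<rho> (inv g) $$ (k, j))
    = (if i = j \<and> k = l then of_nat (card (carrier G)) / of_nat d else 0)"
proof -
  have r: "rep G d \<rho>" and pos: "d > 0" using irreducible_repD[OF irr] d by auto
  have ent: "averaged \<rho> \<rho> l k $$ (x, y) = (\<Sum>g\<in>carrier G. \<rho> g $$ (x, l) * \<rho> (inv g) $$ (k, y))"
    if "x < d" "y < d" for x y using that by (simp add: averaged_def d)
  obtain c where c: "averaged \<rho> \<rho> l k = c \<cdot>\<^sub>m 1\<^sub>m d"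
    using schur_scalar[OF irr d, of "averaged \<rho> \<rho> l k"] averaged_intertwines[OF r r ij(2,3)]
    by (auto simp: averaged_def d)
  have "of_nat d * c = (\<Sum>x<d. averaged \<rho> \<rho> l k $$ (x, x))" unfolding c by simp
  also have "\<dots> = (\<Sum>x<d. \<Sum>g\<in>carrier G. \<rho> g $$ (x, l) * \<rho> (inv g) $$ (k, x))"
    by (intro sum.cong refl) (simp add: ent)
  also have "\<dots> = (\<Sum>g\<in>carrier G. \<Sum>x<d. \<rho> (inv g) $$ (k, x) * \<rho> g $$ (x, l))"
    by (subst sum.swap) (simp add: mult.commute)
  also have "\<dots> = (\<Sum>g\<in>carrier G. \<rho> (inv g \<otimes> g) $$ (k, l))"
    by (intro sum.cong refl rep_mult_entry[OF r _ _ ij(3,2), symmetric]) auto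
  also have "\<dots> = of_nat (card (carrier G)) * (if k = l then 1 else 0)"
    using ij repD(3)[OF r] by simp
  finally have "c = (if k = l then of_nat (card (carrier G)) / of_nat d else 0)"
    using pos by (auto simp: field_simps split: if_splits)
  then show ?thesis unfolding ent[OF ij(1,4), symmetric] c using ij by auto
qed

end

locale finite_group_irreps = group G for G (structure) +
  fixes R :: "('a \<Rightarrow> complex mat) set"
  assumes finite_carrier: "finite (carrier G)" and complete: "complete_irreps G R"
begin

lemma irr: "\<rho> \<in> R \<Longrightarrow> irreducible_rep G \<rho>"
  and inequiv: "\<rho> \<in> R \<Longrightarrow> \<sigma> \<in> R \<Longrightarrow> \<rho> \<noteq> \<sigma> \<Longrightarrow> \<not> equivalent_reps G \<rho> \<sigma>"
  and exhaust: "irreducible_rep G \<sigma> \<Longrightarrow> \<exists>\<rho>\<in>R. equivalent_reps G \<sigma> \<rho>"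
  using complete by (auto simp: complete_irreps_def)

lemma rep_irr: "\<rho> \<in> R \<Longrightarrow> rep G (rep_degree G \<rho>) \<rho>"
  and degree_pos: "\<rho> \<in> R \<Longrightarrow> rep_degree G \<rho> > 0"
  using irr irreducible_repD by auto

lemma card_pos: "card (carrier G) > 0"
  using finite_carrier one_closed card_gt_0_iff by blast

text \<open>Multiplying the relation by \<open>\<sigma> (inv g) $$ (l, k)\<close> and summing over
  the group isolates the coefficient \<open>a \<sigma> k l\<close>.\<close>

lemma matrix_coefficients_independent:
  assumes fin: "finite \<Lambda>" and sub: "\<Lambda> \<subseteq> R"
    and zero: "\<And>g. g \<in> carrier G \<Longrightarrow>
      (\<Sum>\<rho>\<in>\<Lambda>. \<Sum>i<rep_degree G \<rho>. \<Sum>j<rep_degree G \<rho>. a \<rho> i j * \<rho> g $$ (i, j)) = 0"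
    and \<sigma>: "\<sigma> \<in> \<Lambda>" "k < rep_degree G \<sigma>" "l < rep_degree G \<sigma>"
  shows "a \<sigma> k l = 0"
proof -
  let ?d = "rep_degree G"
  let ?N = "of_nat (card (carrier G)) :: complex"
  have orth: "(\<Sum>g\<in>carrier G. \<rho> g $$ (i, j) * \<sigma> (inv g) $$ (l, k))
      = (if \<rho> = \<sigma> \<and> i = k \<and> j = l then ?N / of_nat (?d \<sigma>) else 0)"
    if "\<rho> \<in> \<Lambda>" "i < ?d \<rho>" "j < ?d \<rho>" for \<rho> i j
  proof (cases "\<rho> = \<sigma>")
    case True
    then show ?thesis using orthogonality_same[of \<sigma> "?d \<sigma>" i j l k] irr sub \<sigma> that by auto
  next
    case False
    then have "\<not> equivalent_reps G \<sigma> \<rho>" using inequiv sub \<sigma>(1) that(1) by blast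
    then show ?thesis
      using orthogonality_inequivalent[OF irr irr finite_carrier, of \<rho> \<sigma> i j l k] False sub \<sigma> that by auto
  qed
  have "0 = (\<Sum>g\<in>carrier G. (\<Sum>\<rho>\<in>\<Lambda>. \<Sum>i<?d \<rho>. \<Sum>j<?d \<rho>. a \<rho> i j * \<rho> g $$ (i, j)) * \<sigma> (inv g) $$ (l, k))"
    by (simp add: zero)
  also have "\<dots> = (\<Sum>g\<in>carrier G. \<Sum>\<rho>\<in>\<Lambda>. \<Sum>i<?d \<rho>. \<Sum>j<?d \<rho>. a \<rho> i j * (\<rho> g $$ (i, j) * \<sigma> (inv g) $$ (l, k)))"
    by (simp add: sum_distrib_right mult.assoc)
  also have "\<dots> = (\<Sum>\<rho>\<in>\<Lambda>. \<Sum>g\<in>carrier G. \<Sum>i<?d \<rho>. \<Sum>j<?d \<rho>. a \<rho> i j * (\<rho> g $$ (i, j) * \<sigma> (inv g) $$ (l, k)))"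
    by (rule sum.swap)
  also have "\<dots> = (\<Sum>\<rho>\<in>\<Lambda>. \<Sum>i<?d \<rho>. \<Sum>g\<in>carrier G. \<Sum>j<?d \<rho>. a \<rho> i j * (\<rho> g $$ (i, j) * \<sigma> (inv g) $$ (l, k)))"
    by (intro sum.cong refl) (rule sum.swap)
  also have "\<dots> = (\<Sum>\<rho>\<in>\<Lambda>. \<Sum>i<?d \<rho>. \<Sum>j<?d \<rho>. \<Sum>g\<in>carrier G. a \<rho> i j * (\<rho> g $$ (i, j) * \<sigma> (inv g) $$ (l, k)))"
    by (intro sum.cong refl) (rule sum.swap)
  also have "\<dots> = (\<Sum>\<rho>\<in>\<Lambda>. \<Sum>i<?d \<rho>. \<Sum>j<?d \<rho>. if \<rho> = \<sigma> \<and> i = k \<and> j = l then a \<rho> i j * (?N / of_nat (?d \<sigma>)) else 0)"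
    by (intro sum.cong refl) (simp add: sum_distrib_left[symmetric] orth)
  also have "\<dots> = (\<Sum>\<rho>\<in>\<Lambda>. if \<rho> = \<sigma> then a \<rho> k l * (?N / of_nat (?d \<sigma>)) else 0)"
  proof (intro sum.cong refl)
    fix \<rho> assume "\<rho> \<in> \<Lambda>"
    have "(\<Sum>i<?d \<sigma>. \<Sum>j<?d \<sigma>. if i = k \<and> j = l then a \<sigma> i j * (?N / of_nat (?d \<sigma>)) else 0)
       = (\<Sum>i<?d \<sigma>. if i = k then (\<Sum>j<?d \<sigma>. if j = l then a \<sigma> k j * (?N / of_nat (?d \<sigma>)) else 0) else 0)"
      by (intro sum.cong refl) auto
    also have "\<dots> = a \<sigma> k l * (?N / of_nat (?d \<sigma>))" using \<sigma> by (simp add: sum.delta)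
    finally show "(\<Sum>i<?d \<rho>. \<Sum>j<?d \<rho>. if \<rho> = \<sigma> \<and> i = k \<and> j = l then a \<rho> i j * (?N / of_nat (?d \<sigma>)) else 0)
      = (if \<rho> = \<sigma> then a \<rho> k l * (?N / of_nat (?d \<sigma>)) else 0)" by auto
  qed
  also have "\<dots> = a \<sigma> k l * (?N / of_nat (?d \<sigma>))" using \<sigma> fin by (simp add: sum.delta)
  finally show ?thesis using card_pos degree_pos[of \<sigma>] \<sigma> sub by auto
qed

text \<open>Both halves of Schur's lemma in one formula, for an intertwiner given by its entries:
  between distinct members of \<open>R\<close> only 0 intertwines. All scalar descriptions of blocks
  along the tower come from here.\<close>

lemma intertwiner_entries:
  assumes \<kappa>: "\<kappa> \<in> R" and \<mu>: "\<mu> \<in> R"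
    and T: "\<And>g a b. g \<in> carrier G \<Longrightarrow> a < rep_degree G \<mu> \<Longrightarrow> b < rep_degree G \<kappa> \<Longrightarrow>
       (\<Sum>x<rep_degree G \<mu>. \<mu> g $$ (a, x) * T x b) = (\<Sum>x<rep_degree G \<kappa>. T a x * \<kappa> g $$ (x, b))"
  shows "\<exists>c. \<forall>a<rep_degree G \<mu>. \<forall>b<rep_degree G \<kappa>. T a b = (if \<mu> = \<kappa> \<and> a = b then c else 0)"
proof -
  let ?d = "rep_degree G"
  define M where "M = mat (?d \<mu>) (?d \<kappa>) (\<lambda>(a, b). T a b)"
  have M: "M \<in> carrier_mat (?d \<mu>) (?d \<kappa>)" by (simp add: M_def)
  have comm: "\<mu> g * M = M * \<kappa> g" if g: "g \<in> carrier G" for g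
  proof (rule eq_matI)
    note mg = repD(1)[OF rep_irr[OF \<mu>] g] and kg = repD(1)[OF rep_irr[OF \<kappa>] g]
    fix a b assume "a < dim_row (M * \<kappa> g)" "b < dim_col (M * \<kappa> g)"
    then have ab: "a < ?d \<mu>" "b < ?d \<kappa>" using M kg by auto
    show "(\<mu> g * M) $$ (a, b) = (M * \<kappa> g) $$ (a, b)"
      unfolding mat_mult_entry[OF mg M ab] mat_mult_entry[OF M kg ab]
      using T[OF g ab] ab by (simp add: M_def)
  qed (use repD(1)[OF rep_irr[OF \<mu>] g] repD(1)[OF rep_irr[OF \<kappa>] g] in \<open>auto simp: M_def\<close>)
  show ?thesis
  proof (cases "\<mu> = \<kappa>")
    case True
    obtain c where c: "M = c \<cdot>\<^sub>m 1\<^sub>m (?d \<kappa>)"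
      using schur_scalar[OF irr[OF \<kappa>] refl, of M] M comm True by metis
    show ?thesis
    proof (intro exI[of _ c] allI impI)
      fix a b assume ab: "a < ?d \<mu>" "b < ?d \<kappa>"
      have "T a b = M $$ (a, b)" using ab by (simp add: M_def)
      then show "T a b = (if \<mu> = \<kappa> \<and> a = b then c else 0)" unfolding c using ab True by simp
    qed
  next
    case False
    then have "\<not> equivalent_reps G \<kappa> \<mu>" using inequiv \<kappa> \<mu> by auto
    then have "M $$ (a, b) = 0" if "a < ?d \<mu>" "b < ?d \<kappa>" for a b
      using intertwiner_imp_equivalent[OF irr[OF \<kappa>] irr[OF \<mu>] finite_carrier M comm] that by blast
    then show ?thesis using False by (intro exI[of _ 0]) (auto simp: M_def)
  qed
qed

end

text \<open>Gaussian elimination, one column at a time. The later bounds on sums of degrees, on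
  common children and on parents are instances, each with its own matrix \<open>M\<close>.\<close>

lemma card_le_of_independent_rows:
  fixes M :: "'x \<Rightarrow> 'y \<Rightarrow> complex"
  assumes "finite B" "finite A"
    "\<And>a. (\<forall>y\<in>B. (\<Sum>x\<in>A. a x * M x y) = 0) \<Longrightarrow> \<forall>x\<in>A. a x = 0"
  shows "card A \<le> card B"
  using assms
proof (induction B arbitrary: A M rule: finite_induct)
  case empty
  have "\<forall>x\<in>A. (1::complex) = 0" by (rule empty.prems(2)[of "\<lambda>_. 1"]) simp
  then show ?case by auto
next
  case (insert b B)
  show ?case
  proof (cases "\<exists>z\<in>A. M z b \<noteq> 0")
    case False
    have "card A \<le> card B"
    proof (rule insert.IH[OF insert.prems(1)])
      fix a assume "\<forall>y\<in>B. (\<Sum>x\<in>A. a x * M x y) = 0"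
      then have "\<forall>y\<in>insert b B. (\<Sum>x\<in>A. a x * M x y) = 0" using False by simp
      then show "\<forall>x\<in>A. a x = 0" by (rule insert.prems(2))
    qed
    then show ?thesis using insert.hyps by simp
  next
    case True
    then obtain z where z: "z \<in> A" "M z b \<noteq> 0" by blast
    define M' where "M' x y = M x y - M x b / M z b * M z y" for x y
    have "card (A - {z}) \<le> card B"
    proof (rule insert.IH[of "A - {z}" M'])
      fix a assume a: "\<forall>y\<in>B. (\<Sum>x\<in>A - {z}. a x * M' x y) = 0"
      \<comment> \<open>The coefficient of the pivot row \<open>z\<close> is chosen to make column
        \<open>b\<close> vanish; a relation among the reduced rows thereby becomes one among the
        original rows.\<close>
      define a' where "a' = a (z := - (\<Sum>x\<in>A - {z}. a x * M x b) / M z b)"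
      have eq: "(\<Sum>x\<in>A. a' x * M x y) = (\<Sum>x\<in>A - {z}. a x * M' x y)" for y
      proof -
        have "(\<Sum>x\<in>A. a' x * M x y) = a' z * M z y + (\<Sum>x\<in>A - {z}. a' x * M x y)"
          using insert.prems(1) z by (simp add: sum.remove)
        also have "(\<Sum>x\<in>A - {z}. a' x * M x y) = (\<Sum>x\<in>A - {z}. a x * M x y)"
          by (intro sum.cong) (auto simp: a'_def)
        also have "a' z * M z y = - (\<Sum>x\<in>A - {z}. a x * (M x b / M z b * M z y))"
        proof -
          have "(\<Sum>x\<in>A - {z}. a x * (M x b / M z b * M z y)) = (\<Sum>x\<in>A - {z}. a x * M x b) / M z b * M z y"
            unfolding sum_divide_distrib sum_distrib_right by (intro sum.cong) auto
          then show ?thesis by (simp add: a'_def)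
        qed
        finally show ?thesis by (simp add: M'_def right_diff_distrib sum_subtractf)
      qed
      have "M' x b = 0" for x using z by (simp add: M'_def)
      then have "\<forall>y\<in>insert b B. (\<Sum>x\<in>A. a' x * M x y) = 0" using a by (auto simp: eq)
      then have "\<forall>x\<in>A. a' x = 0" by (rule insert.prems(2))
      then show "\<forall>x\<in>A - {z}. a x = 0" by (auto simp: a'_def split: if_splits)
    qed (use insert.prems(1) in simp)
    then show ?thesis using z insert.prems(1) insert.hyps by simp
  qed
qed

lemma (in finite_group_irreps) sum_degree_squares_le:
  assumes "finite \<Lambda>" "\<Lambda> \<subseteq> R"
  shows "(\<Sum>\<rho>\<in>\<Lambda>. (rep_degree G \<rho>)\<^sup>2) \<le> card (carrier G)"
proof -
  let ?d = "rep_degree G"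
  define X where "X = (SIGMA \<rho>:\<Lambda>. {..<?d \<rho>} \<times> {..<?d \<rho>})"
  have split: "(\<Sum>z\<in>X. F z) = (\<Sum>\<rho>\<in>\<Lambda>. \<Sum>i<?d \<rho>. \<Sum>j<?d \<rho>. F (\<rho>, i, j))" for F :: "_ \<Rightarrow> complex"
    unfolding X_def using assms(1) by (simp add: sum.Sigma sum.cartesian_product case_prod_unfold)
  have "card X \<le> card (carrier G)"
  proof (rule card_le_of_independent_rows[where M = "\<lambda>(\<rho>, i, j) g. \<rho> g $$ (i, j)"])
    fix a assume "\<forall>g\<in>carrier G. (\<Sum>z\<in>X. a z * (case z of (\<rho>, i, j) \<Rightarrow> \<lambda>g. \<rho> g $$ (i, j)) g) = 0"
    then have zero: "(\<Sum>\<rho>\<in>\<Lambda>. \<Sum>i<?d \<rho>. \<Sum>j<?d \<rho>. a (\<rho>, i, j) * \<rho> g $$ (i, j)) = 0" if "g \<in> carrier G" for g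
      using that by (simp add: split)
    have "a (\<rho>, i, j) = 0" if "(\<rho>, i, j) \<in> X" for \<rho> i j
      by (rule matrix_coefficients_independent[OF assms, of "\<lambda>\<rho> i j. a (\<rho>, i, j)"])
        (use that zero in \<open>simp_all add: X_def\<close>)
    then show "\<forall>z\<in>X. a z = 0" by auto
  qed (use assms finite_carrier in \<open>auto simp: X_def\<close>)
  moreover have "card X = (\<Sum>\<rho>\<in>\<Lambda>. (?d \<rho>)\<^sup>2)"
    unfolding X_def using assms(1) by (simp add: card_cartesian_product power2_eq_square)
  ultimately show ?thesis by simp
qed

lemma (in finite_group_irreps) finite_irreps: "finite R"
proof (rule ccontr)
  assume "infinite R"
  then obtain \<Lambda> where L: "finite \<Lambda>" "\<Lambda> \<subseteq> R" "card \<Lambda> = Suc (card (carrier G))"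
    using infinite_arbitrarily_large by metis
  have "card \<Lambda> = (\<Sum>\<rho>\<in>\<Lambda>. 1)" by simp
  also have "\<dots> \<le> (\<Sum>\<rho>\<in>\<Lambda>. (rep_degree G \<rho>)\<^sup>2)"
  proof (rule sum_mono)
    fix \<rho> assume "\<rho> \<in> \<Lambda>"
    then have "rep_degree G \<rho> > 0" using degree_pos L by auto
    then show "1 \<le> (rep_degree G \<rho>)\<^sup>2" by simp
  qed
  also have "\<dots> \<le> card (carrier G)" by (rule sum_degree_squares_le[OF L(1,2)])
  finally show False using L by simp
qed

section \<open>Complete reducibility\<close>

text \<open>Steinitz exchange: among invertible \<open>S\<close> whose first k columns lie in
  \<open>W\<close>, take one with k maximal. A vector of \<open>W\<close> with a nonzero coordinate
  at some i >= k could replace a column and enlarge k.\<close>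

lemma subspace_adapted_basis:
  fixes W :: "complex vec set"
  assumes W: "W \<subseteq> carrier_vec d" "0\<^sub>v d \<in> W"
    "\<And>v w. v \<in> W \<Longrightarrow> w \<in> W \<Longrightarrow> v + w \<in> W" "\<And>c v. v \<in> W \<Longrightarrow> c \<cdot>\<^sub>v v \<in> W"
  obtains S Q k where "S \<in> carrier_mat d d" "Q \<in> carrier_mat d d" "S * Q = 1\<^sub>m d" "Q * S = 1\<^sub>m d" "k \<le> d"
    "\<And>x. x \<in> carrier_vec d \<Longrightarrow> S *\<^sub>v x \<in> W \<longleftrightarrow> (\<forall>i. k \<le> i \<and> i < d \<longrightarrow> x $ i = 0)"
proof -
  define adapted where "adapted S Q k \<longleftrightarrow> S \<in> carrier_mat d d \<and> Q \<in> carrier_mat d d \<and> S * Q = 1\<^sub>m d \<and> Q * S = 1\<^sub>m d \<and> k \<le> d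
    \<and> (\<forall>x\<in>carrier_vec d. (\<forall>i. k \<le> i \<and> i < d \<longrightarrow> x $ i = 0) \<longrightarrow> S *\<^sub>v x \<in> W)" for S Q :: "complex mat" and k
  define K where "K = {k. \<exists>S Q. adapted S Q k}"
  have "x = 0\<^sub>v d" if "x \<in> carrier_vec d" "\<forall>i. 0 \<le> i \<and> i < d \<longrightarrow> x $ i = 0" for x :: "complex vec"
    using that by auto
  then have "adapted (1\<^sub>m d) (1\<^sub>m d) 0" using W(2) by (auto simp: adapted_def)
  then have K0: "0 \<in> K" by (auto simp: K_def)
  have Kle: "K \<subseteq> {..d}" by (auto simp: K_def adapted_def)
  then have finK: "finite K" by (rule finite_subset) simp
  define k where "k = Max K"
  have "k \<in> K" unfolding k_def by (rule Max_in) (use finK K0 in auto)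
  then obtain S Q where ad: "adapted S Q k" by (auto simp: K_def)
  then have S: "S \<in> carrier_mat d d" and Q: "Q \<in> carrier_mat d d" and SQ: "S * Q = 1\<^sub>m d" and QS: "Q * S = 1\<^sub>m d"
    and kd: "k \<le> d"
    and sub: "\<And>x. x \<in> carrier_vec d \<Longrightarrow> (\<And>i. k \<le> i \<Longrightarrow> i < d \<Longrightarrow> x $ i = 0) \<Longrightarrow> S *\<^sub>v x \<in> W"
    by (auto simp: adapted_def)
  have "x $ i = 0" if x: "x \<in> carrier_vec d" and xW: "S *\<^sub>v x \<in> W" and i: "k \<le> i" "i < d" for x i
  proof (rule ccontr)
    assume nz: "x $ i \<noteq> 0"
    define \<pi> where "\<pi> = Transposition.transpose k i"
    have \<pi>: "\<pi> k = i" "\<pi> i = k" "\<pi> (\<pi> c) = c" "\<pi> c < d \<longleftrightarrow> c < d" "\<pi> a = c \<longleftrightarrow> a = \<pi> c" for a c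
    proof -
      show "\<pi> k = i" "\<pi> i = k" and "\<pi> (\<pi> c) = c" for c by (simp_all add: \<pi>_def)
      then show "\<pi> a = c \<longleftrightarrow> a = \<pi> c" by metis
      show "\<pi> c < d \<longleftrightarrow> c < d" using i by (simp add: \<pi>_def Transposition.transpose_def)
    qed
    \<comment> \<open>Column k of \<open>E\<close> is \<open>x\<close>, column i is the k-th unit
      vector and the others are unchanged, so \<open>S * E\<close> has \<open>S *\<^sub>v x\<close>
      in position k. As \<open>x $ i\<close> is not 0, \<open>E\<close> is invertible;
      \<open>F\<close> is its inverse written out.\<close>
    define E where "E = mat d d (\<lambda>(a, c). if c = k then x $ a else if a = \<pi> c then 1 else 0)"
    define F where "F = mat d d (\<lambda>(c, b). if b = i then (if c = k then 1 / x $ i else - x $ (\<pi> c) / x $ i)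
       else if c = \<pi> b then 1 else 0)"
    have E: "E \<in> carrier_mat d d" and F: "F \<in> carrier_mat d d" by (auto simp: E_def F_def)
    have EF: "E * F = 1\<^sub>m d"
    proof (rule eq_matI)
      fix a b assume "a < dim_row (1\<^sub>m d :: complex mat)" "b < dim_col (1\<^sub>m d :: complex mat)"
      then have ab: "a < d" "b < d" by auto
      have kl: "k < d" using i by simp
      have "(E * F) $$ (a, b) = (\<Sum>c<d. E $$ (a, c) * F $$ (c, b))" by (rule mat_mult_entry[OF E F ab])
      also have "\<dots> = (if a = b then 1 else 0)"
      proof (cases "b = i")
        case False
        have "(\<Sum>c<d. E $$ (a, c) * F $$ (c, b)) = (\<Sum>c<d. if c = \<pi> b then E $$ (a, c) else 0)"
          using ab False by (intro sum.cong) (auto simp: F_def)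
        also have "\<dots> = E $$ (a, \<pi> b)" using ab \<pi>(4) by (simp add: sum.delta)
        also have "\<dots> = (if a = b then 1 else 0)" using ab \<pi> False by (auto simp: E_def)
        finally show ?thesis .
      next
        case True
        have "(\<Sum>c<d. E $$ (a, c) * F $$ (c, b))
           = (\<Sum>c<d. if c = k then x $ a / x $ i else if c = \<pi> a then - x $ a / x $ i else 0)"
          using ab True kl \<pi> by (intro sum.cong) (auto simp: E_def F_def)
        also have "\<dots> = (\<Sum>c<d. (if c = k then x $ a / x $ i else 0) + (if c = \<pi> a then (if a = i then 0 else - x $ a / x $ i) else 0))"
          using \<pi> by (intro sum.cong) auto
        also have "\<dots> = (if a = b then 1 else 0)"
          using ab kl nz True \<pi>(4) by (auto simp: sum.distrib sum.delta)
        finally show ?thesis .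
      qed
      finally show "(E * F) $$ (a, b) = 1\<^sub>m d $$ (a, b)" using ab by simp
    qed (use E F in auto)
    have "adapted (S * E) (F * Q) (Suc k)"
      unfolding adapted_def
    proof (intro conjI ballI impI)
      show "S * E \<in> carrier_mat d d" "F * Q \<in> carrier_mat d d" "Suc k \<le> d" using S E F Q i by auto
      have "S * E * (F * Q) = S * (E * F) * Q" using S E F Q by (simp add: assoc_mult_mat[of _ d d _ d _ d])
      also have "\<dots> = 1\<^sub>m d" unfolding EF using S SQ by simp
      finally show "S * E * (F * Q) = 1\<^sub>m d" .
      then show "F * Q * (S * E) = 1\<^sub>m d" using S E F Q by (intro mat_mult_left_right_inverse[of "S * E"]) auto
      fix y :: "complex vec" assume y: "y \<in> carrier_vec d" and y0: "\<forall>i. Suc k \<le> i \<and> i < d \<longrightarrow> y $ i = 0"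
      define z where "z = vec d (\<lambda>c. if c < k then y $ c else 0)"
      have z: "z \<in> carrier_vec d" by (simp add: z_def)
      have "E *\<^sub>v y = (y $ k) \<cdot>\<^sub>v x + z"
      proof (rule eq_vecI)
        fix a assume "a < dim_vec ((y $ k) \<cdot>\<^sub>v x + z)"
        then have a: "a < d" using z by simp
        have "(E *\<^sub>v y) $ a = (\<Sum>c<d. E $$ (a, c) * y $ c)" by (rule mult_mat_vec_entry[OF E y a])
        also have "\<dots> = (\<Sum>c<d. (if c = k then x $ a * y $ c else 0) + (if c = a then z $ a else 0))"
        proof (intro sum.cong refl)
          fix c assume c: "c \<in> {..<d}"
          show "E $$ (a, c) * y $ c = (if c = k then x $ a * y $ c else 0) + (if c = a then z $ a else 0)"
          proof (cases "c < k")
            case True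
            then have "\<pi> c = c" using i by (auto simp: \<pi>_def Transposition.transpose_def)
            then show ?thesis using True a c by (auto simp: E_def z_def)
          next
            case False
            then show ?thesis using a c y0 by (cases "c = k") (auto simp: E_def z_def)
          qed
        qed
        also have "\<dots> = x $ a * y $ k + z $ a" using a i by (simp add: sum.distrib sum.delta)
        finally show "(E *\<^sub>v y) $ a = ((y $ k) \<cdot>\<^sub>v x + z) $ a" using a x z by simp
      qed (use E x z in auto)
      then have "S * E *\<^sub>v y = (y $ k) \<cdot>\<^sub>v (S *\<^sub>v x) + S *\<^sub>v z"
        using S E x y z by (simp add: assoc_mult_mat_vec mult_add_distrib_mat_vec[OF S] mult_mat_vec[OF S])
      moreover have "S *\<^sub>v z \<in> W" by (rule sub[OF z]) (use i in \<open>auto simp: z_def\<close>)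
      ultimately show "S * E *\<^sub>v y \<in> W" using W(3,4) xW by simp
    qed
    then have "Suc k \<in> K" by (auto simp: K_def)
    then show False using Max_ge[OF finK, of "Suc k"] by (simp add: k_def)
  qed
  then have "S *\<^sub>v x \<in> W \<longleftrightarrow> (\<forall>i. k \<le> i \<and> i < d \<longrightarrow> x $ i = 0)" if "x \<in> carrier_vec d" for x
    using sub that by blast
  then show ?thesis using that[OF S Q SQ QS kd] by blast
qed

lemma rep_conjugate:
  fixes G (structure)
  assumes "group G" and r: "rep G d \<rho>" and S: "S \<in> carrier_mat d d" and Q: "Q \<in> carrier_mat d d"
    and SQ: "S * Q = 1\<^sub>m d" and QS: "Q * S = 1\<^sub>m d"
  shows "rep G d (\<lambda>g. Q * \<rho> g * S)" "g \<in> carrier G \<Longrightarrow> similar_mat_wit (\<rho> g) (Q * \<rho> g * S) S Q"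
proof -
  interpret group G by fact
  note a = assoc_mult_mat[of _ d d _ d _ d]
  show "rep G d (\<lambda>g. Q * \<rho> g * S)"
    unfolding rep_def
  proof (intro conjI ballI)
    fix g h assume gh: "g \<in> carrier G" "h \<in> carrier G"
    note c = repD(1)[OF r gh(1)] repD(1)[OF r gh(2)]
    have "Q * \<rho> g * S * (Q * \<rho> h * S) = Q * \<rho> g * (S * Q) * \<rho> h * S" using S Q c by (simp add: a)
    also have "\<dots> = Q * (\<rho> g * \<rho> h) * S" unfolding SQ using S Q c by (simp add: a)
    finally show "Q * \<rho> (g \<otimes> h) * S = Q * \<rho> g * S * (Q * \<rho> h * S)" using repD(2)[OF r gh] by simp
  next
    show "Q * \<rho> \<one> * S = 1\<^sub>m d" using repD(3)[OF r] Q QS by simp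
  qed (use S Q repD(1)[OF r] in auto)
  assume g: "g \<in> carrier G"
  note c = repD(1)[OF r g]
  show "similar_mat_wit (\<rho> g) (Q * \<rho> g * S) S Q"
  proof (rule similar_mat_witI[OF SQ QS _ c _ S Q])
    have "S * (Q * \<rho> g * S) * Q = (S * Q) * \<rho> g * (S * Q)" using S Q c by (simp add: a)
    then show "\<rho> g = S * (Q * \<rho> g * S) * Q" unfolding SQ using c by simp
  qed (use S Q c in auto)
qed

text \<open>With \<open>\<rho> = (A, B; 0, D)\<close>, averaging \<open>B(g) D(g\<^sup>-\<^sup>1)\<close> over the group gives a matrix \<open>U\<close> such
  that conjugation by \<open>1 + U\<close> removes the corner \<open>B\<close>.\<close>

lemma maschke_triangular:
  fixes G (structure)
  assumes "group G" and fin: "finite (carrier G)" and r: "rep G d \<rho>" and kd: "k \<le> d"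
    and tri: "\<And>g i j. g \<in> carrier G \<Longrightarrow> k \<le> i \<Longrightarrow> i < d \<Longrightarrow> j < k \<Longrightarrow> \<rho> g $$ (i, j) = 0"
  obtains M N where "M \<in> carrier_mat d d" "N \<in> carrier_mat d d" "M * N = 1\<^sub>m d" "N * M = 1\<^sub>m d"
    "\<And>g i j. g \<in> carrier G \<Longrightarrow> i < d \<Longrightarrow> j < d \<Longrightarrow> (i < k) \<noteq> (j < k) \<Longrightarrow> (N * \<rho> g * M) $$ (i, j) = 0"
proof -
  interpret group G by fact
  let ?n = "of_nat (card (carrier G)) :: complex"
  have n: "?n \<noteq> 0" using fin one_closed card_gt_0_iff by force
  define t where "t i j = (\<Sum>g\<in>carrier G. \<Sum>x=k..<d. \<rho> g $$ (i, x) * \<rho> (inv g) $$ (x, j)) / ?n" for i j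
  have nt: "?n * t i j = (\<Sum>g\<in>carrier G. \<Sum>x=k..<d. \<rho> g $$ (i, x) * \<rho> (inv g) $$ (x, j))" for i j
    using n by (simp add: t_def)
  define U where "U = mat d d (\<lambda>(i, j). if i < k \<and> k \<le> j then t i j else 0)"
  have U: "U \<in> carrier_mat d d" by (simp add: U_def)
  have split: "(\<Sum>x<d. F x) = (\<Sum>x<k. F x) + (\<Sum>x=k..<d. F x)" for F :: "nat \<Rightarrow> complex"
    using kd by (simp add: lessThan_atLeast0 sum.atLeastLessThan_concat)
  \<comment> \<open>\<open>U\<close> lives in the upper right corner only, so it squares to 0 and 1
    - U is the inverse of 1 + U.\<close>
  have UU: "U * U = 0\<^sub>m d d"
  proof (rule eq_matI)
    fix i j assume "i < dim_row (0\<^sub>m d d :: complex mat)" "j < dim_col (0\<^sub>m d d :: complex mat)"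
    then have ij: "i < d" "j < d" by auto
    show "(U * U) $$ (i, j) = 0\<^sub>m d d $$ (i, j)"
      unfolding mat_mult_entry[OF U U ij] using ij by (auto simp: U_def intro!: sum.neutral)
  qed (use U in auto)
  define M where "M = 1\<^sub>m d + U"
  define N where "N = 1\<^sub>m d - U"
  have M: "M \<in> carrier_mat d d" and N: "N \<in> carrier_mat d d" using U by (auto simp: M_def N_def)
  have "M * N = (1\<^sub>m d + U) * 1\<^sub>m d - (1\<^sub>m d + U) * U"
    unfolding M_def N_def by (rule mult_minus_distrib_mat[of _ d d]) (use U in auto)
  also have "(1\<^sub>m d + U) * U = U" using U UU by (simp add: add_mult_distrib_mat[of _ d d])
  finally have MN: "M * N = 1\<^sub>m d" using U by (auto intro!: eq_matI)
  then have NM: "N * M = 1\<^sub>m d" by (rule mat_mult_left_right_inverse[OF M N])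
  have "(N * \<rho> h * M) $$ (i, j) = 0" if h: "h \<in> carrier G" and ij: "i < d" "j < d" "(i < k) \<noteq> (j < k)" for h i j
  proof -
    note rh = repD(1)[OF r h]
    have rU: "(\<rho> h * U) $$ (a, b) = (if k \<le> b then (\<Sum>y<k. \<rho> h $$ (a, y) * t y b) else 0)" if "a < d" "b < d" for a b
      unfolding mat_mult_entry[OF rh U that] split using that kd by (auto simp: U_def intro!: sum.cong sum.neutral)
    have Ur: "(U * \<rho> h) $$ (a, b) = (if a < k then (\<Sum>y=k..<d. t a y * \<rho> h $$ (y, b)) else 0)" if "a < d" "b < d" for a b
      unfolding mat_mult_entry[OF U rh that] split using that kd by (auto simp: U_def intro!: sum.cong sum.neutral)
    have UrU: "(U * \<rho> h * U) $$ (a, b) = 0" if "a < d" "b < d" for a b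
    proof -
      have Urc: "U * \<rho> h \<in> carrier_mat d d" using U rh by simp
      show ?thesis
        unfolding mat_mult_entry[OF Urc U that]
      proof (rule sum.neutral, safe)
        fix y assume y: "y < d"
        show "(U * \<rho> h) $$ (a, y) * U $$ (y, b) = 0"
        proof (cases "y < k")
          case True
          then show ?thesis unfolding Ur[OF that(1) y] using tri[OF h] by simp
        next
          case False
          then show ?thesis using y that by (simp add: U_def)
        qed
      qed
    qed
    have "N * \<rho> h = \<rho> h - U * \<rho> h"
      unfolding N_def by (subst minus_mult_distrib_mat[of _ d d]) (use U rh in auto)
    then have "N * \<rho> h * M = (\<rho> h - U * \<rho> h) + (\<rho> h - U * \<rho> h) * U"
      unfolding M_def by (subst mult_add_distrib_mat[of _ d d]) (use U rh in auto)
    also have "(\<rho> h - U * \<rho> h) * U = \<rho> h * U - U * \<rho> h * U"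
      by (rule minus_mult_distrib_mat[of _ d d]) (use U rh in auto)
    finally have e: "(N * \<rho> h * M) $$ (i, j) = \<rho> h $$ (i, j) - (U * \<rho> h) $$ (i, j) + (\<rho> h * U) $$ (i, j)"
      using ij U rh UrU[OF ij(1,2)] by simp
    show ?thesis
    proof (cases "i < k")
      case False
      then show ?thesis unfolding e rU[OF ij(1,2)] Ur[OF ij(1,2)] using ij tri[OF h] by auto
    next
      case True
      then have j: "k \<le> j" using ij by auto
      have sw: "\<rho> (g \<otimes> g') $$ (a, b) = (\<Sum>y<k. \<rho> g $$ (a, y) * \<rho> g' $$ (y, b)) + (\<Sum>y=k..<d. \<rho> g $$ (a, y) * \<rho> g' $$ (y, b))"
        if "g \<in> carrier G" "g' \<in> carrier G" "a < d" "b < d" for g g' a b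
        using rep_mult_entry[OF r that] split by simp
      have low: "\<rho> (g \<otimes> g') $$ (a, b) = (\<Sum>y=k..<d. \<rho> g $$ (a, y) * \<rho> g' $$ (y, b))"
        if "g \<in> carrier G" "g' \<in> carrier G" "k \<le> a" "a < d" "b < d" for g g' a b
        using sw[OF that(1,2,4,5)] tri[OF that(1) that(3,4)] by simp
      \<comment> \<open>With A, B, D the blocks of \<open>\<rho>\<close>, the remaining claim is
        A(h) U = U D(h) - B(h). It follows from A(h) B(g) = B(h g) - B(h) D(g): multiply by the
        block D of the inverse of g, sum over g, and substitute h g for g in the first term.\<close>
      have "?n * (\<Sum>y<k. \<rho> h $$ (i, y) * t y j) = (\<Sum>y<k. \<rho> h $$ (i, y) * (?n * t y j))"
        by (simp add: sum_distrib_left mult.left_commute)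
      also have "\<dots> = (\<Sum>y<k. \<Sum>g\<in>carrier G. \<Sum>x=k..<d. \<rho> h $$ (i, y) * \<rho> g $$ (y, x) * \<rho> (inv g) $$ (x, j))"
        unfolding nt by (simp add: sum_distrib_left mult.assoc)
      also have "\<dots> = (\<Sum>g\<in>carrier G. \<Sum>y<k. \<Sum>x=k..<d. \<rho> h $$ (i, y) * \<rho> g $$ (y, x) * \<rho> (inv g) $$ (x, j))"
        by (rule sum.swap)
      also have "\<dots> = (\<Sum>g\<in>carrier G. \<Sum>x=k..<d. (\<Sum>y<k. \<rho> h $$ (i, y) * \<rho> g $$ (y, x)) * \<rho> (inv g) $$ (x, j))"
        by (rule sum.cong[OF refl], subst sum.swap) (simp add: sum_distrib_right)
      also have "\<dots> = (\<Sum>g\<in>carrier G. \<Sum>x=k..<d.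
          (\<rho> (h \<otimes> g) $$ (i, x) - (\<Sum>y=k..<d. \<rho> h $$ (i, y) * \<rho> g $$ (y, x))) * \<rho> (inv g) $$ (x, j))"
        by (intro sum.cong refl) (use sw[OF h _ ij(1)] in simp)
      also have "\<dots> = (\<Sum>g\<in>carrier G. \<Sum>x=k..<d. \<rho> (h \<otimes> g) $$ (i, x) * \<rho> (inv g) $$ (x, j))
          - (\<Sum>g\<in>carrier G. \<Sum>x=k..<d. \<Sum>y=k..<d. \<rho> h $$ (i, y) * \<rho> g $$ (y, x) * \<rho> (inv g) $$ (x, j))"
        by (simp add: left_diff_distrib sum_subtractf sum_distrib_right)
      also have "(\<Sum>g\<in>carrier G. \<Sum>x=k..<d. \<Sum>y=k..<d. \<rho> h $$ (i, y) * \<rho> g $$ (y, x) * \<rho> (inv g) $$ (x, j))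
          = ?n * \<rho> h $$ (i, j)"
      proof -
        have "(\<Sum>x=k..<d. \<Sum>y=k..<d. \<rho> h $$ (i, y) * \<rho> g $$ (y, x) * \<rho> (inv g) $$ (x, j)) = \<rho> h $$ (i, j)"
          if g: "g \<in> carrier G" for g
        proof -
          have "(\<Sum>x=k..<d. \<Sum>y=k..<d. \<rho> h $$ (i, y) * \<rho> g $$ (y, x) * \<rho> (inv g) $$ (x, j))
             = (\<Sum>y=k..<d. \<rho> h $$ (i, y) * (\<Sum>x=k..<d. \<rho> g $$ (y, x) * \<rho> (inv g) $$ (x, j)))"
            by (subst sum.swap) (simp add: sum_distrib_left mult.assoc)
          also have "\<dots> = (\<Sum>y=k..<d. \<rho> h $$ (i, y) * \<rho> (g \<otimes> inv g) $$ (y, j))"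
            using low[OF g inv_closed[OF g] _ _ ij(2)] by (intro sum.cong) auto
          also have "\<dots> = (\<Sum>y=k..<d. if y = j then \<rho> h $$ (i, j) else 0)"
            using g repD(3)[OF r] ij by (intro sum.cong) auto
          also have "\<dots> = \<rho> h $$ (i, j)" using ij j by (simp add: sum.delta)
          finally show ?thesis .
        qed
        then show ?thesis by simp
      qed
      also have "(\<Sum>g\<in>carrier G. \<Sum>x=k..<d. \<rho> (h \<otimes> g) $$ (i, x) * \<rho> (inv g) $$ (x, j))
          = (\<Sum>g\<in>carrier G. \<Sum>x=k..<d. \<rho> (h \<otimes> g) $$ (i, x) * \<rho> (inv (h \<otimes> g) \<otimes> h) $$ (x, j))"
        using h by (intro sum.cong refl) (simp add: inv_mult_group m_assoc)
      also have "\<dots> = (\<Sum>g\<in>carrier G. \<Sum>x=k..<d. \<rho> g $$ (i, x) * \<rho> (inv g \<otimes> h) $$ (x, j))"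
        by (rule sum_left_translate[OF h, where F = "\<lambda>g. \<Sum>x=k..<d. \<rho> g $$ (i, x) * \<rho> (inv g \<otimes> h) $$ (x, j)"])
      also have "\<dots> = (\<Sum>g\<in>carrier G. \<Sum>x=k..<d. \<Sum>y=k..<d. \<rho> g $$ (i, x) * \<rho> (inv g) $$ (x, y) * \<rho> h $$ (y, j))"
        using low[OF inv_closed h _ _ ij(2)] by (intro sum.cong refl) (auto simp: sum_distrib_left mult.assoc)
      also have "\<dots> = (\<Sum>g\<in>carrier G. \<Sum>y=k..<d. \<Sum>x=k..<d. \<rho> g $$ (i, x) * \<rho> (inv g) $$ (x, y) * \<rho> h $$ (y, j))"
        by (intro sum.cong refl sum.swap)
      also have "\<dots> = (\<Sum>y=k..<d. \<Sum>g\<in>carrier G. \<Sum>x=k..<d. \<rho> g $$ (i, x) * \<rho> (inv g) $$ (x, y) * \<rho> h $$ (y, j))"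
        by (rule sum.swap)
      also have "\<dots> = (\<Sum>y=k..<d. ?n * t i y * \<rho> h $$ (y, j))"
        unfolding nt by (simp add: sum_distrib_right)
      also have "\<dots> = ?n * (\<Sum>y=k..<d. t i y * \<rho> h $$ (y, j))"
        by (simp add: sum_distrib_left mult.assoc)
      finally have "?n * (\<Sum>y<k. \<rho> h $$ (i, y) * t y j) = ?n * ((\<Sum>y=k..<d. t i y * \<rho> h $$ (y, j)) - \<rho> h $$ (i, j))"
        by (simp add: right_diff_distrib)
      then have "(\<Sum>y<k. \<rho> h $$ (i, y) * t y j) = (\<Sum>y=k..<d. t i y * \<rho> h $$ (y, j)) - \<rho> h $$ (i, j)"
        using n by simp
      then show ?thesis unfolding e rU[OF ij(1,2)] Ur[OF ij(1,2)] using True j by simp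
    qed
  qed
  then show ?thesis using that[OF M N MN NM] by blast
qed

text \<open>Two changes of basis are composed: one adapted to \<open>W\<close>, which makes all
  \<open>\<rho> g\<close> block triangular, and the one from Maschke's averaging, which clears the
  corner.\<close>

lemma reducible_split:
  fixes G (structure)
  assumes grp: "group G" and fin: "finite (carrier G)" and r: "rep G d \<rho>" and W: "invariant_subspace G \<rho> W"
    and proper: "W \<noteq> {0\<^sub>v d}" "W \<noteq> carrier_vec d"
  obtains d1 d2 \<rho>1 \<rho>2 P Q where "d = d1 + d2" "d1 > 0" "d2 > 0" "rep G d1 \<rho>1" "rep G d2 \<rho>2"
    "\<And>g. g \<in> carrier G \<Longrightarrow> similar_mat_wit (\<rho> g) (four_block_mat (\<rho>1 g) (0\<^sub>m d1 d2) (0\<^sub>m d2 d1) (\<rho>2 g)) P Q"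
proof -
  interpret group G by fact
  obtain S T k where S: "S \<in> carrier_mat d d" and T: "T \<in> carrier_mat d d" and ST: "S * T = 1\<^sub>m d" "T * S = 1\<^sub>m d"
    and kd: "k \<le> d" and SW: "\<And>x. x \<in> carrier_vec d \<Longrightarrow> S *\<^sub>v x \<in> W \<longleftrightarrow> (\<forall>i. k \<le> i \<and> i < d \<longrightarrow> x $ i = 0)"
    by (rule subspace_adapted_basis[OF invariant_subspaceD(1,2)[OF W r] invariant_subspaceD(3,4)[OF W r]])
      (assumption | (rule that; assumption))+
  have WS: "w = S *\<^sub>v (T *\<^sub>v w)" if "w \<in> carrier_vec d" for w
    using that S T ST by (simp add: assoc_mult_mat_vec[symmetric])
  have k0: "0 < k"
  proof (rule ccontr)
    assume k0: "\<not> 0 < k"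
    have "w = 0\<^sub>v d" if "w \<in> W" for w
    proof -
      have w: "w \<in> carrier_vec d" using that invariant_subspaceD(1)[OF W r] by auto
      then have "\<forall>i. k \<le> i \<and> i < d \<longrightarrow> (T *\<^sub>v w) $ i = 0" using SW[of "T *\<^sub>v w"] WS[OF w] T that by simp
      then have "T *\<^sub>v w = 0\<^sub>v d" using k0 T by (intro eq_vecI) auto
      then show ?thesis using WS[OF w] S by auto
    qed
    then have "W = {0\<^sub>v d}" using invariant_subspaceD(2)[OF W r] by blast
    then show False using proper(1) by simp
  qed
  have kd': "k < d"
  proof (rule ccontr)
    assume kd'': "\<not> k < d"
    have "w \<in> W" if w: "w \<in> carrier_vec d" for w
    proof -
      have "S *\<^sub>v (T *\<^sub>v w) \<in> W" by (subst SW) (use T w kd'' in auto)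
      then show ?thesis using WS[OF w, symmetric] by simp
    qed
    then have "W = carrier_vec d" using invariant_subspaceD(1)[OF W r] by blast
    then show False using proper(2) by simp
  qed
  define \<rho>' where "\<rho>' g = T * \<rho> g * S" for g
  have r': "rep G d \<rho>'" and sim: "\<And>g. g \<in> carrier G \<Longrightarrow> similar_mat_wit (\<rho> g) (\<rho>' g) S T"
    unfolding \<rho>'_def using rep_conjugate[OF grp r S T ST] by auto
  have tri: "\<rho>' g $$ (i, j) = 0" if g: "g \<in> carrier G" and i: "k \<le> i" "i < d" and j: "j < k" for g i j
  proof -
    note rg = repD(1)[OF r g] and rg' = repD(1)[OF r' g]
    have jd: "j < d" using j kd by simp
    have "S *\<^sub>v unit_vec d j \<in> W" using j by (subst SW) auto
    then have "\<rho> g *\<^sub>v (S *\<^sub>v unit_vec d j) \<in> W" by (rule invariant_subspaceD(5)[OF W r g])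
    moreover have "S *\<^sub>v (\<rho>' g *\<^sub>v unit_vec d j) = S * \<rho>' g *\<^sub>v unit_vec d j"
      using S rg' by (intro assoc_mult_mat_vec[symmetric]) auto
    moreover have "S * \<rho>' g = \<rho> g * S"
    proof -
      have "S * \<rho>' g = S * T * \<rho> g * S" unfolding \<rho>'_def using S T rg by (simp add: assoc_mult_mat[of _ d d _ d _ d])
      then show ?thesis using ST rg by simp
    qed
    moreover have "\<rho> g * S *\<^sub>v unit_vec d j = \<rho> g *\<^sub>v (S *\<^sub>v unit_vec d j)"
      using S rg by (intro assoc_mult_mat_vec) auto
    ultimately have "S *\<^sub>v (\<rho>' g *\<^sub>v unit_vec d j) \<in> W" by simp
    then have "(\<rho>' g *\<^sub>v unit_vec d j) $ i = 0" using i rg' by (subst (asm) SW) auto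
    then show ?thesis using rg' i jd by simp
  qed
  obtain M N where M: "M \<in> carrier_mat d d" and N: "N \<in> carrier_mat d d" and MN: "M * N = 1\<^sub>m d" "N * M = 1\<^sub>m d"
    and zero: "\<And>g i j. g \<in> carrier G \<Longrightarrow> i < d \<Longrightarrow> j < d \<Longrightarrow> (i < k) \<noteq> (j < k) \<Longrightarrow> (N * \<rho>' g * M) $$ (i, j) = 0"
    by (rule maschke_triangular[OF grp fin r' kd tri]) (assumption | (rule that; assumption))+
  define \<tau> where "\<tau> g = N * \<rho>' g * M" for g
  have t: "rep G d \<tau>" and sim': "\<And>g. g \<in> carrier G \<Longrightarrow> similar_mat_wit (\<rho>' g) (\<tau> g) M N"
    unfolding \<tau>_def using rep_conjugate[OF grp r' M N MN] by auto
  have tz: "\<tau> g $$ (i, j) = 0" if "g \<in> carrier G" "i < d" "j < d" "(i < k) \<noteq> (j < k)" for g i j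
    unfolding \<tau>_def using zero that by auto
  define \<rho>1 where "\<rho>1 g = mat k k (\<lambda>(i, j). \<tau> g $$ (i, j))" for g
  define \<rho>2 where "\<rho>2 g = mat (d - k) (d - k) (\<lambda>(i, j). \<tau> g $$ (i + k, j + k))" for g
  have split: "(\<Sum>x<d. F x) = (\<Sum>x<k. F x) + (\<Sum>x<d-k. F (x + k))" for F :: "nat \<Rightarrow> complex"
  proof -
    have "(\<Sum>x<d. F x) = (\<Sum>x<k. F x) + (\<Sum>x=k..<d. F x)"
      using kd by (simp add: lessThan_atLeast0 sum.atLeastLessThan_concat)
    also have "(\<Sum>x=k..<d. F x) = (\<Sum>x<d-k. F (x + k))"
      using kd sum.shift_bounds_nat_ivl[of F 0 k "d - k"] by (simp add: lessThan_atLeast0)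
    finally show ?thesis .
  qed
  have r1: "rep G k \<rho>1"
    unfolding rep_def
  proof (intro conjI ballI)
    fix g h assume gh: "g \<in> carrier G" "h \<in> carrier G"
    show "\<rho>1 (g \<otimes> h) = \<rho>1 g * \<rho>1 h"
    proof (rule eq_matI)
      fix i j assume "i < dim_row (\<rho>1 g * \<rho>1 h)" "j < dim_col (\<rho>1 g * \<rho>1 h)"
      then have ij: "i < k" "j < k" by (auto simp: \<rho>1_def)
      have "\<rho>1 (g \<otimes> h) $$ (i, j) = (\<Sum>x<k. \<tau> g $$ (i, x) * \<tau> h $$ (x, j))"
        using ij kd' rep_mult_entry[OF t gh, of i j] tz[OF gh(1), of i] by (simp add: \<rho>1_def split)
      also have "\<dots> = (\<rho>1 g * \<rho>1 h) $$ (i, j)"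
        using ij by (subst mat_mult_entry[of _ k k _ k]) (auto simp: \<rho>1_def)
      finally show "\<rho>1 (g \<otimes> h) $$ (i, j) = (\<rho>1 g * \<rho>1 h) $$ (i, j)" .
    qed (auto simp: \<rho>1_def)
  next
    show "\<rho>1 \<one> = 1\<^sub>m k" using repD(3)[OF t] kd by (auto simp: \<rho>1_def intro!: eq_matI)
  qed (auto simp: \<rho>1_def)
  have r2: "rep G (d - k) \<rho>2"
    unfolding rep_def
  proof (intro conjI ballI)
    fix g h assume gh: "g \<in> carrier G" "h \<in> carrier G"
    show "\<rho>2 (g \<otimes> h) = \<rho>2 g * \<rho>2 h"
    proof (rule eq_matI)
      fix i j assume "i < dim_row (\<rho>2 g * \<rho>2 h)" "j < dim_col (\<rho>2 g * \<rho>2 h)"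
      then have ij: "i < d - k" "j < d - k" by (auto simp: \<rho>2_def)
      have "\<rho>2 (g \<otimes> h) $$ (i, j) = (\<Sum>x<d-k. \<tau> g $$ (i + k, x + k) * \<tau> h $$ (x + k, j + k))"
        using ij kd' rep_mult_entry[OF t gh, of "i + k" "j + k"] tz[OF gh(1), of "i + k"] by (simp add: \<rho>2_def split)
      also have "\<dots> = (\<rho>2 g * \<rho>2 h) $$ (i, j)"
        using ij by (subst mat_mult_entry[of _ "d - k" "d - k" _ "d - k"]) (auto simp: \<rho>2_def)
      finally show "\<rho>2 (g \<otimes> h) $$ (i, j) = (\<rho>2 g * \<rho>2 h) $$ (i, j)" .
    qed (auto simp: \<rho>2_def)
  next
    show "\<rho>2 \<one> = 1\<^sub>m (d - k)" using repD(3)[OF t] kd by (auto simp: \<rho>2_def intro!: eq_matI)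
  qed (auto simp: \<rho>2_def)
  have blocks: "\<tau> g = four_block_mat (\<rho>1 g) (0\<^sub>m k (d - k)) (0\<^sub>m (d - k) k) (\<rho>2 g)" if g: "g \<in> carrier G" for g
    using repD(1)[OF t g] tz[OF g] kd' by (intro eq_matI) (auto simp: \<rho>1_def \<rho>2_def)
  have "similar_mat_wit (\<rho> g) (four_block_mat (\<rho>1 g) (0\<^sub>m k (d - k)) (0\<^sub>m (d - k) k) (\<rho>2 g)) (S * M) (N * T)"
    if "g \<in> carrier G" for g
    using similar_mat_wit_trans[OF sim[OF that] sim'[OF that]] blocks[OF that] by simp
  then show ?thesis using that[of k "d - k" \<rho>1 \<rho>2 "S * M" "N * T"] k0 kd' r1 r2 by auto
qed

lemma equivalent_reps_sym: "equivalent_reps G \<rho> \<sigma> \<Longrightarrow> equivalent_reps G \<sigma> \<rho>"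
  unfolding equivalent_reps_def using similar_mat_wit_sym by blast

lemma equivalent_reps_trans:
  assumes "equivalent_reps G \<rho> \<sigma>" "equivalent_reps G \<sigma> \<tau>"
  shows "equivalent_reps G \<rho> \<tau>"
proof -
  obtain P Q P' Q' where "\<forall>g\<in>carrier G. similar_mat_wit (\<rho> g) (\<sigma> g) P Q"
    "\<forall>g\<in>carrier G. similar_mat_wit (\<sigma> g) (\<tau> g) P' Q'"
    using assms by (auto simp: equivalent_reps_def)
  then have "\<forall>g\<in>carrier G. similar_mat_wit (\<rho> g) (\<tau> g) (P * P') (Q' * Q)"
    using similar_mat_wit_trans by blast
  then show ?thesis unfolding equivalent_reps_def by blast
qed

text \<open>The pair P, Q does not depend on g; when \<open>\<rho>\<close> is the restriction of a
  representation of a larger group, this allows the same pair to conjugate the whole representation.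
  A list is used because a summand may occur repeatedly.\<close>

lemma (in finite_group_irreps) complete_reducibility:
  assumes "rep G d \<rho>"
  shows "\<exists>bs P Q. set bs \<subseteq> R \<and>
    (\<forall>g\<in>carrier G. similar_mat_wit (\<rho> g) (diag_block_mat (map (\<lambda>\<kappa>. \<kappa> g) bs)) P Q)"
  using assms
proof (induction d arbitrary: \<rho> rule: less_induct)
  case (less d)
  note r = less.prems
  consider "d = 0" | "irreducible_rep G \<rho>" | "d > 0" "\<not> irreducible_rep G \<rho>" by blast
  then show ?case
  proof cases
    case 1
    then have "similar_mat_wit (\<rho> g) (diag_block_mat (map (\<lambda>\<kappa>. \<kappa> g) [])) (1\<^sub>m 0) (1\<^sub>m 0)"
      if "g \<in> carrier G" for g
      using repD(1)[OF r that] by (intro similar_mat_witI[of _ _ 0]) auto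
    then show ?thesis by (intro exI[of _ "[]"]) auto
  next
    case 2
    then obtain \<kappa> P Q where "\<kappa> \<in> R" "\<forall>g\<in>carrier G. similar_mat_wit (\<rho> g) (\<kappa> g) P Q"
      using exhaust unfolding equivalent_reps_def by blast
    then show ?thesis by (intro exI[of _ "[\<kappa>]"] exI[of _ P] exI[of _ Q]) (auto simp del: diag_block_mat.simps)
  next
    case 3
    then obtain W where W: "invariant_subspace G \<rho> W" "W \<noteq> {0\<^sub>v d}" "W \<noteq> carrier_vec d"
      using rep_imp_matrix_rep[OF r] repD(4)[OF r] by (auto simp: irreducible_rep_def)
    obtain d1 d2 \<rho>1 \<rho>2 P Q where d: "d = d1 + d2" "d1 > 0" "d2 > 0" and r12: "rep G d1 \<rho>1" "rep G d2 \<rho>2"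
      and sim: "\<And>g. g \<in> carrier G \<Longrightarrow> similar_mat_wit (\<rho> g) (four_block_mat (\<rho>1 g) (0\<^sub>m d1 d2) (0\<^sub>m d2 d1) (\<rho>2 g)) P Q"
      using reducible_split[OF is_group finite_carrier r W] by metis
    obtain bs1 P1 Q1 where b1: "set bs1 \<subseteq> R"
      and s1: "\<And>g. g \<in> carrier G \<Longrightarrow> similar_mat_wit (\<rho>1 g) (diag_block_mat (map (\<lambda>\<kappa>. \<kappa> g) bs1)) P1 Q1"
      using less.IH[OF _ r12(1)] d by (metis less_add_same_cancel1)
    obtain bs2 P2 Q2 where b2: "set bs2 \<subseteq> R"
      and s2: "\<And>g. g \<in> carrier G \<Longrightarrow> similar_mat_wit (\<rho>2 g) (diag_block_mat (map (\<lambda>\<kappa>. \<kappa> g) bs2)) P2 Q2"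
      using less.IH[OF _ r12(2)] d by (metis less_add_same_cancel2)
    let ?Z1 = "0\<^sub>m d1 d2 :: complex mat" and ?Z2 = "0\<^sub>m d2 d1 :: complex mat"
    have "similar_mat_wit (\<rho> g) (diag_block_mat (map (\<lambda>\<kappa>. \<kappa> g) (bs1 @ bs2)))
        (P * four_block_mat P1 ?Z1 ?Z2 P2) (four_block_mat Q1 ?Z1 ?Z2 Q2 * Q)" if g: "g \<in> carrier G" for g
    proof -
      note c1 = similar_mat_witD2[OF repD(1)[OF r12(1) g] s1[OF g]]
      note c2 = similar_mat_witD2[OF repD(1)[OF r12(2) g] s2[OF g]]
      have "similar_mat_wit (four_block_mat (\<rho>1 g) ?Z1 ?Z2 (\<rho>2 g))
          (four_block_mat (diag_block_mat (map (\<lambda>\<kappa>. \<kappa> g) bs1)) ?Z1 ?Z2 (diag_block_mat (map (\<lambda>\<kappa>. \<kappa> g) bs2)))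
          (four_block_mat P1 ?Z1 ?Z2 P2) (four_block_mat Q1 ?Z1 ?Z2 Q2)"
        by (rule similar_mat_wit_four_block[OF s1[OF g] s2[OF g]]) (use c1(4-7) c2(4-7) in auto)
      also have "four_block_mat (diag_block_mat (map (\<lambda>\<kappa>. \<kappa> g) bs1)) ?Z1 ?Z2 (diag_block_mat (map (\<lambda>\<kappa>. \<kappa> g) bs2))
         = diag_block_mat (map (\<lambda>\<kappa>. \<kappa> g) (bs1 @ bs2))"
        using c1(5) c2(5) by (simp add: diag_block_mat_append Let_def)
      finally show ?thesis by (rule similar_mat_wit_trans[OF sim[OF g]])
    qed
    then show ?thesis using b1 b2 by (intro exI[of _ "bs1 @ bs2"]) auto
  qed
qed

text \<open>Multiplication by \<open>P\<close> carries invariant subspaces of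
  \<open>\<sigma>\<close> to invariant subspaces of \<open>\<rho>\<close>, and \<open>Q\<close>
  undoes it.\<close>

lemma (in group) irreducible_conjugate:
  assumes irr: "irreducible_rep G \<rho>" and sim: "\<And>g. g \<in> carrier G \<Longrightarrow> similar_mat_wit (\<rho> g) (\<sigma> g) P Q"
    and s: "rep G d \<sigma>"
  shows "irreducible_rep G \<sigma>"
proof -
  have d: "rep_degree G \<rho> = d"
    using similar_mat_witD(5)[OF refl sim[OF one_closed]] repD(3)[OF s] by (auto simp: rep_degree_def)
  have r: "rep G d \<rho>" and pos: "d > 0" using irreducible_repD[OF irr] d by auto
  note w = similar_mat_witD2[OF repD(1)[OF r one_closed] sim[OF one_closed]]
  have P: "P \<in> carrier_mat d d" and Q: "Q \<in> carrier_mat d d" and PQ: "P * Q = 1\<^sub>m d" "Q * P = 1\<^sub>m d" using w(1,2,6,7) by auto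
  have QP: "Q *\<^sub>v (P *\<^sub>v v) = v" if "v \<in> carrier_vec d" for v
    using that P Q PQ by (simp_all add: assoc_mult_mat_vec[symmetric])
  have "W = {0\<^sub>v d} \<or> W = carrier_vec d" if W: "invariant_subspace G \<sigma> W" for W
  proof -
    note D = invariant_subspaceD[OF W s]
    have car: "v \<in> carrier_vec d" if "v \<in> W" for v using D(1) that by auto
    define V where "V = (\<lambda>v. P *\<^sub>v v) ` W"
    have "invariant_subspace G \<rho> V"
      unfolding invariant_subspace_def d subspace_module_vec_iff
    proof (intro conjI ballI allI)
      show "V \<subseteq> carrier_vec d" using P car by (auto simp: V_def)
      show "0\<^sub>v d \<in> V" using D(2) P by (force simp: V_def)
      show "v + w \<in> V" if "v \<in> V" "w \<in> V" for v w
        using that D(3) car by (auto simp: V_def mult_add_distrib_mat_vec[OF P, symmetric])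
      show "c \<cdot>\<^sub>v v \<in> V" if "v \<in> V" for c v
        using that D(4) car by (auto simp: V_def mult_mat_vec[OF P, symmetric])
      fix g v assume g: "g \<in> carrier G" and "v \<in> V"
      then obtain w where w: "w \<in> W" "v = P *\<^sub>v w" by (auto simp: V_def)
      note c = similar_mat_witD2[OF repD(1)[OF r g] sim[OF g]]
      have "\<rho> g *\<^sub>v v = P *\<^sub>v (\<sigma> g *\<^sub>v (Q *\<^sub>v (P *\<^sub>v w)))"
        unfolding w(2) c(3) using c(4-7) car[OF w(1)] by (simp add: assoc_mult_mat_vec[of _ d d _ d])
      also have "\<dots> = P *\<^sub>v (\<sigma> g *\<^sub>v w)" by (simp add: QP[OF car[OF w(1)]])
      finally show "\<rho> g *\<^sub>v v \<in> V" using D(5)[OF g w(1)] by (auto simp: V_def)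
    qed
    then have "V = {0\<^sub>v d} \<or> V = carrier_vec d" using irreducible_repD(3)[OF irr] d by auto
    then show ?thesis
    proof
      assume V0: "V = {0\<^sub>v d}"
      have "v = 0\<^sub>v d" if "v \<in> W" for v
      proof -
        have "P *\<^sub>v v = 0\<^sub>v d" using that V0 by (auto simp: V_def)
        then have "v = Q *\<^sub>v 0\<^sub>v d" using QP[OF car[OF that]] by simp
        then show ?thesis using Q by auto
      qed
      then show ?thesis using D(2) by blast
    next
      assume V1: "V = carrier_vec d"
      have "v \<in> W" if v: "v \<in> carrier_vec d" for v
      proof -
        have "P *\<^sub>v v \<in> V" unfolding V1 using P v by auto
        then obtain w where "w \<in> W" "P *\<^sub>v v = P *\<^sub>v w" by (auto simp: V_def)
        then show ?thesis using QP[OF v] QP[OF car] by metis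
      qed
      then show ?thesis using D(1) by blast
    qed
  qed
  then show ?thesis using rep_imp_matrix_rep[OF s] pos by (auto simp: irreducible_rep_def repD(4)[OF s])
qed

text \<open>The predicate under \<open>SOME\<close> depends only on the equivalence class of
  \<open>\<sigma>\<close>, so the choice is constant on classes and its range contains exactly one
  member of each class.\<close>

lemma adapted_complete_irreps_exist:
  assumes "\<And>\<sigma>. irreducible_rep G \<sigma> \<Longrightarrow> \<exists>\<rho>. irreducible_rep G \<rho> \<and> equivalent_reps G \<sigma> \<rho> \<and> A \<rho>"
  shows "\<exists>R. complete_irreps G R \<and> (\<forall>\<rho>\<in>R. A \<rho>)"
proof -
  define f where "f \<sigma> = (SOME \<rho>. irreducible_rep G \<rho> \<and> equivalent_reps G \<sigma> \<rho> \<and> A \<rho>)" for \<sigma>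
  have f: "irreducible_rep G (f \<sigma>) \<and> equivalent_reps G \<sigma> (f \<sigma>) \<and> A (f \<sigma>)" if "irreducible_rep G \<sigma>" for \<sigma>
    using someI_ex[OF assms[OF that]] by (simp only: f_def)
  have "f \<sigma> = f \<tau>" if "irreducible_rep G \<sigma>" "irreducible_rep G \<tau>" "equivalent_reps G (f \<sigma>) (f \<tau>)" for \<sigma> \<tau>
  proof -
    have "equivalent_reps G \<sigma> \<rho> \<longleftrightarrow> equivalent_reps G \<tau> \<rho>" for \<rho>
      using f[OF that(1)] f[OF that(2)] that(3) equivalent_reps_sym equivalent_reps_trans by metis
    then show ?thesis by (simp add: f_def)
  qed
  then show ?thesis
    using f by (intro exI[of _ "f ` Collect (irreducible_rep G)"]) (auto simp: complete_irreps_def)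
qed

text \<open>\<open>R\<close> is a complete set of irreps of \<open>H\<close>; the restriction of \<open>\<rho>\<close> to \<open>H\<close> is the direct sum of the
  irreps \<open>\<kappa> i\<close>, \<open>i < N\<close>, the basis vectors of the \<open>i\<close>-th summand being numbered by \<open>e i\<close>.\<close>

definition block_decomposition :: "('g, 'b) monoid_scheme \<Rightarrow> ('g \<Rightarrow> complex mat) set \<Rightarrow> nat \<Rightarrow>
    (nat \<Rightarrow> 'g \<Rightarrow> complex mat) \<Rightarrow> (nat \<Rightarrow> nat \<Rightarrow> nat) \<Rightarrow> ('g \<Rightarrow> complex mat) \<Rightarrow> nat \<Rightarrow> bool" where
  "block_decomposition H R N \<kappa> e \<rho> d \<longleftrightarrow> (\<forall>i<N. \<kappa> i \<in> R) \<and>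
     bij_betw (\<lambda>(i, a). e i a) (SIGMA i:{..<N}. {..<rep_degree H (\<kappa> i)}) {..<d} \<and>
     (\<forall>h\<in>carrier H. \<forall>i<N. \<forall>j<N. \<forall>a<rep_degree H (\<kappa> i). \<forall>b<rep_degree H (\<kappa> j).
        \<rho> h $$ (e i a, e j b) = (if i = j then \<kappa> i h $$ (a, b) else 0))"

lemma diag_block_mat_decomposition:
  assumes "set bs \<subseteq> R" "\<And>\<kappa>. \<kappa> \<in> R \<Longrightarrow> rep H (rep_degree H \<kappa>) \<kappa>"
  shows "\<exists>e. block_decomposition H R (length bs) (\<lambda>i. bs ! i) e (\<lambda>h. diag_block_mat (map (\<lambda>\<kappa>. \<kappa> h) bs))
     (\<Sum>\<kappa>\<leftarrow>bs. rep_degree H \<kappa>)"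
  using assms(1)
proof (induction bs)
  case Nil
  then show ?case by (auto simp: block_decomposition_def bij_betw_def)
next
  case (Cons \<mu> bs)
  let ?d = "rep_degree H" and ?D = "\<lambda>h bs. diag_block_mat (map (\<lambda>\<kappa>. \<kappa> h) bs)" and ?s = "\<Sum>\<kappa>\<leftarrow>bs. rep_degree H \<kappa>"
  have car: "\<kappa> h \<in> carrier_mat (?d \<kappa>) (?d \<kappa>)" if "\<kappa> \<in> R" "h \<in> carrier H" for \<kappa> h
    using assms(2)[OF that(1)] that(2) by (auto simp: rep_def)
  have dims: "?D h bs \<in> carrier_mat ?s ?s" if "h \<in> carrier H" for h
  proof -
    have "map dim_row (map (\<lambda>\<kappa>. \<kappa> h) bs) = map ?d bs" "map dim_col (map (\<lambda>\<kappa>. \<kappa> h) bs) = map ?d bs"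
      using car[OF _ that] Cons.prems by auto
    then show ?thesis unfolding carrier_mat_def mem_Collect_eq dim_diag_block_mat by (simp only:)
  qed
  obtain e where e: "block_decomposition H R (length bs) (\<lambda>i. bs ! i) e (\<lambda>h. ?D h bs) ?s"
    using Cons by auto
  define e' where "e' i a = (case i of 0 \<Rightarrow> a | Suc i \<Rightarrow> ?d \<mu> + e i a)" for i a
  have bij: "bij_betw (\<lambda>(i, a). e i a) (SIGMA i:{..<length bs}. {..<?d (bs ! i)}) {..<?s}"
    using e by (simp add: block_decomposition_def)
  have lt: "e i a < ?s" if "i < length bs" "a < ?d (bs ! i)" for i a
    using bij_betw_apply[OF bij, of "(i, a)"] that by auto
  have inj: "i = j \<and> a = b" if "i < length bs" "a < ?d (bs ! i)" "j < length bs" "b < ?d (bs ! j)" "e i a = e j b" for i j a b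
  proof -
    have "(i, a) = (j, b)"
      by (rule inj_onD[OF bij_betw_imp_inj_on[OF bij]]) (use that in auto)
    then show ?thesis by simp
  qed
  have "bij_betw (\<lambda>(i, a). e' i a) (SIGMA i:{..<length (\<mu> # bs)}. {..<?d ((\<mu> # bs) ! i)}) {..<\<Sum>\<kappa>\<leftarrow>\<mu> # bs. ?d \<kappa>}"
  proof (intro bij_betw_imageI inj_onI subset_antisym subsetI)
    fix p q assume p: "p \<in> (SIGMA i:{..<length (\<mu> # bs)}. {..<?d ((\<mu> # bs) ! i)})"
      and q: "q \<in> (SIGMA i:{..<length (\<mu> # bs)}. {..<?d ((\<mu> # bs) ! i)})"
      and "(case p of (i, a) \<Rightarrow> e' i a) = (case q of (i, a) \<Rightarrow> e' i a)"
    then show "p = q"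
      by (cases p; cases q; cases "fst p"; cases "fst q") (auto simp: e'_def dest: inj)
  next
    fix x assume "x \<in> (\<lambda>(i, a). e' i a) ` (SIGMA i:{..<length (\<mu> # bs)}. {..<?d ((\<mu> # bs) ! i)})"
    then obtain i a where "x = e' i a" "i < Suc (length bs)" "a < ?d ((\<mu> # bs) ! i)" by auto
    then show "x \<in> {..<\<Sum>\<kappa>\<leftarrow>\<mu> # bs. ?d \<kappa>}" using lt by (cases i) (auto simp: e'_def)
  next
    fix x assume x: "x \<in> {..<\<Sum>\<kappa>\<leftarrow>\<mu> # bs. ?d \<kappa>}"
    show "x \<in> (\<lambda>(i, a). e' i a) ` (SIGMA i:{..<length (\<mu> # bs)}. {..<?d ((\<mu> # bs) ! i)})"
    proof (cases "x < ?d \<mu>")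
      case True
      then show ?thesis by (intro image_eqI[of _ _ "(0, x)"]) (auto simp: e'_def)
    next
      case False
      then have "x - ?d \<mu> \<in> {..<?s}" using x by auto
      then obtain i a where "i < length bs" "a < ?d (bs ! i)" "x - ?d \<mu> = e i a"
        unfolding bij_betw_imp_surj_on[OF bij, symmetric] by auto
      then show ?thesis using False by (intro image_eqI[of _ _ "(Suc i, a)"]) (auto simp: e'_def)
    qed
  qed
  moreover have "?D h (\<mu> # bs) $$ (e' i a, e' j b) = (if i = j then (((\<mu> # bs) ! i) h) $$ (a, b) else 0)"
    if h: "h \<in> carrier H" and "i < length (\<mu> # bs)" "j < length (\<mu> # bs)"
      "a < ?d ((\<mu> # bs) ! i)" "b < ?d ((\<mu> # bs) ! j)" for h i j a b
  proof -
    have m: "\<mu> h \<in> carrier_mat (?d \<mu>) (?d \<mu>)" using car h Cons.prems by auto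
    show ?thesis
      using that m dims[OF h] lt e unfolding block_decomposition_def
      by (cases i; cases j) (auto simp: e'_def Let_def)
  qed
  ultimately show ?case
    using Cons.prems by (intro exI[of _ e']) (auto simp: block_decomposition_def nth_Cons split: nat.split)
qed

section \<open>Signed permutations\<close>

abbreviation "B \<equiv> hyperoctahedral"

definition letters :: "nat \<Rightarrow> int set" where
  "letters n = {i. i \<noteq> 0 \<and> \<bar>i\<bar> \<le> int n}"

lemma letters_0 [simp]: "letters 0 = {}"
  by (auto simp: letters_def)

lemma letters_Suc: "letters (Suc m) = insert (int (Suc m)) (insert (- int (Suc m)) (letters m))"
  by (auto simp: letters_def)

lemma finite_letters [simp]: "finite (letters n)"
  by (induction n) (auto simp: letters_Suc)

lemma card_letters: "card (letters n) = 2 * n"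
proof (induction n)
  case (Suc n)
  have "int (Suc n) \<notin> letters n" "- int (Suc n) \<notin> letters n" "int (Suc n) \<noteq> - int (Suc n)"
    by (auto simp: letters_def)
  then show ?case using Suc by (simp add: letters_Suc)
qed simp

lemma uminus_letters_iff [simp]: "- i \<in> letters n \<longleftrightarrow> i \<in> letters n"
  by (auto simp: letters_def)

lemma int_letters_iff [simp]: "int k \<in> letters n \<longleftrightarrow> 0 < k \<and> k \<le> n"
  by (auto simp: letters_def)

lemma B_simps [simp]: "p \<otimes>\<^bsub>B n\<^esub> q = p \<circ> q" "\<one>\<^bsub>B n\<^esub> = id"
  by (auto simp: hyperoctahedral_def)

lemma carrier_B_iff: "p \<in> carrier (B n) \<longleftrightarrow> p permutes letters n \<and> (\<forall>i. p (- i) = - p i)"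
  by (auto simp: hyperoctahedral_def letters_def)

lemma BD:
  assumes "p \<in> carrier (B n)"
  shows "p permutes letters n" "p (- i) = - p i" "inj p" "i \<notin> letters n \<Longrightarrow> p i = i" "p i \<in> letters n \<longleftrightarrow> i \<in> letters n"
proof -
  show p: "p permutes letters n" and "p (- i) = - p i" using assms by (auto simp: carrier_B_iff)
  show "inj p" "i \<notin> letters n \<Longrightarrow> p i = i" "p i \<in> letters n \<longleftrightarrow> i \<in> letters n"
    using permutes_inj[OF p] permutes_not_in[OF p] permutes_in_image[OF p] by auto
qed

lemma carrier_B_mono: "m \<le> n \<Longrightarrow> carrier (B m) \<subseteq> carrier (B n)"
  by (auto simp: carrier_B_iff letters_def elim!: permutes_subset)

lemma finite_carrier_B: "finite (carrier (B n))"
  by (rule finite_subset[OF _ finite_permutations[OF finite_letters[of n]]]) (auto simp: carrier_B_iff)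

lemma id_in_B [simp]: "id \<in> carrier (B n)"
  using permutes_id[of "letters n"] by (simp add: carrier_B_iff)

lemma B_comp: "p \<in> carrier (B n) \<Longrightarrow> q \<in> carrier (B n) \<Longrightarrow> p \<circ> q \<in> carrier (B n)"
  using group.is_monoid[OF group_hyperoctahedral, of n] monoid.m_closed[of "B n" p q] by simp

lemma B_inv:
  assumes "p \<in> carrier (B n)"
  shows "inv\<^bsub>B n\<^esub> p = inv_into UNIV p" "inv_into UNIV p \<in> carrier (B n)"
proof -
  interpret group "B n" by (rule group_hyperoctahedral)
  have "inv\<^bsub>B n\<^esub> p \<circ> p = id" using l_inv[OF assms] by simp
  then show "inv\<^bsub>B n\<^esub> p = inv_into UNIV p" by (metis inv_unique_comp r_inv[OF assms] B_simps)
  then show "inv_into UNIV p \<in> carrier (B n)" using inv_closed[OF assms] by simp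
qed

lemma B_inv_comp:
  assumes "p \<in> carrier (B n)"
  shows "inv_into UNIV p \<circ> p = id" "p \<circ> inv_into UNIV p = id"
  using permutes_inv_o[OF BD(1)[OF assms]] by auto

lemma fixing_last:
  assumes p: "p \<in> carrier (B (Suc m))" and fix_last: "p (int (Suc m)) = int (Suc m)"
  shows "p \<in> carrier (B m)"
proof -
  have "p permutes letters m"
  proof (rule permutes_superset[OF BD(1)[OF p]])
    fix x assume "x \<in> letters (Suc m) - letters m"
    then show "p x = x" using fix_last BD(2)[OF p, of "int (Suc m)"] by (auto simp: letters_Suc)
  qed
  then show ?thesis using BD(2)[OF p] by (simp add: carrier_B_iff)
qed

lemma B_fixes: "p \<in> carrier (B m) \<Longrightarrow> m < k \<Longrightarrow> p (int k) = int k"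
  using BD(4)[of p m "int k"] by (auto simp: letters_def)

section \<open>Reflections and coset representatives\<close>

definition signed_swap :: "int \<Rightarrow> int \<Rightarrow> int \<Rightarrow> int" where
  "signed_swap i j x = (if x = i then j else if x = j then i else if x = - i then - j else if x = - j then - i else x)"

definition sign_flip :: "int \<Rightarrow> int \<Rightarrow> int" where
  "sign_flip i x = (if x = i \<or> x = - i then - x else x)"

lemma signed_swap_involution: "\<bar>i\<bar> \<noteq> \<bar>j\<bar> \<Longrightarrow> i \<noteq> 0 \<Longrightarrow> j \<noteq> 0 \<Longrightarrow> signed_swap i j \<circ> signed_swap i j = id"
  by (auto simp: signed_swap_def fun_eq_iff)

lemma sign_flip_involution: "sign_flip i \<circ> sign_flip i = id"
  by (auto simp: sign_flip_def fun_eq_iff)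

lemma involution_permutes:
  assumes "f \<circ> f = id" "\<And>x. x \<notin> S \<Longrightarrow> f x = x"
  shows "f permutes S"
  using assms unfolding permutes_def by (metis comp_apply id_apply)

lemma signed_swap_in_B:
  assumes "i \<in> letters n" "j \<in> letters n" "\<bar>i\<bar> \<noteq> \<bar>j\<bar>"
  shows "signed_swap i j \<in> carrier (B n)"
proof -
  have "signed_swap i j permutes letters n"
    by (rule involution_permutes[OF signed_swap_involution])
      (use assms in \<open>auto simp: signed_swap_def letters_def\<close>)
  then show ?thesis using assms by (auto simp: carrier_B_iff signed_swap_def letters_def)
qed

lemma sign_flip_in_B:
  assumes "i \<in> letters n"
  shows "sign_flip i \<in> carrier (B n)"
proof -
  have "sign_flip i permutes letters n"
    by (rule involution_permutes[OF sign_flip_involution])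
      (use assms in \<open>auto simp: sign_flip_def letters_def\<close>)
  then show ?thesis by (auto simp: carrier_B_iff sign_flip_def)
qed

lemma conjugate_signed_swap:
  assumes "p \<in> carrier (B n)"
  shows "p \<circ> signed_swap i j = signed_swap (p i) (p j) \<circ> p"
proof -
  have e: "p x = p y \<longleftrightarrow> x = y" for x y using BD(3)[OF assms] by (auto dest: injD)
  have e': "p x = - p y \<longleftrightarrow> x = - y" for x y using e[of x "- y"] BD(2)[OF assms] by simp
  show ?thesis by (rule ext) (simp add: signed_swap_def e e' BD(2)[OF assms])
qed

lemma conjugate_sign_flip:
  assumes "p \<in> carrier (B n)"
  shows "p \<circ> sign_flip i = sign_flip (p i) \<circ> p"
proof -
  have e: "p x = p y \<longleftrightarrow> x = y" for x y using BD(3)[OF assms] by (auto dest: injD)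
  have e': "p x = - p y \<longleftrightarrow> x = - y" for x y using e[of x "- y"] BD(2)[OF assms] by simp
  show ?thesis by (rule ext) (simp add: sign_flip_def e e' BD(2)[OF assms])
qed

text \<open>The label j of a left coset of \<open>B m\<close> in \<open>B (Suc m)\<close> is the
  image of the last letter. Only labels in \<open>letters\<close> are meaningful; in particular the
  last branch is reached for such a label only when m > 0.\<close>

fun coset_rep :: "nat \<Rightarrow> int \<Rightarrow> int \<Rightarrow> int" where
  "coset_rep 0 j = id"
| "coset_rep (Suc m) j = (if j = int (Suc m) then id else if j = - int (Suc m) then sign_flip (int (Suc m))
     else coset_rep m j \<circ> signed_swap (int m) (int (Suc m)))"

lemma coset_rep:
  assumes "j \<in> letters n"
  shows "coset_rep n j \<in> carrier (B n)" "coset_rep n j (int n) = j"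
  using assms
proof (induction n)
  case (Suc m)
  have swap: "signed_swap (int m) (int (Suc m)) \<in> carrier (B (Suc m))" if "j \<in> letters m"
    using that by (intro signed_swap_in_B) (auto simp: letters_def)
  { case 1
    then show ?case using Suc.IH(1) swap carrier_B_mono[of m "Suc m"] B_comp[of _ "Suc m"] sign_flip_in_B[of "int (Suc m)" "Suc m"]
      by (auto simp: letters_Suc)
  next
    case 2
    then show ?case using Suc.IH(2) by (auto simp: letters_Suc sign_flip_def signed_swap_def)
  }
qed auto

text \<open>The label is read off as \<open>w (int (Suc m))\<close>; after division by the
  representative the last letter is fixed, which characterises \<open>B m\<close>.\<close>

lemma coset_decomposition:
  "bij_betw (\<lambda>(j, h). coset_rep (Suc m) j \<circ> h) (letters (Suc m) \<times> carrier (B m)) (carrier (B (Suc m)))"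
proof (intro bij_betw_imageI inj_onI subset_antisym subsetI)
  fix x y assume x: "x \<in> letters (Suc m) \<times> carrier (B m)" and y: "y \<in> letters (Suc m) \<times> carrier (B m)"
    and eq: "(case x of (j, h) \<Rightarrow> coset_rep (Suc m) j \<circ> h) = (case y of (j, h) \<Rightarrow> coset_rep (Suc m) j \<circ> h)"
  obtain j h i k where xy: "x = (j, h)" "y = (i, k)" by (cases x; cases y)
  have eq': "coset_rep (Suc m) j \<circ> h = coset_rep (Suc m) i \<circ> k" using eq xy by simp
  have "(coset_rep (Suc m) j \<circ> h) (int (Suc m)) = j" "(coset_rep (Suc m) i \<circ> k) (int (Suc m)) = i"
    using x y xy coset_rep(2)[of _ "Suc m"] B_fixes[of h m "Suc m"] B_fixes[of k m "Suc m"]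
    by (auto simp del: coset_rep.simps of_nat_Suc)
  then have ij: "i = j" unfolding eq' by (simp only:)
  have "inj (coset_rep (Suc m) j)" using x xy coset_rep(1) BD(3) by blast
  then have "h = k" using eq' ij by (simp add: fun_eq_iff inj_eq del: coset_rep.simps)
  then show "x = y" using xy ij by simp
next
  fix w assume "w \<in> (\<lambda>(j, h). coset_rep (Suc m) j \<circ> h) ` (letters (Suc m) \<times> carrier (B m))"
  then show "w \<in> carrier (B (Suc m))"
    using coset_rep(1) carrier_B_mono[of m "Suc m"] B_comp[of _ "Suc m"] by (auto simp del: coset_rep.simps)
next
  fix w assume w: "w \<in> carrier (B (Suc m))"
  define j where "j = w (int (Suc m))"
  have j: "j \<in> letters (Suc m)" unfolding j_def using BD(5)[OF w] by (simp del: of_nat_Suc)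
  define c where "c = coset_rep (Suc m) j"
  have c: "c \<in> carrier (B (Suc m))" "c (int (Suc m)) = j" unfolding c_def using coset_rep[OF j] by auto
  define h where "h = inv_into UNIV c \<circ> w"
  have "h (int (Suc m)) = int (Suc m)"
    unfolding h_def using c(2) BD(3)[OF c(1)] j_def by (metis comp_apply inv_f_f)
  moreover have "h \<in> carrier (B (Suc m))" unfolding h_def using B_inv(2)[OF c(1)] w B_comp by blast
  ultimately have "h \<in> carrier (B m)" using fixing_last by blast
  moreover have "w = c \<circ> h" unfolding h_def using B_inv_comp(2)[OF c(1)] by (metis comp_assoc id_o)
  ultimately show "w \<in> (\<lambda>(j, h). coset_rep (Suc m) j \<circ> h) ` (letters (Suc m) \<times> carrier (B m))"
    using j c_def by (intro image_eqI[of _ _ "(j, h)"]) auto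
qed

lemma sum_cosets:
  "(\<Sum>w\<in>carrier (B (Suc m)). F w) =
     (\<Sum>j\<in>letters (Suc m). \<Sum>h\<in>carrier (B m). F (coset_rep (Suc m) j \<circ> h) :: complex)"
proof -
  have "(\<Sum>w\<in>carrier (B (Suc m)). F w) = (\<Sum>(j, h)\<in>letters (Suc m) \<times> carrier (B m). F (coset_rep (Suc m) j \<circ> h))"
    using sum.reindex_bij_betw[OF coset_decomposition, of F m] by (simp add: case_prod_unfold del: coset_rep.simps)
  then show ?thesis by (simp add: sum.cartesian_product del: coset_rep.simps)
qed

lemma order_B_Suc: "Coset.order (B (Suc m)) = 2 * Suc m * Coset.order (B m)"
  using bij_betw_same_card[OF coset_decomposition[of m]]
  by (simp add: Coset.order_def card_cartesian_product card_letters)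

lemma odd_function_sign: "(\<And>x. f (- x) = - f x) \<Longrightarrow> \<epsilon> \<in> {1, - 1} \<Longrightarrow> f (\<epsilon> * x) = \<epsilon> * (f x :: int)" for x :: int
  by auto

text \<open>On each orbit of \<open>\<langle>g, -1\<rangle>\<close> choose a base point \<open>b\<close>, taking the last letter whenever possible,
  and let \<open>h\<close> send \<open>\<plusminus> g\<^sup>k b\<close> to \<open>\<plusminus> g\<^sup>-\<^sup>k b\<close>.\<close>

lemma inverse_conjugate:
  assumes g: "g \<in> carrier (B (Suc m))"
  shows "\<exists>h\<in>carrier (B m). h \<circ> g = inv_into UNIV g \<circ> h"
proof -
  define N where "N = int (Suc m)"
  define gi where "gi = inv_into UNIV g"
  have gi: "gi \<in> carrier (B (Suc m))" unfolding gi_def by (rule B_inv(2)[OF g])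
  have ggi [simp]: "g (gi x) = x" "gi (g x) = x" for x
    using B_inv_comp[OF g] by (auto simp: gi_def fun_eq_iff)
  have odd_pow: "(f ^^ k) (- x) = - (f ^^ k) x" if "f \<in> carrier (B (Suc m))" for f k and x :: int
    using BD(2)[OF that] by (induction k) auto
  have sgn: "(f ^^ k) (\<epsilon> * x) = \<epsilon> * (f ^^ k) x" if "f \<in> carrier (B (Suc m))" "\<epsilon> \<in> {1, - 1}" for f k \<epsilon> x
    by (rule odd_function_sign[where f = "f ^^ k", OF _ that(2)]) (rule odd_pow[OF that(1)])
  have cancel: "(gi ^^ k) ((g ^^ k) x) = x" "(g ^^ k) ((gi ^^ k) x) = x" for k x
    by (induction k arbitrary: x) (simp_all add: funpow_swap1)
  have commute: "(f ^^ k) ((f ^^ l) x) = (f ^^ l) ((f ^^ k) x)" for f :: "int \<Rightarrow> int" and k l x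
    by (metis add.commute comp_apply funpow_add)
  define E where "E x = {y. \<exists>k. \<exists>\<epsilon>\<in>{1, - 1}. y = \<epsilon> * (g ^^ k) x}" for x
  have E_refl: "x \<in> E x" for x unfolding E_def by (auto intro: exI[of _ 0])
  have E_trans: "z \<in> E x" if "y \<in> E x" "z \<in> E y" for x y z
  proof -
    obtain k \<epsilon> l \<delta> where y: "\<epsilon> \<in> {1, - 1}" "y = \<epsilon> * (g ^^ k) x" and z: "\<delta> \<in> {1, - 1}" "z = \<delta> * (g ^^ l) y"
      using \<open>y \<in> E x\<close> \<open>z \<in> E y\<close> unfolding E_def by blast
    have "z = (\<delta> * \<epsilon>) * (g ^^ (l + k)) x" unfolding z(2) y(2) by (simp add: sgn[OF g y(1)] funpow_add)
    moreover have "\<delta> * \<epsilon> \<in> {1, - 1}" using y(1) z(1) by auto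
    ultimately show ?thesis unfolding E_def by blast
  qed
  \<comment> \<open>The relation \<open>E\<close> uses natural powers of \<open>g\<close> only. The
    finite order of \<open>g\<close> supplies the inverse powers and makes \<open>E\<close>
    symmetric.\<close>
  obtain M where M: "M > 0" "g ^^ M = id"
    using permutation_is_nilpotent[of g] BD(1)[OF g] finite_letters[of "Suc m"] permutation_permutes[of g] by metis
  have E_sym: "x \<in> E y" if y_in: "y \<in> E x" for x y
  proof -
    obtain k \<epsilon> where y: "\<epsilon> \<in> {1, - 1}" "y = \<epsilon> * (g ^^ k) x" using y_in unfolding E_def by blast
    have pow: "g ^^ (M * k) = id" using M by (metis funpow_mult id_funpow)
    have "(g ^^ (M * k - k)) y = \<epsilon> * (g ^^ (M * k - k)) ((g ^^ k) x)" unfolding y(2) by (rule sgn[OF g y(1)])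
    also have "(g ^^ (M * k - k)) ((g ^^ k) x) = (g ^^ (M * k)) x"
      using M(1) by (metis comp_apply funpow_add le_add_diff_inverse2 mult_le_mono1 nat_mult_1 Suc_leI One_nat_def)
    finally have "x = \<epsilon> * (g ^^ (M * k - k)) y" using pow y(1) by auto
    then show ?thesis using y(1) unfolding E_def by blast
  qed
  have E_eq: "E y = E x" if "y \<in> E x" for x y using that E_sym E_trans by blast
  define base where "base x = (if N \<in> E x then N else (SOME y. y \<in> E x))" for x
  have base_in: "base x \<in> E x" for x using someI[of "\<lambda>y. y \<in> E x", OF E_refl] by (auto simp: base_def)
  have base_eq: "base y = base x" if "y \<in> E x" for x y using E_eq[OF that] by (simp add: base_def)
  \<comment> \<open>A coincidence up to sign between powers of one of \<open>g\<close>,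
    \<open>gi\<close> at a base point yields the same coincidence for the other. In one direction
    this makes \<open>h\<close> well defined, in the other it makes \<open>h\<close>
    injective.\<close>
  have flip: "(f' ^^ k) b = \<epsilon> * (f' ^^ l) b"
    if f: "f \<in> carrier (B (Suc m))" "f' \<in> carrier (B (Suc m))" "\<And>k x. (f' ^^ k) ((f ^^ k) x) = x"
      and \<epsilon>: "\<epsilon> \<in> {1, - 1}" and eq: "(f ^^ k) b = \<epsilon> * (f ^^ l) b" for f f' k l \<epsilon> b
  proof -
    have "(f' ^^ l) b = (f' ^^ l) ((f' ^^ k) ((f ^^ k) b))" using f(3) by simp
    also have "\<dots> = \<epsilon> * (f' ^^ k) ((f' ^^ l) ((f ^^ l) b))"
      unfolding eq by (simp add: sgn[OF f(2) \<epsilon>] commute[where f = f' and k = l and l = k])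
    finally have "(f' ^^ l) b = \<epsilon> * (f' ^^ k) b" using f(3) by simp
    then show ?thesis using \<epsilon> by auto
  qed
  define h where "h x = (SOME z. \<exists>k. \<exists>\<epsilon>\<in>{1, - 1}. x = \<epsilon> * (g ^^ k) (base x) \<and> z = \<epsilon> * (gi ^^ k) (base x))" for x
  have ex: "\<exists>k. \<exists>\<epsilon>\<in>{1, - 1}. x = \<epsilon> * (g ^^ k) (base x)" for x
    using E_sym[OF base_in[of x]] by (auto simp: E_def)
  have h_eq: "h x = \<epsilon> * (gi ^^ k) (base x)" if \<epsilon>: "\<epsilon> \<in> {1, - 1}" and x: "x = \<epsilon> * (g ^^ k) (base x)" for x \<epsilon> k
  proof -
    have "\<exists>z. \<exists>k. \<exists>\<epsilon>\<in>{1, - 1}. x = \<epsilon> * (g ^^ k) (base x) \<and> z = \<epsilon> * (gi ^^ k) (base x)" using ex[of x] by blast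
    from someI_ex[OF this] obtain l \<delta> where l: "\<delta> \<in> {1, - 1}" "x = \<delta> * (g ^^ l) (base x)" "h x = \<delta> * (gi ^^ l) (base x)"
      unfolding h_def by blast
    have "(g ^^ l) (base x) = (\<delta> * \<epsilon>) * (g ^^ k) (base x)" using l(1,2) x \<epsilon> by auto
    moreover have "\<delta> * \<epsilon> \<in> {1, - 1}" using l(1) \<epsilon> by auto
    ultimately have "(gi ^^ l) (base x) = (\<delta> * \<epsilon>) * (gi ^^ k) (base x)" by (intro flip[OF g gi cancel(1)])
    then show ?thesis using l(1,3) \<epsilon> by auto
  qed
  have h_odd: "h (- x) = - h x" for x
  proof -
    obtain k \<epsilon> where e: "\<epsilon> \<in> {1, - 1}" "x = \<epsilon> * (g ^^ k) (base x)" using ex by blast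
    have "- x \<in> E x" unfolding E_def by (auto intro: exI[of _ 0])
    then have b: "base (- x) = base x" by (rule base_eq)
    have "h (- x) = (- \<epsilon>) * (gi ^^ k) (base (- x))" by (rule h_eq) (use e b in auto)
    then show ?thesis using h_eq[OF e] b by simp
  qed
  have h_comm: "h (g x) = gi (h x)" for x
  proof -
    obtain k \<epsilon> where e: "\<epsilon> \<in> {1, - 1}" "x = \<epsilon> * (g ^^ k) (base x)" using ex by blast
    have "g x \<in> E x" unfolding E_def by (auto intro: exI[of _ 1])
    then have b: "base (g x) = base x" by (rule base_eq)
    have "g x = g (\<epsilon> * (g ^^ k) (base x))" by (rule arg_cong[OF e(2)])
    also have "\<dots> = \<epsilon> * (g ^^ Suc k) (base x)" using sgn[OF g e(1), of 1] by simp
    finally have "g x = \<epsilon> * (g ^^ Suc k) (base x)" .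
    then have "h (g x) = \<epsilon> * (gi ^^ Suc k) (base x)" using h_eq[OF e(1), of "g x" "Suc k"] b by simp
    also have "\<dots> = gi (h x)" unfolding h_eq[OF e] using sgn[OF gi e(1), of 1] by simp
    finally show ?thesis .
  qed
  have h_N: "h N = N"
  proof -
    have "base N = N" using E_refl by (simp add: base_def)
    then show ?thesis using h_eq[of 1 N 0] by simp
  qed
  have h_out: "h x = x" if x: "x \<notin> letters (Suc m)" for x
  proof -
    have "(g ^^ k) x = x" for k using BD(4)[OF g x] by (induction k) auto
    then have "base x \<in> {x, - x}" using base_in[of x] by (auto simp: E_def)
    then have "x = 1 * (g ^^ 0) (base x) \<or> x = - 1 * (g ^^ 0) (base x)" by auto
    then show ?thesis using h_eq[of 1 x 0] h_eq[of "- 1" x 0] by auto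
  qed
  have "inj h"
  proof (rule injI)
    fix x y assume hxy: "h x = h y"
    obtain k \<epsilon> where e: "\<epsilon> \<in> {1, - 1}" "x = \<epsilon> * (g ^^ k) (base x)" using ex by blast
    obtain l \<delta> where d: "\<delta> \<in> {1, - 1}" "y = \<delta> * (g ^^ l) (base y)" using ex by blast
    have base_h: "base (h z) = base z" if "\<epsilon> \<in> {1, - 1}" "z = \<epsilon> * (g ^^ k) (base z)" for z \<epsilon> k
    proof -
      have "base z = \<epsilon> * (g ^^ k) (h z)"
        unfolding h_eq[OF that] using that(1) by (auto simp: sgn[OF g that(1)] cancel odd_pow[OF g])
      then have "base z \<in> E (h z)" using that(1) unfolding E_def by blast
      then have "h z \<in> E (base z)" by (rule E_sym)
      then have "h z \<in> E z" using E_eq[OF base_in[of z]] by simp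
      then show ?thesis by (rule base_eq)
    qed
    have b: "base x = base y" using base_h[OF e] base_h[OF d] hxy by simp
    have "(gi ^^ k) (base x) = (\<epsilon> * \<delta>) * (gi ^^ l) (base x)"
      using hxy h_eq[OF e] h_eq[OF d] b e(1) d(1) by auto
    moreover have "\<epsilon> * \<delta> \<in> {1, - 1}" using e(1) d(1) by auto
    ultimately have "(g ^^ k) (base x) = (\<epsilon> * \<delta>) * (g ^^ l) (base x)" by (intro flip[OF gi g cancel(2)])
    then show "x = y" using e d b by auto
  qed
  have "h ` letters (Suc m) \<subseteq> letters (Suc m)"
  proof safe
    fix x assume x: "x \<in> letters (Suc m)"
    show "h x \<in> letters (Suc m)"
    proof (rule ccontr)
      assume out: "h x \<notin> letters (Suc m)"
      then have "h x = x" using h_out[OF out] injD[OF \<open>inj h\<close>] by blast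
      then show False using x out by simp
    qed
  qed
  then have "bij_betw h (letters (Suc m)) (letters (Suc m))"
    using \<open>inj h\<close> finite_letters by (metis bij_betw_def endo_inj_surj inj_on_subset subset_UNIV)
  then have "h permutes letters (Suc m)" using h_out by (rule bij_imp_permutes)
  then have "h \<in> carrier (B (Suc m))" using h_odd by (simp add: carrier_B_iff)
  then have "h \<in> carrier (B m)" using h_N unfolding N_def by (rule fixing_last)
  moreover have "h \<circ> g = inv_into UNIV g \<circ> h" using h_comm by (auto simp: gi_def)
  ultimately show ?thesis by blast
qed

section \<open>Relations between the generators of consecutive levels\<close>

abbreviation adjacent_swap :: "nat \<Rightarrow> int \<Rightarrow> int" where
  "adjacent_swap m \<equiv> signed_swap (int m) (int (Suc m))"

abbreviation last_flip :: "nat \<Rightarrow> int \<Rightarrow> int" where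
  "last_flip m \<equiv> sign_flip (int m)"

lemma adjacent_swap_in_B: "m > 0 \<Longrightarrow> m < n \<Longrightarrow> adjacent_swap m \<in> carrier (B n)"
  by (intro signed_swap_in_B) (auto simp del: of_nat_Suc)

lemma last_flip_in_B: "m > 0 \<Longrightarrow> m \<le> n \<Longrightarrow> last_flip m \<in> carrier (B n)"
  by (intro sign_flip_in_B) auto

lemma adjacent_swap_involution: "m > 0 \<Longrightarrow> adjacent_swap m \<circ> adjacent_swap m = id"
  by (rule signed_swap_involution) auto

lemma adjacent_swap_commute:
  assumes "p \<in> carrier (B m)"
  shows "p \<circ> adjacent_swap (Suc m) = adjacent_swap (Suc m) \<circ> p"
  using conjugate_signed_swap[OF assms] B_fixes[OF assms] by (simp del: of_nat_Suc)

lemma last_flip_commute: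
  assumes "p \<in> carrier (B m)"
  shows "p \<circ> last_flip (Suc m) = last_flip (Suc m) \<circ> p"
  using conjugate_sign_flip[OF assms] B_fixes[OF assms] by (simp del: of_nat_Suc)

lemma adjacent_swap_last_flip:
  "adjacent_swap (Suc m) \<circ> last_flip (Suc m) = last_flip (Suc (Suc m)) \<circ> adjacent_swap (Suc m)"
  using conjugate_sign_flip[OF adjacent_swap_in_B[of "Suc m" "Suc (Suc m)"], of "int (Suc m)"]
  by (simp add: signed_swap_def del: of_nat_Suc)

lemma adjacent_swap_conjugate:
  assumes "i \<in> letters m"
  shows "adjacent_swap (Suc m) \<circ> signed_swap i (int (Suc m)) = signed_swap i (int (Suc (Suc m))) \<circ> adjacent_swap (Suc m)"
proof -
  have "adjacent_swap (Suc m) i = i" using assms by (auto simp: signed_swap_def letters_def)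
  then show ?thesis
    using conjugate_signed_swap[OF adjacent_swap_in_B[of "Suc m" "Suc (Suc m)"], of i "int (Suc m)"]
    by (simp add: signed_swap_def[of _ _ "int (Suc m)"] del: of_nat_Suc)
qed

text \<open>The reflections in the orthogonal vectors e_i + e_j and e_i - e_j multiply to -1 on
  their plane. This is the origin of the product of two flip eigenvalues in
  \<open>swap_jm\<close>.\<close>

lemma negative_swap:
  "signed_swap (- int (Suc m)) (int (Suc (Suc m))) \<circ> adjacent_swap (Suc m) = last_flip (Suc m) \<circ> last_flip (Suc (Suc m))"
  by (auto simp: signed_swap_def sign_flip_def fun_eq_iff)

lemma braid:
  "adjacent_swap (Suc m) \<circ> adjacent_swap (Suc (Suc m)) \<circ> adjacent_swap (Suc m)
    = adjacent_swap (Suc (Suc m)) \<circ> adjacent_swap (Suc m) \<circ> adjacent_swap (Suc (Suc m))"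
  by (auto simp: signed_swap_def fun_eq_iff)

lemma signed_swap_last_conjugate:
  assumes "p \<in> carrier (B m)"
  shows "p \<circ> signed_swap i (int (Suc m)) = signed_swap (p i) (int (Suc m)) \<circ> p"
  using conjugate_signed_swap[OF assms] B_fixes[OF assms] by (simp del: of_nat_Suc)

section \<open>Branching without multiplicities\<close>

lemma complete_irreps_exist: "\<exists>R. complete_irreps G R"
proof -
  have "equivalent_reps G \<sigma> \<sigma>" if irr: "irreducible_rep G \<sigma>" for \<sigma>
  proof -
    obtain d where d: "\<sigma> \<in> hom G (GL d)" using irr unfolding irreducible_rep_def matrix_rep_def by blast
    have "\<sigma> g \<in> carrier_mat d d" if "g \<in> carrier G" for g
      using hom_in_carrier[OF d that] by (auto simp: units_of_carrier Units_def ring_mat_simps)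
    then show ?thesis unfolding equivalent_reps_def using similar_mat_wit_refl by blast
  qed
  then show ?thesis using adapted_complete_irreps_exist[of G "\<lambda>_. True"] by blast
qed

lemma irreps_B: "complete_irreps (B m) R \<Longrightarrow> finite_group_irreps (B m) R"
  by (intro finite_group_irreps.intro finite_group_irreps_axioms.intro group_hyperoctahedral finite_carrier_B)

type_synonym B_rep = "(int \<Rightarrow> int) \<Rightarrow> complex mat"

abbreviation deg :: "B_rep \<Rightarrow> nat" where
  "deg \<rho> \<equiv> dim_row (\<rho> id)"

lemma rep_degree_B [simp]: "rep_degree (B m) \<rho> = deg \<rho>"
  by (simp add: rep_degree_def)

text \<open>The base change that decomposes the restriction of \<open>\<sigma>\<close> to
  \<open>B m\<close> is applied to \<open>\<sigma>\<close> on all of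
  \<open>B (Suc m)\<close>.\<close>

lemma adapted_irreps_exist:
  assumes R: "complete_irreps (B m) R"
  shows "\<exists>R'. complete_irreps (B (Suc m)) R' \<and> (\<forall>\<rho>\<in>R'. \<exists>N \<kappa> e. block_decomposition (B m) R N \<kappa> e \<rho> (deg \<rho>))"
proof (rule adapted_complete_irreps_exist)
  interpret G: group "B (Suc m)" by (rule group_hyperoctahedral)
  interpret H: finite_group_irreps "B m" R by (rule irreps_B[OF R])
  fix \<sigma> assume irr: "irreducible_rep (B (Suc m)) \<sigma>"
  define d where "d = deg \<sigma>"
  have r: "rep (B (Suc m)) d \<sigma>" using G.irreducible_repD(1)[OF irr] by (simp add: d_def)
  have sub: "carrier (B m) \<subseteq> carrier (B (Suc m))" by (rule carrier_B_mono) simp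
  then have "rep (B m) d \<sigma>" using r by (auto simp: rep_def)
  then obtain bs P Q where bs: "set bs \<subseteq> R"
    and sim: "\<And>h. h \<in> carrier (B m) \<Longrightarrow> similar_mat_wit (\<sigma> h) (diag_block_mat (map (\<lambda>\<kappa>. \<kappa> h) bs)) P Q"
    using H.complete_reducibility by blast
  have id: "id \<in> carrier (B m)" "id \<in> carrier (B (Suc m))" by auto
  note c = similar_mat_witD2[OF G.repD(1)[OF r id(2)] sim[OF id(1)]]
  define \<rho> where "\<rho> g = Q * \<sigma> g * P" for g
  have r': "rep (B (Suc m)) d \<rho>" and sim': "\<And>g. g \<in> carrier (B (Suc m)) \<Longrightarrow> similar_mat_wit (\<sigma> g) (\<rho> g) P Q"
    unfolding \<rho>_def using rep_conjugate[OF G.is_group r c(6,7,1,2)] by auto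
  have deg: "deg \<rho> = d" using G.repD(4)[OF r'] by simp
  have blocks: "\<rho> h = diag_block_mat (map (\<lambda>\<kappa>. \<kappa> h) bs)" if "h \<in> carrier (B m)" for h
    using similar_mat_witD(3)[OF refl similar_mat_wit_sym[OF sim[OF that]]] by (simp add: \<rho>_def)
  obtain e where e: "block_decomposition (B m) R (length bs) (\<lambda>i. bs ! i) e
      (\<lambda>h. diag_block_mat (map (\<lambda>\<kappa>. \<kappa> h) bs)) (\<Sum>\<kappa>\<leftarrow>bs. rep_degree (B m) \<kappa>)"
    using diag_block_mat_decomposition[OF bs H.rep_irr] by blast
  have dsum: "(\<Sum>\<kappa>\<leftarrow>bs. rep_degree (B m) \<kappa>) = d"
    using blocks[OF id(1)] deg by (simp add: dim_diag_block_mat comp_def)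
  have "block_decomposition (B m) R (length bs) (\<lambda>i. bs ! i) e \<rho> (deg \<rho>)"
    using e[unfolded dsum] blocks unfolding block_decomposition_def deg by simp
  moreover have "irreducible_rep (B (Suc m)) \<rho>" by (rule G.irreducible_conjugate[OF irr sim' r'])
  moreover have "equivalent_reps (B (Suc m)) \<sigma> \<rho>" using sim' by (auto simp: equivalent_reps_def)
  ultimately show "\<exists>\<rho>. irreducible_rep (B (Suc m)) \<rho> \<and> equivalent_reps (B (Suc m)) \<sigma> \<rho> \<and>
      (\<exists>N \<kappa> e. block_decomposition (B m) R N \<kappa> e \<rho> (deg \<rho>))"
    by blast
qed

text \<open>Suppose \<open>\<kappa> i = \<kappa> j\<close>, and let \<open>t k l g\<close> be the trace of the block \<open>(k, l)\<close> of \<open>\<rho> g\<close>, for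
  \<open>k, l \<in> {i, j}\<close>. These functions are invariant under conjugation by \<open>H\<close>, hence under \<open>g \<mapsto> g\<^sup>-\<^sup>1\<close>. By
  orthogonality the convolution of \<open>t k l\<close> and \<open>t l k\<close> is a multiple of \<open>t k k\<close>, and it is symmetric in \<open>k\<close> and
  \<open>l\<close> by inversion. So \<open>t i i = t j j\<close>, which contradicts the independence of the matrix coefficients of \<open>\<rho>\<close>.\<close>

lemma (in group) multiplicity_free:
  assumes H: "H \<subseteq> carrier G" and fin: "finite (carrier G)"
    and conj: "\<And>g. g \<in> carrier G \<Longrightarrow> \<exists>h\<in>H. h \<otimes> g \<otimes> inv h = inv g"
    and irr: "irreducible_rep G \<rho>" and d: "d = rep_degree G \<rho>"
    and dec: "block_decomposition (G\<lparr>carrier := H\<rparr>) R N \<kappa> e \<rho> d"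
    and pos: "\<And>\<kappa>. \<kappa> \<in> R \<Longrightarrow> rep_degree G \<kappa> > 0"
  shows "inj_on \<kappa> {..<N}"
proof (rule inj_onI, rule ccontr)
  fix i j assume "i \<in> {..<N}" "j \<in> {..<N}" and eq: "\<kappa> i = \<kappa> j" and ne: "i \<noteq> j"
  then have ij: "i < N" "j < N" by auto
  define f where "f = rep_degree G (\<kappa> i)"
  have deg: "rep_degree (G\<lparr>carrier := H\<rparr>) \<mu> = rep_degree G \<mu>" for \<mu> by (simp add: rep_degree_def)
  note dec = dec[unfolded block_decomposition_def deg, simplified]
  have fpos: "f > 0" using pos dec ij by (simp add: f_def)
  have r: "rep G d \<rho>" and dpos: "d > 0" using irreducible_repD(1,2)[OF irr] by (simp_all add: d)
  have bij: "bij_betw (\<lambda>(i, a). e i a) (SIGMA i:{..<N}. {..<rep_degree G (\<kappa> i)}) {..<d}" using dec by simp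
  have blk: "\<rho> h $$ (e k a, e l b) = (if k = l then \<kappa> k h $$ (a, b) else 0)"
    if "h \<in> H" "k < N" "l < N" "a < rep_degree G (\<kappa> k)" "b < rep_degree G (\<kappa> l)" for h k l a b
    using dec that by simp
  have k: "k < N" "\<kappa> k = \<kappa> i" "rep_degree G (\<kappa> k) = f" if "k \<in> {i, j}" for k using that ij eq by (auto simp: f_def)
  have lt: "e k a < d" if "k \<in> {i, j}" "a < f" for k a
    using bij_betw_apply[OF bij, of "(k, a)"] that k[OF that(1)] by auto
  have inj: "e k a = e l b \<longleftrightarrow> k = l \<and> a = b" if "k \<in> {i, j}" "a < f" "l \<in> {i, j}" "b < f" for k l a b
    using inj_onD[OF bij_betw_imp_inj_on[OF bij], of "(k, a)" "(l, b)"] that k[OF that(1)] k[OF that(3)] by auto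
  have split: "(\<Sum>x<d. F x) = (\<Sum>k<N. \<Sum>a<rep_degree G (\<kappa> k). F (e k a))" for F :: "nat \<Rightarrow> complex"
    using sum.reindex_bij_betw[OF bij, of F] by (simp add: sum.Sigma case_prod_unfold)
  have row: "(\<Sum>x<d. \<rho> h $$ (e k a, x) * F x) = (\<Sum>b<f. \<kappa> i h $$ (a, b) * F (e k b))"
    and col: "(\<Sum>x<d. F x * \<rho> h $$ (x, e k a)) = (\<Sum>b<f. F (e k b) * \<kappa> i h $$ (b, a))"
    if h: "h \<in> H" and kij: "k \<in> {i, j}" and a: "a < f" for h k a F
  proof -
    have "(\<Sum>x<d. \<rho> h $$ (e k a, x) * F x) = (\<Sum>l<N. if l = k then (\<Sum>b<f. \<kappa> i h $$ (a, b) * F (e k b)) else 0)"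
      unfolding split using h a k[OF kij] by (intro sum.cong refl) (auto simp: blk)
    then show "(\<Sum>x<d. \<rho> h $$ (e k a, x) * F x) = (\<Sum>b<f. \<kappa> i h $$ (a, b) * F (e k b))" using k[OF kij] by simp
    have "(\<Sum>x<d. F x * \<rho> h $$ (x, e k a)) = (\<Sum>l<N. if l = k then (\<Sum>b<f. F (e k b) * \<kappa> i h $$ (b, a)) else 0)"
      unfolding split using h a k[OF kij] by (intro sum.cong refl) (auto simp: blk)
    then show "(\<Sum>x<d. F x * \<rho> h $$ (x, e k a)) = (\<Sum>b<f. F (e k b) * \<kappa> i h $$ (b, a))" using k[OF kij] by simp
  qed
  define t where "t k l g = (\<Sum>x<f. \<rho> g $$ (e k x, e l x))" for k l g
  \<comment> \<open>Cyclicity of the trace holds also for the off-diagonal block, since H acts on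
    both summands by the same matrices \<open>\<kappa> i h\<close>.\<close>
  have t_comm: "t k l (h \<otimes> g) = t k l (g \<otimes> h)"
    if kl: "k \<in> {i, j}" "l \<in> {i, j}" and h: "h \<in> H" and g: "g \<in> carrier G" for k l h g
  proof -
    have hG: "h \<in> carrier G" using h H by blast
    have "t k l (h \<otimes> g) = (\<Sum>x<f. \<Sum>b<f. \<kappa> i h $$ (x, b) * \<rho> g $$ (e k b, e l x))"
      unfolding t_def using lt kl row[OF h kl(1)] by (intro sum.cong refl) (simp add: rep_mult_entry[OF r hG g])
    also have "\<dots> = (\<Sum>b<f. \<Sum>x<f. \<rho> g $$ (e k b, e l x) * \<kappa> i h $$ (x, b))"
      by (subst sum.swap) (simp add: mult.commute)
    also have "\<dots> = t k l (g \<otimes> h)"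
      unfolding t_def using lt kl col[OF h kl(2)] by (intro sum.cong refl) (simp add: rep_mult_entry[OF r g hG])
    finally show ?thesis .
  qed
  have t_inv: "t k l (inv g) = t k l g" if kl: "k \<in> {i, j}" "l \<in> {i, j}" and g: "g \<in> carrier G" for k l g
  proof -
    obtain h where h: "h \<in> H" "h \<otimes> g \<otimes> inv h = inv g" using conj[OF g] by blast
    have hG: "h \<in> carrier G" using h H by blast
    have "t k l (inv g) = t k l (h \<otimes> (g \<otimes> inv h))" using h(2) hG g by (simp add: m_assoc)
    also have "\<dots> = t k l g" using t_comm[OF kl h(1), of "g \<otimes> inv h"] hG g by (simp add: m_assoc)
    finally show ?thesis .
  qed
  define c where "c = of_nat (card (carrier G)) / (of_nat d :: complex)"
  have "card (carrier G) > 0" using fin one_closed card_gt_0_iff by blast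
  then have c0: "c \<noteq> 0" using dpos by (simp add: c_def)
  have orth: "(\<Sum>g\<in>carrier G. \<rho> g $$ (u, v) * \<rho> (inv g) $$ (x, y)) = (if u = y \<and> x = v then c else 0)"
    if "u < d" "v < d" "x < d" "y < d" for u v x y
    using orthogonality_same[OF irr d that] by (simp add: c_def)
  have conv: "(\<Sum>g\<in>carrier G. t k l (inv g) * t l k (g \<otimes> w)) = c * t k k w"
    if kl: "k \<in> {i, j}" "l \<in> {i, j}" and w: "w \<in> carrier G" for k l w
  proof -
    have "(\<Sum>g\<in>carrier G. t k l (inv g) * t l k (g \<otimes> w))
        = (\<Sum>g\<in>carrier G. \<Sum>x<f. \<Sum>y<f. \<Sum>z<d. \<rho> g $$ (e l y, z) * \<rho> (inv g) $$ (e k x, e l x) * \<rho> w $$ (z, e k y))"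
      unfolding t_def sum_product using lt kl
      by (intro sum.cong refl) (simp add: rep_mult_entry[OF r _ w] sum_distrib_left mult_ac)
    also have "\<dots> = (\<Sum>x<f. \<Sum>g\<in>carrier G. \<Sum>y<f. \<Sum>z<d. \<rho> g $$ (e l y, z) * \<rho> (inv g) $$ (e k x, e l x) * \<rho> w $$ (z, e k y))"
      by (rule sum.swap)
    also have "\<dots> = (\<Sum>x<f. \<Sum>y<f. \<Sum>g\<in>carrier G. \<Sum>z<d. \<rho> g $$ (e l y, z) * \<rho> (inv g) $$ (e k x, e l x) * \<rho> w $$ (z, e k y))"
      by (intro sum.cong refl sum.swap)
    also have "\<dots> = (\<Sum>x<f. \<Sum>y<f. \<Sum>z<d. \<Sum>g\<in>carrier G. \<rho> g $$ (e l y, z) * \<rho> (inv g) $$ (e k x, e l x) * \<rho> w $$ (z, e k y))"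
      by (intro sum.cong refl sum.swap)
    also have "\<dots> = (\<Sum>x<f. \<Sum>y<f. \<Sum>z<d. if z = e k x then (if y = x then c * \<rho> w $$ (z, e k y) else 0) else 0)"
      using lt kl inj by (intro sum.cong refl) (auto simp: sum_distrib_right[symmetric] orth)
    also have "\<dots> = c * t k k w"
      unfolding t_def sum_distrib_left using lt kl by (intro sum.cong refl) simp
    finally show ?thesis .
  qed
  \<comment> \<open>Shifting g by \<open>inv w\<close> and inverting both arguments turns the
    convolution for (i, j) at \<open>w\<close> into the one for (j, i) at
    \<open>inv w\<close>.\<close>
  have t_eq: "t i i w = t j j w" if w: "w \<in> carrier G" for w
  proof -
    have "c * t i i w = (\<Sum>g\<in>carrier G. t i j (inv (g \<otimes> inv w)) * t j i (g \<otimes> inv w \<otimes> w))"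
      using sum_right_translate[of "inv w" "\<lambda>g. t i j (inv g) * t j i (g \<otimes> w)"] conv[of i j w] w by simp
    also have "\<dots> = (\<Sum>g\<in>carrier G. t j i (inv g) * t i j (g \<otimes> inv w))"
      using w by (intro sum.cong refl) (simp add: t_inv m_assoc del: inv_mult_group)
    also have "\<dots> = c * t j j w" using conv[of j i "inv w"] w by (simp add: t_inv)
    finally show ?thesis using c0 by simp
  qed
  \<comment> \<open>Pairing with the diagonal coefficient at \<open>e i 0\<close> distinguishes
    \<open>t i i\<close> from \<open>t j j\<close>: it gives c for the former and 0 for the
    latter.\<close>
  have coeff: "(\<Sum>g\<in>carrier G. t k k g * \<rho> (inv g) $$ (e i 0, e i 0)) = (if k = i then c else 0)" if kij: "k \<in> {i, j}" for k
  proof -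
    have "(\<Sum>g\<in>carrier G. t k k g * \<rho> (inv g) $$ (e i 0, e i 0))
        = (\<Sum>x<f. \<Sum>g\<in>carrier G. \<rho> g $$ (e k x, e k x) * \<rho> (inv g) $$ (e i 0, e i 0))"
      unfolding t_def sum_distrib_right by (rule sum.swap)
    also have "\<dots> = (\<Sum>x<f. if x = 0 then (if k = i then c else 0) else 0)"
      using lt kij inj fpos by (intro sum.cong refl) (auto simp: orth)
    finally show ?thesis using fpos by simp
  qed
  have "(\<Sum>g\<in>carrier G. t i i g * \<rho> (inv g) $$ (e i 0, e i 0)) = (\<Sum>g\<in>carrier G. t j j g * \<rho> (inv g) $$ (e i 0, e i 0))"
    by (intro sum.cong refl) (simp add: t_eq)
  then show False using coeff[of i] coeff[of j] ne c0 by simp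
qed

lemma multiplicity_free_B:
  assumes R: "complete_irreps (B m) R" and irr: "irreducible_rep (B (Suc m)) \<rho>"
    and dec: "block_decomposition (B m) R N \<kappa> e \<rho> (deg \<rho>)"
  shows "inj_on \<kappa> {..<N}"
proof -
  interpret G: group "B (Suc m)" by (rule group_hyperoctahedral)
  interpret H: finite_group_irreps "B m" R by (rule irreps_B[OF R])
  have sub: "carrier (B m) \<subseteq> carrier (B (Suc m))" by (rule carrier_B_mono) simp
  have B: "B (Suc m)\<lparr>carrier := carrier (B m)\<rparr> = B m" by (simp add: hyperoctahedral_def)
  show ?thesis
  proof (rule G.multiplicity_free[OF sub finite_carrier_B _ irr refl])
    fix g assume g: "g \<in> carrier (B (Suc m))"
    obtain h where h: "h \<in> carrier (B m)" "h \<circ> g = inv_into UNIV g \<circ> h" using inverse_conjugate[OF g] by blast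
    have "h \<otimes>\<^bsub>B (Suc m)\<^esub> g \<otimes>\<^bsub>B (Suc m)\<^esub> inv\<^bsub>B (Suc m)\<^esub> h
        = inv\<^bsub>B (Suc m)\<^esub> g \<otimes>\<^bsub>B (Suc m)\<^esub> h \<otimes>\<^bsub>B (Suc m)\<^esub> inv\<^bsub>B (Suc m)\<^esub> h"
      using h(2) B_inv(1)[OF g] by simp
    also have "\<dots> = inv\<^bsub>B (Suc m)\<^esub> g" using subsetD[OF sub h(1)] g by (simp add: G.m_assoc del: B_simps)
    finally show "\<exists>h\<in>carrier (B m). h \<otimes>\<^bsub>B (Suc m)\<^esub> g \<otimes>\<^bsub>B (Suc m)\<^esub> inv\<^bsub>B (Suc m)\<^esub> h = inv\<^bsub>B (Suc m)\<^esub> g"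
      using h(1) by blast
  qed (use dec H.degree_pos in \<open>simp_all add: B\<close>)
qed

section \<open>Adapted bases along the tower of hyperoctahedral groups\<close>

text \<open>The arguments of a representation have to stay compositions of group elements.\<close>

declare id_apply [simp del] comp_apply [simp del] of_nat_Suc [simp del]

text \<open>A summand is described by its effect on row and column sums, not by its entries. In this
  form a matrix product shrinks in a single rewriting step, and summands two levels apart are
  obtained by composing the index maps.\<close>

definition embedded :: "nat \<Rightarrow> B_rep \<Rightarrow> B_rep \<Rightarrow> (nat \<Rightarrow> nat) \<Rightarrow> bool" where
  "embedded m \<kappa> \<rho> e \<longleftrightarrow> (\<forall>a<deg \<kappa>. e a < deg \<rho>) \<and>
     (\<forall>h\<in>carrier (B m). \<forall>F. \<forall>a<deg \<kappa>.
        (\<Sum>x<deg \<rho>. \<rho> h $$ (e a, x) * F x) = (\<Sum>b<deg \<kappa>. \<kappa> h $$ (a, b) * F (e b)) \<and>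
        (\<Sum>x<deg \<rho>. F x * \<rho> h $$ (x, e a)) = (\<Sum>b<deg \<kappa>. F (e b) * \<kappa> h $$ (b, a)))"

lemma embeddedD:
  assumes "embedded m \<kappa> \<rho> e"
  shows "a < deg \<kappa> \<Longrightarrow> e a < deg \<rho>"
    and "h \<in> carrier (B m) \<Longrightarrow> a < deg \<kappa> \<Longrightarrow>
      (\<Sum>x<deg \<rho>. \<rho> h $$ (e a, x) * F x) = (\<Sum>b<deg \<kappa>. \<kappa> h $$ (a, b) * F (e b))"
    and "h \<in> carrier (B m) \<Longrightarrow> a < deg \<kappa> \<Longrightarrow>
      (\<Sum>x<deg \<rho>. F x * \<rho> h $$ (x, e a)) = (\<Sum>b<deg \<kappa>. F (e b) * \<kappa> h $$ (b, a))"
  using assms by (auto simp: embedded_def)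

lemma embedded_trans:
  assumes e: "embedded m \<kappa> \<rho> e" and e': "embedded k \<theta> \<kappa> e'" and km: "k \<le> m"
  shows "embedded k \<theta> \<rho> (\<lambda>a. e (e' a))"
  unfolding embedded_def
proof (intro conjI allI impI ballI)
  fix a assume a: "a < deg \<theta>"
  then show "e (e' a) < deg \<rho>" using embeddedD(1)[OF e] embeddedD(1)[OF e'] by blast
next
  fix h F a assume h: "h \<in> carrier (B k)" and a: "a < deg \<theta>"
  have h': "h \<in> carrier (B m)" using h carrier_B_mono[OF km] by auto
  note ea = embeddedD(1)[OF e' a]
  show "(\<Sum>x<deg \<rho>. \<rho> h $$ (e (e' a), x) * F x) = (\<Sum>b<deg \<theta>. \<theta> h $$ (a, b) * F (e (e' b)))"
    using embeddedD(2)[OF e h' ea, of F] embeddedD(2)[OF e' h a, of "\<lambda>x. F (e x)"] by simp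
  show "(\<Sum>x<deg \<rho>. F x * \<rho> h $$ (x, e (e' a))) = (\<Sum>b<deg \<theta>. F (e (e' b)) * \<theta> h $$ (b, a))"
    using embeddedD(3)[OF e h' ea, of F] embeddedD(3)[OF e' h a, of "\<lambda>x. F (e x)"] by simp
qed

text \<open>Because no child is repeated, the blocks of \<open>\<rho>\<close> can be indexed by the
  children themselves: \<open>emb m \<rho> \<kappa> a\<close> is the position in
  \<open>\<rho>\<close> of the basis vector number a of \<open>\<kappa>\<close>.\<close>

locale tower =
  fixes R :: "nat \<Rightarrow> B_rep set"
    and ch :: "nat \<Rightarrow> B_rep \<Rightarrow> B_rep set"
    and emb :: "nat \<Rightarrow> B_rep \<Rightarrow> B_rep \<Rightarrow> nat \<Rightarrow> nat"
  assumes complete: "complete_irreps (B m) (R m)"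
    and ch_sub: "\<rho> \<in> R (Suc m) \<Longrightarrow> ch m \<rho> \<subseteq> R m"
    and emb_bij: "\<rho> \<in> R (Suc m) \<Longrightarrow>
      bij_betw (\<lambda>(\<kappa>, a). emb m \<rho> \<kappa> a) (SIGMA \<kappa>:ch m \<rho>. {..<deg \<kappa>}) {..<deg \<rho>}"
    and emb_block: "\<rho> \<in> R (Suc m) \<Longrightarrow> h \<in> carrier (B m) \<Longrightarrow> \<kappa> \<in> ch m \<rho> \<Longrightarrow> \<mu> \<in> ch m \<rho> \<Longrightarrow>
      a < deg \<kappa> \<Longrightarrow> b < deg \<mu> \<Longrightarrow>
      \<rho> h $$ (emb m \<rho> \<kappa> a, emb m \<rho> \<mu> b) = (if \<kappa> = \<mu> then \<kappa> h $$ (a, b) else 0)"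

text \<open>Dependent choice is needed since the representatives on one level must be adapted to
  those already fixed one level below. Freedom from multiplicities then turns block numbers into
  children.\<close>

lemma tower_exists: "\<exists>R ch emb. tower R ch emb"
proof -
  define adapted where "adapted m R R' \<longleftrightarrow>
    (\<forall>\<rho>\<in>R'. \<exists>N \<kappa> e. block_decomposition (B m) R N \<kappa> e \<rho> (deg \<rho>))" for m R R'
  have "\<exists>R. \<forall>m. complete_irreps (B m) (R m) \<and> adapted m (R m) (R (Suc m))"
    by (rule dependent_nat_choice) (use complete_irreps_exist adapted_irreps_exist in \<open>auto simp: adapted_def\<close>)
  then obtain R where R: "\<And>m. complete_irreps (B m) (R m)" and ad: "\<And>m. adapted m (R m) (R (Suc m))"
    by blast
  define blocks where "blocks m \<rho> C e \<longleftrightarrow> C \<subseteq> R m \<and>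
      bij_betw (\<lambda>(\<kappa>, a). e \<kappa> a) (SIGMA \<kappa>:C. {..<deg \<kappa>}) {..<deg \<rho>} \<and>
      (\<forall>h\<in>carrier (B m). \<forall>\<kappa>\<in>C. \<forall>\<mu>\<in>C. \<forall>a<deg \<kappa>. \<forall>b<deg \<mu>.
        \<rho> h $$ (e \<kappa> a, e \<mu> b) = (if \<kappa> = \<mu> then \<kappa> h $$ (a, b) else 0))" for m \<rho> C and e :: "_ \<Rightarrow> nat \<Rightarrow> nat"
  have ex: "\<exists>C e. blocks m \<rho> C e"
    if \<rho>: "\<rho> \<in> R (Suc m)" for m \<rho>
  proof -
    obtain N \<kappa> e where dec: "block_decomposition (B m) (R m) N \<kappa> e \<rho> (deg \<rho>)"
      using ad[of m] \<rho> unfolding adapted_def by blast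
    have irr: "irreducible_rep (B (Suc m)) \<rho>" using R \<rho> by (auto simp: complete_irreps_def)
    have inj: "inj_on \<kappa> {..<N}" by (rule multiplicity_free_B[OF R irr dec])
    define idx where "idx = the_inv_into {..<N} \<kappa>"
    have idx: "idx (\<kappa> i) = i" if "i < N" for i unfolding idx_def using the_inv_into_f_f[OF inj] that by simp
    have "bij_betw (\<lambda>(\<mu>, a). (idx \<mu>, a)) (SIGMA \<mu>:\<kappa> ` {..<N}. {..<deg \<mu>}) (SIGMA i:{..<N}. {..<deg (\<kappa> i)})"
      by (rule bij_betwI[where g = "\<lambda>(i, a). (\<kappa> i, a)"]) (auto simp: idx)
    from bij_betw_trans[OF this dec[unfolded block_decomposition_def rep_degree_B, THEN conjunct2, THEN conjunct1]]
    have "bij_betw ((\<lambda>(i, a). e i a) \<circ> (\<lambda>(\<mu>, a). (idx \<mu>, a))) (SIGMA \<mu>:\<kappa> ` {..<N}. {..<deg \<mu>}) {..<deg \<rho>}" .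
    moreover have "(\<lambda>(i, a). e i a) \<circ> (\<lambda>(\<mu>, a). (idx \<mu>, a)) = (\<lambda>(\<mu>, a). e (idx \<mu>) a)"
      by (auto simp: comp_apply fun_eq_iff)
    ultimately show ?thesis
      using dec idx unfolding blocks_def by (intro exI[of _ "\<kappa> ` {..<N}"] exI[of _ "\<lambda>\<mu>. e (idx \<mu>)"])
        (auto simp: block_decomposition_def inj_on_eq_iff[OF inj])
  qed
  define ch where "ch m \<rho> = (SOME C. \<exists>e. blocks m \<rho> C e)" for m \<rho>
  define emb where "emb m \<rho> = (SOME e. blocks m \<rho> (ch m \<rho>) e)" for m \<rho>
  have ce: "blocks m \<rho> (ch m \<rho>) (emb m \<rho>)" if "\<rho> \<in> R (Suc m)" for m \<rho>
  proof -
    have "\<exists>e. blocks m \<rho> (ch m \<rho>) e" using someI_ex[OF ex[OF that]] by (simp only: ch_def)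
    then show ?thesis unfolding emb_def by (rule someI_ex)
  qed
  have "tower R ch emb"
  proof
    show "complete_irreps (B m) (R m)" for m by (rule R)
  qed (use ce in \<open>auto simp: blocks_def\<close>)
  then show ?thesis by blast
qed

context tower begin

lemma irreps: "finite_group_irreps (B m) (R m)"
  by (rule irreps_B[OF complete])

lemma finite_R: "finite (R m)"
  by (rule finite_group_irreps.finite_irreps[OF irreps])

lemma rep_R: "\<rho> \<in> R m \<Longrightarrow> rep (B m) (deg \<rho>) \<rho>"
  and deg_pos: "\<rho> \<in> R m \<Longrightarrow> deg \<rho> > 0"
  using finite_group_irreps.rep_irr[OF irreps] finite_group_irreps.degree_pos[OF irreps] by auto

lemma R_id_entry: "\<rho> \<in> R m \<Longrightarrow> i < deg \<rho> \<Longrightarrow> j < deg \<rho> \<Longrightarrow> \<rho> id $$ (i, j) = (if i = j then 1 else 0)"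
  using group.repD(3)[OF group_hyperoctahedral rep_R, of \<rho> m]
  by (metis B_simps(2) index_one_mat(1))

lemma comp_entry:
  assumes "\<rho> \<in> R m" "g \<in> carrier (B m)" "h \<in> carrier (B m)" "i < deg \<rho>" "j < deg \<rho>"
  shows "\<rho> (g \<circ> h) $$ (i, j) = (\<Sum>k<deg \<rho>. \<rho> g $$ (i, k) * \<rho> h $$ (k, j))"
  using group.rep_mult_entry[OF group_hyperoctahedral rep_R[OF assms(1)] assms(2-5)] by simp

lemma finite_ch: "\<rho> \<in> R (Suc m) \<Longrightarrow> finite (ch m \<rho>)"
  using finite_subset[OF ch_sub finite_R] .

lemma ch_in_R: "\<rho> \<in> R (Suc m) \<Longrightarrow> \<kappa> \<in> ch m \<rho> \<Longrightarrow> \<kappa> \<in> R m"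
  using ch_sub by blast

lemma emb_lt: "\<rho> \<in> R (Suc m) \<Longrightarrow> \<kappa> \<in> ch m \<rho> \<Longrightarrow> a < deg \<kappa> \<Longrightarrow> emb m \<rho> \<kappa> a < deg \<rho>"
  using bij_betw_apply[OF emb_bij, of \<rho> m "(\<kappa>, a)"] by auto

lemma emb_eq_iff:
  assumes "\<rho> \<in> R (Suc m)" "\<kappa> \<in> ch m \<rho>" "a < deg \<kappa>" "\<mu> \<in> ch m \<rho>" "b < deg \<mu>"
  shows "emb m \<rho> \<kappa> a = emb m \<rho> \<mu> b \<longleftrightarrow> \<kappa> = \<mu> \<and> a = b"
  using inj_on_eq_iff[OF bij_betw_imp_inj_on[OF emb_bij[OF assms(1)]], of "(\<kappa>, a)" "(\<mu>, b)"] assms by auto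

lemma emb_cases:
  assumes "\<rho> \<in> R (Suc m)" "i < deg \<rho>"
  obtains \<kappa> a where "\<kappa> \<in> ch m \<rho>" "a < deg \<kappa>" "i = emb m \<rho> \<kappa> a"
proof -
  have "i \<in> (\<lambda>(\<kappa>, a). emb m \<rho> \<kappa> a) ` (SIGMA \<kappa>:ch m \<rho>. {..<deg \<kappa>})"
    using bij_betw_imp_surj_on[OF emb_bij[OF assms(1)]] assms(2) by simp
  then show ?thesis using that by auto
qed

lemma sum_blocks:
  fixes F :: "nat \<Rightarrow> 'c :: comm_monoid_add"
  assumes "\<rho> \<in> R (Suc m)"
  shows "(\<Sum>x<deg \<rho>. F x) = (\<Sum>\<kappa>\<in>ch m \<rho>. \<Sum>a<deg \<kappa>. F (emb m \<rho> \<kappa> a))"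
  using sum.reindex_bij_betw[OF emb_bij[OF assms], of F] finite_ch[OF assms]
  by (simp add: sum.Sigma case_prod_unfold)

lemma sum_deg_ch: "\<rho> \<in> R (Suc m) \<Longrightarrow> (\<Sum>\<kappa>\<in>ch m \<rho>. deg \<kappa>) = deg \<rho>"
  using sum_blocks[of \<rho> m "\<lambda>_. 1 :: nat"] by (simp add: id_apply)

lemma ch_nonempty: "\<rho> \<in> R (Suc m) \<Longrightarrow> ch m \<rho> \<noteq> {}"
  using sum_deg_ch[of \<rho> m] deg_pos[of \<rho> "Suc m"] by auto

lemma embedded_emb:
  assumes \<rho>: "\<rho> \<in> R (Suc m)" and \<kappa>: "\<kappa> \<in> ch m \<rho>"
  shows "embedded m \<kappa> \<rho> (emb m \<rho> \<kappa>)"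
  unfolding embedded_def
proof (intro conjI allI impI ballI)
  show "emb m \<rho> \<kappa> a < deg \<rho>" if "a < deg \<kappa>" for a using emb_lt[OF \<rho> \<kappa> that] .
  fix h F a assume h: "h \<in> carrier (B m)" and a: "a < deg \<kappa>"
  have "(\<Sum>x<deg \<rho>. \<rho> h $$ (emb m \<rho> \<kappa> a, x) * F x)
      = (\<Sum>\<mu>\<in>ch m \<rho>. if \<mu> = \<kappa> then (\<Sum>b<deg \<kappa>. \<kappa> h $$ (a, b) * F (emb m \<rho> \<kappa> b)) else 0)"
    unfolding sum_blocks[OF \<rho>] by (intro sum.cong refl) (auto simp: emb_block[OF \<rho> h \<kappa> _ a])
  then show "(\<Sum>x<deg \<rho>. \<rho> h $$ (emb m \<rho> \<kappa> a, x) * F x) = (\<Sum>b<deg \<kappa>. \<kappa> h $$ (a, b) * F (emb m \<rho> \<kappa> b))"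
    using \<kappa> finite_ch[OF \<rho>] by simp
  have "(\<Sum>x<deg \<rho>. F x * \<rho> h $$ (x, emb m \<rho> \<kappa> a))
      = (\<Sum>\<mu>\<in>ch m \<rho>. if \<mu> = \<kappa> then (\<Sum>b<deg \<kappa>. F (emb m \<rho> \<kappa> b) * \<kappa> h $$ (b, a)) else 0)"
    unfolding sum_blocks[OF \<rho>] by (intro sum.cong refl) (auto simp: emb_block[OF \<rho> h _ \<kappa> _ a])
  then show "(\<Sum>x<deg \<rho>. F x * \<rho> h $$ (x, emb m \<rho> \<kappa> a)) = (\<Sum>b<deg \<kappa>. F (emb m \<rho> \<kappa> b) * \<kappa> h $$ (b, a))"
    using \<kappa> finite_ch[OF \<rho>] by simp
qed

text \<open>Cutting a matrix that commutes with \<open>B k\<close> down to two embedded summands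
  leaves an intertwiner, to which Schur's lemma applies. The level k may lie two steps below that of
  \<open>\<rho>\<close>, as \<open>adjacent_swap\<close> requires.\<close>

lemma commuting_block:
  fixes M :: "nat \<Rightarrow> nat \<Rightarrow> complex"
  assumes \<theta>: "\<theta> \<in> R k" "embedded k \<theta> \<rho> e" and \<theta>': "\<theta>' \<in> R k" "embedded k \<theta>' \<rho> e'"
    and comm: "\<And>h x y. h \<in> carrier (B k) \<Longrightarrow> x < deg \<rho> \<Longrightarrow> y < deg \<rho> \<Longrightarrow>
      (\<Sum>z<deg \<rho>. \<rho> h $$ (x, z) * M z y) = (\<Sum>z<deg \<rho>. M x z * \<rho> h $$ (z, y))"
  shows "\<exists>c. \<forall>a<deg \<theta>'. \<forall>b<deg \<theta>. M (e' a) (e b) = (if \<theta>' = \<theta> \<and> a = b then c else 0)"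
proof -
  have "(\<Sum>x<deg \<theta>'. \<theta>' h $$ (a, x) * M (e' x) (e b)) = (\<Sum>x<deg \<theta>. M (e' a) (e x) * \<theta> h $$ (x, b))"
    if "h \<in> carrier (B k)" "a < deg \<theta>'" "b < deg \<theta>" for h a b
    using embeddedD(2)[OF \<theta>'(2) that(1,2), of "\<lambda>z. M z (e b)"] embeddedD(3)[OF \<theta>(2) that(1,3), of "\<lambda>z. M (e' a) z"]
      comm[OF that(1) embeddedD(1)[OF \<theta>'(2) that(2)] embeddedD(1)[OF \<theta>(2) that(3)]] by simp
  then show ?thesis
    using finite_group_irreps.intertwiner_entries[OF irreps \<theta>(1) \<theta>'(1), of "\<lambda>a b. M (e' a) (e b)"] by simp
qed

section \<open>Scalars by which commuting elements act on blocks\<close>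

lemma commuting_element:
  assumes "\<rho> \<in> R n" "g \<in> carrier (B n)" "k \<le> n" "\<And>h. h \<in> carrier (B k) \<Longrightarrow> h \<circ> g = g \<circ> h"
    "h \<in> carrier (B k)" "x < deg \<rho>" "y < deg \<rho>"
  shows "(\<Sum>z<deg \<rho>. \<rho> h $$ (x, z) * \<rho> g $$ (z, y)) = (\<Sum>z<deg \<rho>. \<rho> g $$ (x, z) * \<rho> h $$ (z, y))"
proof -
  have h: "h \<in> carrier (B n)" using assms(5) carrier_B_mono[OF assms(3)] by auto
  show ?thesis
    using comp_entry[OF assms(1) h assms(2,6,7)] comp_entry[OF assms(1,2) h assms(6,7)] assms(4)[OF assms(5)] by simp
qed

text \<open>The last sign change commutes with \<open>B m\<close> and is therefore scalar on the
  summand \<open>\<kappa>\<close>; the scalar is read off at basis vector 0, which exists because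
  degrees are positive.\<close>

definition flip_eig :: "nat \<Rightarrow> B_rep \<Rightarrow> B_rep \<Rightarrow> complex" where
  "flip_eig m \<kappa> \<rho> = \<rho> (last_flip (Suc m)) $$ (emb m \<rho> \<kappa> 0, emb m \<rho> \<kappa> 0)"

text \<open>The matrix of the Jucys--Murphy element of \<open>B (Suc m)\<close>, the sum of the reflections
  exchanging \<open>\<plusminus> (m + 1)\<close> with some other letter.\<close>

definition jm :: "nat \<Rightarrow> B_rep \<Rightarrow> nat \<Rightarrow> nat \<Rightarrow> complex" where
  "jm m \<rho> x y = (\<Sum>i\<in>letters m. \<rho> (signed_swap i (int (Suc m))) $$ (x, y))"

definition jm_eig :: "nat \<Rightarrow> B_rep \<Rightarrow> B_rep \<Rightarrow> complex" where
  "jm_eig m \<kappa> \<rho> = jm m \<rho> (emb m \<rho> \<kappa> 0) (emb m \<rho> \<kappa> 0)"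

text \<open>The swap of the letters m + 1 and m + 2 commutes with \<open>B m\<close>, so it maps the
  copy of \<open>\<theta>\<close> inside \<open>\<kappa>\<close> to the copy inside
  \<open>\<mu>\<close> by a scalar. The target \<open>\<mu>\<close> comes first, like a row
  index.\<close>

definition swap_coeff :: "nat \<Rightarrow> B_rep \<Rightarrow> B_rep \<Rightarrow>
    B_rep \<Rightarrow> B_rep \<Rightarrow> complex" where
  "swap_coeff m \<rho> \<mu> \<kappa> \<theta> = \<rho> (adjacent_swap (Suc m)) $$
     (emb (Suc m) \<rho> \<mu> (emb m \<mu> \<theta> 0), emb (Suc m) \<rho> \<kappa> (emb m \<kappa> \<theta> 0))"

lemma block_scalar:
  assumes \<rho>: "\<rho> \<in> R (Suc m)" and \<kappa>: "\<kappa> \<in> ch m \<rho>" "a < deg \<kappa>" and \<mu>: "\<mu> \<in> ch m \<rho>" "b < deg \<mu>"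
    and comm: "\<And>h x y. h \<in> carrier (B m) \<Longrightarrow> x < deg \<rho> \<Longrightarrow> y < deg \<rho> \<Longrightarrow>
      (\<Sum>z<deg \<rho>. \<rho> h $$ (x, z) * M z y) = (\<Sum>z<deg \<rho>. M x z * \<rho> h $$ (z, y))"
  shows "M (emb m \<rho> \<mu> b) (emb m \<rho> \<kappa> a)
    = (if \<mu> = \<kappa> \<and> b = a then M (emb m \<rho> \<kappa> 0) (emb m \<rho> \<kappa> 0) else 0)"
proof -
  note k = ch_in_R[OF \<rho> \<kappa>(1)] and m = ch_in_R[OF \<rho> \<mu>(1)]
  obtain c where c: "\<forall>b<deg \<mu>. \<forall>a<deg \<kappa>. M (emb m \<rho> \<mu> b) (emb m \<rho> \<kappa> a) = (if \<mu> = \<kappa> \<and> b = a then c else 0)"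
    using commuting_block[OF k embedded_emb[OF \<rho> \<kappa>(1)] m embedded_emb[OF \<rho> \<mu>(1)] comm] by blast
  show ?thesis
  proof (cases "\<mu> = \<kappa>")
    case True
    then have "M (emb m \<rho> \<kappa> 0) (emb m \<rho> \<kappa> 0) = c" using c deg_pos[OF k] by auto
    then show ?thesis using c \<kappa> \<mu> by auto
  qed (use c \<kappa> \<mu> in auto)
qed

lemma flip_entry:
  assumes "\<rho> \<in> R (Suc m)" "\<kappa> \<in> ch m \<rho>" "a < deg \<kappa>" "\<mu> \<in> ch m \<rho>" "b < deg \<mu>"
  shows "\<rho> (last_flip (Suc m)) $$ (emb m \<rho> \<mu> b, emb m \<rho> \<kappa> a) = (if \<mu> = \<kappa> \<and> b = a then flip_eig m \<kappa> \<rho> else 0)"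
  unfolding flip_eig_def
  by (rule block_scalar[OF assms, of "\<lambda>x y. \<rho> (last_flip (Suc m)) $$ (x, y)"])
    (rule commuting_element[OF assms(1) last_flip_in_B _ last_flip_commute], auto)

lemma jm_entry:
  assumes \<rho>: "\<rho> \<in> R (Suc m)" and "\<kappa> \<in> ch m \<rho>" "a < deg \<kappa>" "\<mu> \<in> ch m \<rho>" "b < deg \<mu>"
  shows "jm m \<rho> (emb m \<rho> \<mu> b) (emb m \<rho> \<kappa> a) = (if \<mu> = \<kappa> \<and> b = a then jm_eig m \<kappa> \<rho> else 0)"
  unfolding jm_eig_def
proof (rule block_scalar[OF assms, of "jm m \<rho>"])
  fix h x y assume h: "h \<in> carrier (B m)" and xy: "x < deg \<rho>" "y < deg \<rho>"
  have h': "h \<in> carrier (B (Suc m))" using h carrier_B_mono[of m "Suc m"] by auto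
  have sw: "signed_swap i (int (Suc m)) \<in> carrier (B (Suc m))" if "i \<in> letters m" for i
    using that by (intro signed_swap_in_B) (auto simp: letters_def)
  have "(\<Sum>z<deg \<rho>. \<rho> h $$ (x, z) * jm m \<rho> z y) = (\<Sum>i\<in>letters m. \<rho> (h \<circ> signed_swap i (int (Suc m))) $$ (x, y))"
    unfolding jm_def sum_distrib_left using comp_entry[OF \<rho> h' sw xy]
    by (subst sum.swap) (intro sum.cong refl, simp)
  also have "\<dots> = (\<Sum>i\<in>letters m. \<rho> (signed_swap (h i) (int (Suc m)) \<circ> h) $$ (x, y))"
    by (simp add: signed_swap_last_conjugate[OF h])
  also have "\<dots> = (\<Sum>i\<in>letters m. \<rho> (signed_swap i (int (Suc m)) \<circ> h) $$ (x, y))"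
    by (rule sum.reindex_bij_betw[OF permutes_imp_bij[OF BD(1)[OF h]], of "\<lambda>i. \<rho> (signed_swap i (int (Suc m)) \<circ> h) $$ (x, y)"])
  also have "\<dots> = (\<Sum>z<deg \<rho>. jm m \<rho> x z * \<rho> h $$ (z, y))"
    unfolding jm_def sum_distrib_right using comp_entry[OF \<rho> sw h' xy]
    by (subst sum.swap) (intro sum.cong refl, simp)
  finally show "(\<Sum>z<deg \<rho>. \<rho> h $$ (x, z) * jm m \<rho> z y) = (\<Sum>z<deg \<rho>. jm m \<rho> x z * \<rho> h $$ (z, y))" .
qed

lemma swap_entry:
  assumes \<rho>: "\<rho> \<in> R (Suc (Suc m))" and \<kappa>: "\<kappa> \<in> ch (Suc m) \<rho>" "\<theta> \<in> ch m \<kappa>" "a < deg \<theta>"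
    and \<mu>: "\<mu> \<in> ch (Suc m) \<rho>" "\<theta>' \<in> ch m \<mu>" "b < deg \<theta>'"
  shows "\<rho> (adjacent_swap (Suc m)) $$ (emb (Suc m) \<rho> \<mu> (emb m \<mu> \<theta>' b), emb (Suc m) \<rho> \<kappa> (emb m \<kappa> \<theta> a))
    = (if \<theta>' = \<theta> \<and> b = a then swap_coeff m \<rho> \<mu> \<kappa> \<theta> else 0)"
proof -
  note kR = ch_in_R[OF \<rho> \<kappa>(1)] and mR = ch_in_R[OF \<rho> \<mu>(1)]
  note tR = ch_in_R[OF kR \<kappa>(2)] and tR' = ch_in_R[OF mR \<mu>(2)]
  note e = embedded_trans[OF embedded_emb[OF \<rho> \<kappa>(1)] embedded_emb[OF kR \<kappa>(2)] le_SucI[OF order_refl]]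
  note e' = embedded_trans[OF embedded_emb[OF \<rho> \<mu>(1)] embedded_emb[OF mR \<mu>(2)] le_SucI[OF order_refl]]
  have "\<exists>c. \<forall>b<deg \<theta>'. \<forall>a<deg \<theta>.
     \<rho> (adjacent_swap (Suc m)) $$ (emb (Suc m) \<rho> \<mu> (emb m \<mu> \<theta>' b), emb (Suc m) \<rho> \<kappa> (emb m \<kappa> \<theta> a))
       = (if \<theta>' = \<theta> \<and> b = a then c else 0)"
    by (rule commuting_block[OF tR e tR' e', where M = "\<lambda>x y. \<rho> (adjacent_swap (Suc m)) $$ (x, y)"])
      (rule commuting_element[OF \<rho> adjacent_swap_in_B _ adjacent_swap_commute, where k = m], auto)
  then obtain c where c: "\<forall>b<deg \<theta>'. \<forall>a<deg \<theta>.
     \<rho> (adjacent_swap (Suc m)) $$ (emb (Suc m) \<rho> \<mu> (emb m \<mu> \<theta>' b), emb (Suc m) \<rho> \<kappa> (emb m \<kappa> \<theta> a))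
       = (if \<theta>' = \<theta> \<and> b = a then c else 0)" by blast
  show ?thesis
  proof (cases "\<theta>' = \<theta>")
    case True
    then have "swap_coeff m \<rho> \<mu> \<kappa> \<theta> = c" using c deg_pos[OF tR] by (auto simp: swap_coeff_def)
    then show ?thesis using c \<kappa> \<mu> by auto
  qed (use c \<kappa> \<mu> in auto)
qed

lemma scalar_row:
  assumes "\<rho> \<in> R (Suc m)" "\<kappa> \<in> ch m \<rho>" "a < deg \<kappa>"
    and M: "\<And>\<mu> b. \<mu> \<in> ch m \<rho> \<Longrightarrow> b < deg \<mu> \<Longrightarrow> M (emb m \<rho> \<kappa> a) (emb m \<rho> \<mu> b) = (if \<kappa> = \<mu> \<and> a = b then c else 0)"
  shows "(\<Sum>z<deg \<rho>. M (emb m \<rho> \<kappa> a) z * F z) = c * (F (emb m \<rho> \<kappa> a) :: complex)"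
proof -
  have d: "(if P then c else 0) * y = (if P then c * y else 0)" "y * (if P then c else 0) = (if P then y * c else 0)" for P y
    by auto
  have "(\<Sum>z<deg \<rho>. M (emb m \<rho> \<kappa> a) z * F z)
      = (\<Sum>\<mu>\<in>ch m \<rho>. if \<kappa> = \<mu> then (\<Sum>b<deg \<kappa>. if a = b then c * F (emb m \<rho> \<kappa> a) else 0) else 0)"
    unfolding sum_blocks[OF assms(1)] by (intro sum.cong refl) (auto simp: M d assms(3))
  then show ?thesis using assms finite_ch[OF assms(1)] by simp
qed

lemma scalar_col:
  assumes "\<rho> \<in> R (Suc m)" "\<kappa> \<in> ch m \<rho>" "a < deg \<kappa>"
    and M: "\<And>\<mu> b. \<mu> \<in> ch m \<rho> \<Longrightarrow> b < deg \<mu> \<Longrightarrow> M (emb m \<rho> \<mu> b) (emb m \<rho> \<kappa> a) = (if \<mu> = \<kappa> \<and> b = a then c else 0)"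
  shows "(\<Sum>z<deg \<rho>. F z * M z (emb m \<rho> \<kappa> a)) = (F (emb m \<rho> \<kappa> a) :: complex) * c"
proof -
  have d: "(if P then c else 0) * y = (if P then c * y else 0)" "y * (if P then c else 0) = (if P then y * c else 0)" for P y
    by auto
  have "(\<Sum>z<deg \<rho>. F z * M z (emb m \<rho> \<kappa> a))
      = (\<Sum>\<mu>\<in>ch m \<rho>. if \<mu> = \<kappa> then (\<Sum>b<deg \<kappa>. if b = a then F (emb m \<rho> \<kappa> a) * c else 0) else 0)"
    unfolding sum_blocks[OF assms(1)] by (intro sum.cong refl) (auto simp: M d assms(3))
  then show ?thesis using assms finite_ch[OF assms(1)] by simp
qed

lemma flip_row:
  assumes "\<rho> \<in> R (Suc m)" "\<kappa> \<in> ch m \<rho>" "a < deg \<kappa>"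
  shows "(\<Sum>z<deg \<rho>. \<rho> (last_flip (Suc m)) $$ (emb m \<rho> \<kappa> a, z) * F z) = flip_eig m \<kappa> \<rho> * F (emb m \<rho> \<kappa> a)"
  by (rule scalar_row[OF assms, of "\<lambda>x y. \<rho> (last_flip (Suc m)) $$ (x, y)"])
    (use flip_entry[OF assms(1) _ _ assms(2,3)] in auto)

lemma flip_col:
  assumes "\<rho> \<in> R (Suc m)" "\<kappa> \<in> ch m \<rho>" "a < deg \<kappa>"
  shows "(\<Sum>z<deg \<rho>. F z * \<rho> (last_flip (Suc m)) $$ (z, emb m \<rho> \<kappa> a)) = F (emb m \<rho> \<kappa> a) * flip_eig m \<kappa> \<rho>"
  by (rule scalar_col[OF assms, of "\<lambda>x y. \<rho> (last_flip (Suc m)) $$ (x, y)"])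
    (use flip_entry[OF assms] in auto)

lemma flip_eig_square:
  assumes \<rho>: "\<rho> \<in> R (Suc m)" and \<kappa>: "\<kappa> \<in> ch m \<rho>"
  shows "flip_eig m \<kappa> \<rho> * flip_eig m \<kappa> \<rho> = 1"
proof -
  have p: "0 < deg \<kappa>" by (rule deg_pos[OF ch_in_R[OF \<rho> \<kappa>]])
  let ?e = "emb m \<rho> \<kappa> 0"
  have e: "?e < deg \<rho>" by (rule emb_lt[OF \<rho> \<kappa> p])
  have t: "last_flip (Suc m) \<in> carrier (B (Suc m))" by (rule last_flip_in_B) auto
  have "1 = \<rho> (last_flip (Suc m) \<circ> last_flip (Suc m)) $$ (?e, ?e)"
    using R_id_entry[OF \<rho> e e] by (simp add: sign_flip_involution)
  also have "\<dots> = (\<Sum>z<deg \<rho>. \<rho> (last_flip (Suc m)) $$ (?e, z) * \<rho> (last_flip (Suc m)) $$ (z, ?e))"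
    by (rule comp_entry[OF \<rho> t t e e])
  also have "\<dots> = flip_eig m \<kappa> \<rho> * flip_eig m \<kappa> \<rho>"
    unfolding flip_row[OF \<rho> \<kappa> p] by (simp add: flip_eig_def)
  finally show ?thesis ..
qed

text \<open>One matrix entry of the relation \<open>adjacent_swap_last_flip\<close>; on either side
  the sign change acts by a scalar.\<close>

lemma swap_flip:
  assumes \<rho>: "\<rho> \<in> R (Suc (Suc m))" and \<kappa>: "\<kappa> \<in> ch (Suc m) \<rho>" "\<theta> \<in> ch m \<kappa>"
    and \<mu>: "\<mu> \<in> ch (Suc m) \<rho>" "\<theta> \<in> ch m \<mu>"
  shows "swap_coeff m \<rho> \<mu> \<kappa> \<theta> * flip_eig m \<theta> \<kappa> = flip_eig (Suc m) \<mu> \<rho> * swap_coeff m \<rho> \<mu> \<kappa> \<theta>"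
proof -
  note kR = ch_in_R[OF \<rho> \<kappa>(1)] and mR = ch_in_R[OF \<rho> \<mu>(1)]
  have p: "0 < deg \<theta>" by (rule deg_pos[OF ch_in_R[OF kR \<kappa>(2)]])
  let ?P = "emb (Suc m) \<rho> \<mu> (emb m \<mu> \<theta> 0)" and ?Q = "emb (Suc m) \<rho> \<kappa> (emb m \<kappa> \<theta> 0)"
  let ?s = "adjacent_swap (Suc m)"
  note ek = emb_lt[OF kR \<kappa>(2) p] and em = emb_lt[OF mR \<mu>(2) p]
  have PQ: "?P < deg \<rho>" "?Q < deg \<rho>" using emb_lt[OF \<rho> \<kappa>(1) ek] emb_lt[OF \<rho> \<mu>(1) em] by auto
  have el: "?s \<in> carrier (B (Suc (Suc m)))" "last_flip (Suc m) \<in> carrier (B (Suc m))"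
    "last_flip (Suc m) \<in> carrier (B (Suc (Suc m)))" "last_flip (Suc (Suc m)) \<in> carrier (B (Suc (Suc m)))"
    by (auto intro!: adjacent_swap_in_B last_flip_in_B)
  have "\<rho> (?s \<circ> last_flip (Suc m)) $$ (?P, ?Q) = (\<Sum>z<deg \<rho>. \<rho> ?s $$ (?P, z) * \<rho> (last_flip (Suc m)) $$ (z, ?Q))"
    by (rule comp_entry[OF \<rho> el(1,3) PQ])
  also have "\<dots> = (\<Sum>b<deg \<kappa>. \<rho> ?s $$ (?P, emb (Suc m) \<rho> \<kappa> b) * \<kappa> (last_flip (Suc m)) $$ (b, emb m \<kappa> \<theta> 0))"
    by (rule embeddedD(3)[OF embedded_emb[OF \<rho> \<kappa>(1)] el(2) ek])
  also have "\<dots> = swap_coeff m \<rho> \<mu> \<kappa> \<theta> * flip_eig m \<theta> \<kappa>"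
    unfolding flip_col[OF kR \<kappa>(2) p] swap_coeff_def ..
  finally have 1: "\<rho> (?s \<circ> last_flip (Suc m)) $$ (?P, ?Q) = swap_coeff m \<rho> \<mu> \<kappa> \<theta> * flip_eig m \<theta> \<kappa>" .
  have "\<rho> (last_flip (Suc (Suc m)) \<circ> ?s) $$ (?P, ?Q) = (\<Sum>z<deg \<rho>. \<rho> (last_flip (Suc (Suc m))) $$ (?P, z) * \<rho> ?s $$ (z, ?Q))"
    by (rule comp_entry[OF \<rho> el(4,1) PQ])
  also have "\<dots> = flip_eig (Suc m) \<mu> \<rho> * swap_coeff m \<rho> \<mu> \<kappa> \<theta>"
    unfolding flip_row[OF \<rho> \<mu>(1) em] swap_coeff_def ..
  finally show ?thesis using 1 adjacent_swap_last_flip[of m] by metis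
qed

text \<open>One matrix entry of the relation X' s = s X + 1 + t t', with X, X' consecutive
  Jucys-Murphy sums and t, t' consecutive sign changes. The term 1 comes from the reflection that is
  s itself, the term t t' from the letter -(m + 1) by \<open>negative_swap\<close>; all other
  reflections are conjugated by s.\<close>

lemma swap_jm:
  assumes \<rho>: "\<rho> \<in> R (Suc (Suc m))" and \<kappa>: "\<kappa> \<in> ch (Suc m) \<rho>" "\<theta> \<in> ch m \<kappa>"
    and \<mu>: "\<mu> \<in> ch (Suc m) \<rho>" "\<theta> \<in> ch m \<mu>"
  shows "jm_eig (Suc m) \<mu> \<rho> * swap_coeff m \<rho> \<mu> \<kappa> \<theta> = swap_coeff m \<rho> \<mu> \<kappa> \<theta> * jm_eig m \<theta> \<kappa>
    + (if \<mu> = \<kappa> then 1 + flip_eig m \<theta> \<kappa> * flip_eig (Suc m) \<kappa> \<rho> else 0)"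
proof -
  note kR = ch_in_R[OF \<rho> \<kappa>(1)] and mR = ch_in_R[OF \<rho> \<mu>(1)]
  have p: "0 < deg \<theta>" by (rule deg_pos[OF ch_in_R[OF kR \<kappa>(2)]])
  let ?P = "emb (Suc m) \<rho> \<mu> (emb m \<mu> \<theta> 0)" and ?Q = "emb (Suc m) \<rho> \<kappa> (emb m \<kappa> \<theta> 0)"
  let ?s = "adjacent_swap (Suc m)" and ?r = "\<lambda>i. signed_swap i (int (Suc (Suc m)))" and ?r' = "\<lambda>i. signed_swap i (int (Suc m))"
  note ek = emb_lt[OF kR \<kappa>(2) p] and em = emb_lt[OF mR \<mu>(2) p]
  have PQ: "?P < deg \<rho>" "?Q < deg \<rho>" using emb_lt[OF \<rho> \<kappa>(1) ek] emb_lt[OF \<rho> \<mu>(1) em] by auto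
  have el: "?s \<in> carrier (B (Suc (Suc m)))" "last_flip (Suc m) \<in> carrier (B (Suc m))"
    "last_flip (Suc m) \<in> carrier (B (Suc (Suc m)))" "last_flip (Suc (Suc m)) \<in> carrier (B (Suc (Suc m)))"
    by (auto intro!: adjacent_swap_in_B last_flip_in_B)
  have r: "?r i \<in> carrier (B (Suc (Suc m)))" if "i \<in> letters (Suc m)" for i
    using that by (intro signed_swap_in_B) (auto simp: letters_def)
  have r': "?r' i \<in> carrier (B (Suc m))" "?r' i \<in> carrier (B (Suc (Suc m)))" if "i \<in> letters m" for i
    using that by (auto intro!: signed_swap_in_B simp: letters_def)
  have "(\<Sum>i\<in>letters (Suc m). \<rho> (?r i \<circ> ?s) $$ (?P, ?Q))
      = (\<Sum>i\<in>letters (Suc m). \<Sum>z<deg \<rho>. \<rho> (?r i) $$ (?P, z) * \<rho> ?s $$ (z, ?Q))"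
    by (intro sum.cong refl comp_entry[OF \<rho> r el(1) PQ])
  also have "\<dots> = (\<Sum>z<deg \<rho>. jm (Suc m) \<rho> ?P z * \<rho> ?s $$ (z, ?Q))"
    unfolding jm_def sum_distrib_right by (rule sum.swap)
  also have "\<dots> = jm_eig (Suc m) \<mu> \<rho> * swap_coeff m \<rho> \<mu> \<kappa> \<theta>"
    unfolding swap_coeff_def
    by (rule scalar_row[OF \<rho> \<mu>(1) em]) (use jm_entry[OF \<rho> _ _ \<mu>(1) em] in auto)
  finally have 1: "(\<Sum>i\<in>letters (Suc m). \<rho> (?r i \<circ> ?s) $$ (?P, ?Q)) = jm_eig (Suc m) \<mu> \<rho> * swap_coeff m \<rho> \<mu> \<kappa> \<theta>" .
  have "int (Suc m) \<notin> insert (- int (Suc m)) (letters m)" "- int (Suc m) \<notin> letters m"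
    by (auto simp: letters_def)
  then have 2: "(\<Sum>i\<in>letters (Suc m). \<rho> (?r i \<circ> ?s) $$ (?P, ?Q)) = \<rho> (?s \<circ> ?s) $$ (?P, ?Q)
     + (\<rho> (?r (- int (Suc m)) \<circ> ?s) $$ (?P, ?Q) + (\<Sum>i\<in>letters m. \<rho> (?r i \<circ> ?s) $$ (?P, ?Q)))"
    unfolding letters_Suc by simp
  have 3: "\<rho> (?s \<circ> ?s) $$ (?P, ?Q) = (if \<mu> = \<kappa> then 1 else 0)"
    using R_id_entry[OF \<rho> PQ] emb_eq_iff[OF \<rho> \<mu>(1) em \<kappa>(1) ek] by (auto simp: adjacent_swap_involution)
  have "\<rho> (?r (- int (Suc m)) \<circ> ?s) $$ (?P, ?Q) = (\<Sum>z<deg \<rho>. \<rho> (last_flip (Suc m)) $$ (?P, z) * \<rho> (last_flip (Suc (Suc m))) $$ (z, ?Q))"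
    unfolding negative_swap by (rule comp_entry[OF \<rho> el(3,4) PQ])
  also have "\<dots> = \<rho> (last_flip (Suc m)) $$ (?P, ?Q) * flip_eig (Suc m) \<kappa> \<rho>"
    by (rule flip_col[OF \<rho> \<kappa>(1) ek])
  also have "\<rho> (last_flip (Suc m)) $$ (?P, ?Q) = (if \<mu> = \<kappa> then flip_eig m \<theta> \<kappa> else 0)"
    using emb_block[OF \<rho> el(2) \<mu>(1) \<kappa>(1) em ek] by (auto simp: flip_eig_def)
  finally have 4: "\<rho> (?r (- int (Suc m)) \<circ> ?s) $$ (?P, ?Q) = (if \<mu> = \<kappa> then flip_eig m \<theta> \<kappa> * flip_eig (Suc m) \<kappa> \<rho> else 0)"
    by auto
  have "(\<Sum>i\<in>letters m. \<rho> (?r i \<circ> ?s) $$ (?P, ?Q)) = (\<Sum>i\<in>letters m. \<rho> (?s \<circ> ?r' i) $$ (?P, ?Q))"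
    by (intro sum.cong refl) (simp add: adjacent_swap_conjugate)
  also have "\<dots> = (\<Sum>i\<in>letters m. \<Sum>z<deg \<rho>. \<rho> ?s $$ (?P, z) * \<rho> (?r' i) $$ (z, ?Q))"
    by (intro sum.cong refl comp_entry[OF \<rho> el(1) r'(2) PQ])
  also have "\<dots> = (\<Sum>i\<in>letters m. \<Sum>b<deg \<kappa>. \<rho> ?s $$ (?P, emb (Suc m) \<rho> \<kappa> b) * \<kappa> (?r' i) $$ (b, emb m \<kappa> \<theta> 0))"
    by (intro sum.cong refl embeddedD(3)[OF embedded_emb[OF \<rho> \<kappa>(1)] r'(1) ek])
  also have "\<dots> = (\<Sum>b<deg \<kappa>. \<rho> ?s $$ (?P, emb (Suc m) \<rho> \<kappa> b) * jm m \<kappa> b (emb m \<kappa> \<theta> 0))"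
    unfolding jm_def sum_distrib_left by (rule sum.swap)
  also have "\<dots> = swap_coeff m \<rho> \<mu> \<kappa> \<theta> * jm_eig m \<theta> \<kappa>"
    unfolding swap_coeff_def by (rule scalar_col[OF kR \<kappa>(2) p]) (use jm_entry[OF kR \<kappa>(2) p] in auto)
  finally show ?thesis using 1 2 3 4 by (auto simp: algebra_simps)
qed

section \<open>Linear independence among the parents of a representation\<close>

lemma column_independent:
  assumes sub: "\<Lambda> \<subseteq> R n" and j: "\<And>\<rho>. \<rho> \<in> \<Lambda> \<Longrightarrow> j \<rho> < deg \<rho>"
    and zero: "\<And>g. g \<in> carrier (B n) \<Longrightarrow> (\<Sum>\<rho>\<in>\<Lambda>. \<Sum>i<deg \<rho>. a \<rho> i * \<rho> g $$ (i, j \<rho>)) = 0"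
    and \<rho>: "\<rho> \<in> \<Lambda>" "i < deg \<rho>"
  shows "a \<rho> i = 0"
proof -
  have "(if j \<rho> = j \<rho> then a \<rho> i else 0) = 0"
  proof (rule finite_group_irreps.matrix_coefficients_independent[OF irreps finite_subset[OF sub finite_R] sub,
      where a = "\<lambda>\<rho> i l. if l = j \<rho> then a \<rho> i else 0" and k = i and l = "j \<rho>" and \<sigma> = \<rho>])
    fix g assume g: "g \<in> carrier (B n)"
    have "(\<Sum>\<rho>\<in>\<Lambda>. \<Sum>i<rep_degree (B n) \<rho>. \<Sum>l<rep_degree (B n) \<rho>. (if l = j \<rho> then a \<rho> i else 0) * \<rho> g $$ (i, l))
        = (\<Sum>\<rho>\<in>\<Lambda>. \<Sum>i<deg \<rho>. \<Sum>l<deg \<rho>. if l = j \<rho> then a \<rho> i * \<rho> g $$ (i, l) else 0)"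
      by (intro sum.cong) auto
    also have "\<dots> = (\<Sum>\<rho>\<in>\<Lambda>. \<Sum>i<deg \<rho>. a \<rho> i * \<rho> g $$ (i, j \<rho>))"
      by (intro sum.cong refl) (simp add: j)
    finally show "(\<Sum>\<rho>\<in>\<Lambda>. \<Sum>i<rep_degree (B n) \<rho>. \<Sum>l<rep_degree (B n) \<rho>. (if l = j \<rho> then a \<rho> i else 0) * \<rho> g $$ (i, l)) = 0"
      using zero[OF g] by simp
  qed (use \<rho> j in auto)
  then show ?thesis by simp
qed

definition parents :: "nat \<Rightarrow> B_rep \<Rightarrow> B_rep set" where
  "parents m \<kappa> = {\<rho> \<in> R (Suc m). \<kappa> \<in> ch m \<rho>}"

lemma finite_parents: "finite (parents m \<kappa>)"
  using finite_subset[OF _ finite_R[of "Suc m"]] by (auto simp: parents_def)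

text \<open>The matrices of \<open>1\<close>, \<open>last_flip\<close> and \<open>adjacent_swap\<close> determine a representation restricted to a block,
  because these elements represent the double cosets of \<open>B m\<close> in \<open>B (Suc m)\<close>.\<close>

lemma parents_independent:
  assumes \<kappa>: "\<kappa> \<in> R m" and \<mu>: "\<mu> \<in> R m" and sub: "\<Lambda> \<subseteq> parents m \<kappa> \<inter> parents m \<mu>"
    and s: "\<And>a b. m > 0 \<Longrightarrow> b < deg \<mu> \<Longrightarrow> a < deg \<kappa> \<Longrightarrow>
      (\<Sum>\<rho>\<in>\<Lambda>. x \<rho> * \<rho> (adjacent_swap m) $$ (emb m \<rho> \<mu> b, emb m \<rho> \<kappa> a)) = 0"
    and one: "\<kappa> = \<mu> \<Longrightarrow> (\<Sum>\<rho>\<in>\<Lambda>. x \<rho>) = 0"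
    and flip: "\<kappa> = \<mu> \<Longrightarrow> (\<Sum>\<rho>\<in>\<Lambda>. x \<rho> * flip_eig m \<kappa> \<rho>) = 0"
    and \<rho>0: "\<rho>0 \<in> \<Lambda>"
  shows "x \<rho>0 = 0"
proof -
  have L: "\<rho> \<in> R (Suc m)" "\<kappa> \<in> ch m \<rho>" "\<mu> \<in> ch m \<rho>" if "\<rho> \<in> \<Lambda>" for \<rho>
    using sub that by (auto simp: parents_def)
  have p: "0 < deg \<kappa>" "0 < deg \<mu>" using deg_pos \<kappa> \<mu> by auto
  have hb: "(\<Sum>\<rho>\<in>\<Lambda>. x \<rho> * \<rho> h $$ (emb m \<rho> \<mu> b, emb m \<rho> \<kappa> a)) = 0"
    "(\<Sum>\<rho>\<in>\<Lambda>. x \<rho> * \<rho> (last_flip (Suc m) \<circ> h) $$ (emb m \<rho> \<mu> b, emb m \<rho> \<kappa> a)) = 0"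
    if h: "h \<in> carrier (B m)" and ab: "b < deg \<mu>" "a < deg \<kappa>" for h a b
  proof -
    have h': "h \<in> carrier (B (Suc m))" using h carrier_B_mono[of m "Suc m"] by auto
    have t: "last_flip (Suc m) \<in> carrier (B (Suc m))" by (rule last_flip_in_B) auto
    have e: "\<rho> h $$ (emb m \<rho> \<mu> b, emb m \<rho> \<kappa> a) = (if \<mu> = \<kappa> then \<kappa> h $$ (b, a) else 0)" if "\<rho> \<in> \<Lambda>" for \<rho>
      using emb_block[OF L(1)[OF that] h L(3)[OF that] L(2)[OF that] ab] by auto
    have "(\<Sum>\<rho>\<in>\<Lambda>. x \<rho> * \<rho> h $$ (emb m \<rho> \<mu> b, emb m \<rho> \<kappa> a)) = (\<Sum>\<rho>\<in>\<Lambda>. x \<rho>) * (if \<mu> = \<kappa> then \<kappa> h $$ (b, a) else 0)"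
      unfolding sum_distrib_right by (intro sum.cong refl) (simp add: e)
    then show "(\<Sum>\<rho>\<in>\<Lambda>. x \<rho> * \<rho> h $$ (emb m \<rho> \<mu> b, emb m \<rho> \<kappa> a)) = 0" using one by auto
    have "\<rho> (last_flip (Suc m) \<circ> h) $$ (emb m \<rho> \<mu> b, emb m \<rho> \<kappa> a)
        = flip_eig m \<mu> \<rho> * (if \<mu> = \<kappa> then \<kappa> h $$ (b, a) else 0)" if r: "\<rho> \<in> \<Lambda>" for \<rho>
      using comp_entry[OF L(1)[OF r] t h' emb_lt[OF L(1)[OF r] L(3)[OF r] ab(1)] emb_lt[OF L(1)[OF r] L(2)[OF r] ab(2)]]
        flip_row[OF L(1)[OF r] L(3)[OF r] ab(1)] e[OF r] by simp
    then have "(\<Sum>\<rho>\<in>\<Lambda>. x \<rho> * \<rho> (last_flip (Suc m) \<circ> h) $$ (emb m \<rho> \<mu> b, emb m \<rho> \<kappa> a))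
       = (\<Sum>\<rho>\<in>\<Lambda>. x \<rho> * flip_eig m \<mu> \<rho>) * (if \<mu> = \<kappa> then \<kappa> h $$ (b, a) else 0)"
      unfolding sum_distrib_right by (intro sum.cong refl) (simp add: mult.assoc)
    then show "(\<Sum>\<rho>\<in>\<Lambda>. x \<rho> * \<rho> (last_flip (Suc m) \<circ> h) $$ (emb m \<rho> \<mu> b, emb m \<rho> \<kappa> a)) = 0" using flip by auto
  qed
  have zero: "(\<Sum>\<rho>\<in>\<Lambda>. x \<rho> * \<rho> w $$ (emb m \<rho> \<mu> 0, emb m \<rho> \<kappa> 0)) = 0" if w: "w \<in> carrier (B (Suc m))" for w
  proof -
    have "w \<in> (\<lambda>(j, h). coset_rep (Suc m) j \<circ> h) ` (letters (Suc m) \<times> carrier (B m))"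
      using bij_betw_imp_surj_on[OF coset_decomposition[of m]] w by simp
    then obtain j h where j: "j \<in> letters (Suc m)" and h: "h \<in> carrier (B m)" and wjh: "w = coset_rep (Suc m) j \<circ> h"
      by auto
    show ?thesis
    proof (cases "j = int (Suc m) \<or> j = - int (Suc m)")
      case True
      then show ?thesis using hb[OF h p(2,1)] by (auto simp: wjh)
    next
      case False
      then have jm: "j \<in> letters m" using j by (auto simp: letters_Suc)
      then have m: "m > 0" by (auto simp: letters_def)
      define c where "c = coset_rep m j"
      have c: "c \<in> carrier (B m)" "c \<in> carrier (B (Suc m))"
        unfolding c_def using coset_rep(1)[OF jm] carrier_B_mono[of m "Suc m"] by auto
      have h': "h \<in> carrier (B (Suc m))" using h carrier_B_mono[of m "Suc m"] by auto
      have sB: "adjacent_swap m \<in> carrier (B (Suc m))" using m by (intro adjacent_swap_in_B) auto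
      \<comment> \<open>On this double coset w = c s h with c and h in \<open>B m\<close>. The outer
        factors act within \<open>\<mu>\<close> and \<open>\<kappa>\<close>, so the entry is a
        combination of entries of the swap between the two blocks, with coefficients independent of
        \<open>\<rho>\<close>.\<close>
      have wc: "w = c \<circ> (adjacent_swap m \<circ> h)" using False by (simp add: wjh c_def comp_assoc)
      have sh: "adjacent_swap m \<circ> h \<in> carrier (B (Suc m))" by (rule B_comp[OF sB h'])
      have "\<rho> w $$ (emb m \<rho> \<mu> 0, emb m \<rho> \<kappa> 0)
         = (\<Sum>b<deg \<mu>. \<Sum>a<deg \<kappa>. \<mu> c $$ (0, b) * (\<rho> (adjacent_swap m) $$ (emb m \<rho> \<mu> b, emb m \<rho> \<kappa> a) * \<kappa> h $$ (a, 0)))"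
        if r: "\<rho> \<in> \<Lambda>" for \<rho>
      proof -
        note L' = L[OF r]
        have "\<rho> w $$ (emb m \<rho> \<mu> 0, emb m \<rho> \<kappa> 0)
           = (\<Sum>z<deg \<rho>. \<rho> c $$ (emb m \<rho> \<mu> 0, z) * \<rho> (adjacent_swap m \<circ> h) $$ (z, emb m \<rho> \<kappa> 0))"
          unfolding wc by (rule comp_entry[OF L'(1) c(2) sh emb_lt[OF L'(1,3) p(2)] emb_lt[OF L'(1,2) p(1)]])
        also have "\<dots> = (\<Sum>b<deg \<mu>. \<mu> c $$ (0, b) * \<rho> (adjacent_swap m \<circ> h) $$ (emb m \<rho> \<mu> b, emb m \<rho> \<kappa> 0))"
          by (rule embeddedD(2)[OF embedded_emb[OF L'(1,3)] c(1) p(2)])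
        also have "\<dots> = (\<Sum>b<deg \<mu>. \<mu> c $$ (0, b) * (\<Sum>a<deg \<kappa>. \<rho> (adjacent_swap m) $$ (emb m \<rho> \<mu> b, emb m \<rho> \<kappa> a) * \<kappa> h $$ (a, 0)))"
        proof (intro sum.cong refl)
          fix b assume b: "b \<in> {..<deg \<mu>}"
          have "\<rho> (adjacent_swap m \<circ> h) $$ (emb m \<rho> \<mu> b, emb m \<rho> \<kappa> 0)
             = (\<Sum>z<deg \<rho>. \<rho> (adjacent_swap m) $$ (emb m \<rho> \<mu> b, z) * \<rho> h $$ (z, emb m \<rho> \<kappa> 0))"
            by (rule comp_entry[OF L'(1) sB h' emb_lt[OF L'(1,3)] emb_lt[OF L'(1,2) p(1)]]) (use b in auto)
          also have "\<dots> = (\<Sum>a<deg \<kappa>. \<rho> (adjacent_swap m) $$ (emb m \<rho> \<mu> b, emb m \<rho> \<kappa> a) * \<kappa> h $$ (a, 0))"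
            by (rule embeddedD(3)[OF embedded_emb[OF L'(1,2)] h p(1)])
          finally show "\<mu> c $$ (0, b) * \<rho> (adjacent_swap m \<circ> h) $$ (emb m \<rho> \<mu> b, emb m \<rho> \<kappa> 0)
            = \<mu> c $$ (0, b) * (\<Sum>a<deg \<kappa>. \<rho> (adjacent_swap m) $$ (emb m \<rho> \<mu> b, emb m \<rho> \<kappa> a) * \<kappa> h $$ (a, 0))" by simp
        qed
        finally show ?thesis by (simp add: sum_distrib_left)
      qed
      then have "(\<Sum>\<rho>\<in>\<Lambda>. x \<rho> * \<rho> w $$ (emb m \<rho> \<mu> 0, emb m \<rho> \<kappa> 0))
         = (\<Sum>\<rho>\<in>\<Lambda>. \<Sum>b<deg \<mu>. \<Sum>a<deg \<kappa>. x \<rho> * (\<mu> c $$ (0, b) * (\<rho> (adjacent_swap m) $$ (emb m \<rho> \<mu> b, emb m \<rho> \<kappa> a) * \<kappa> h $$ (a, 0))))"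
        by (intro sum.cong refl) (simp add: sum_distrib_left)
      also have "\<dots> = (\<Sum>b<deg \<mu>. \<Sum>\<rho>\<in>\<Lambda>. \<Sum>a<deg \<kappa>. x \<rho> * (\<mu> c $$ (0, b) * (\<rho> (adjacent_swap m) $$ (emb m \<rho> \<mu> b, emb m \<rho> \<kappa> a) * \<kappa> h $$ (a, 0))))"
        by (rule sum.swap)
      also have "\<dots> = (\<Sum>b<deg \<mu>. \<Sum>a<deg \<kappa>. \<Sum>\<rho>\<in>\<Lambda>. x \<rho> * (\<mu> c $$ (0, b) * (\<rho> (adjacent_swap m) $$ (emb m \<rho> \<mu> b, emb m \<rho> \<kappa> a) * \<kappa> h $$ (a, 0))))"
        by (intro sum.cong[OF refl] sum.swap)
      also have "\<dots> = (\<Sum>b<deg \<mu>. \<Sum>a<deg \<kappa>. (\<mu> c $$ (0, b) * \<kappa> h $$ (a, 0)) *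
          (\<Sum>\<rho>\<in>\<Lambda>. x \<rho> * \<rho> (adjacent_swap m) $$ (emb m \<rho> \<mu> b, emb m \<rho> \<kappa> a)))"
        by (simp add: sum_distrib_left mult_ac)
      also have "\<dots> = 0" by (intro sum.neutral ballI) (simp add: s[OF m])
      finally show ?thesis .
    qed
  qed
  \<comment> \<open>The vacuous \<open>if\<close> matches the coefficient function given to
    \<open>column_independent\<close>, which is supported on a single row; so one matrix entry from
    each \<open>\<rho>\<close> is tested.\<close>
  have "(if emb m \<rho>0 \<mu> 0 = emb m \<rho>0 \<mu> 0 then x \<rho>0 else 0) = 0"
  proof (rule column_independent[where n = "Suc m" and \<Lambda> = \<Lambda> and j = "\<lambda>\<rho>. emb m \<rho> \<kappa> 0"
      and a = "\<lambda>\<rho> i. if i = emb m \<rho> \<mu> 0 then x \<rho> else 0" and i = "emb m \<rho>0 \<mu> 0"])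
    fix w assume w: "w \<in> carrier (B (Suc m))"
    have "(\<Sum>\<rho>\<in>\<Lambda>. \<Sum>i<deg \<rho>. (if i = emb m \<rho> \<mu> 0 then x \<rho> else 0) * \<rho> w $$ (i, emb m \<rho> \<kappa> 0))
      = (\<Sum>\<rho>\<in>\<Lambda>. \<Sum>i<deg \<rho>. if i = emb m \<rho> \<mu> 0 then x \<rho> * \<rho> w $$ (i, emb m \<rho> \<kappa> 0) else 0)"
      by (intro sum.cong refl) auto
    also have "\<dots> = (\<Sum>\<rho>\<in>\<Lambda>. x \<rho> * \<rho> w $$ (emb m \<rho> \<mu> 0, emb m \<rho> \<kappa> 0))"
      by (intro sum.cong refl) (use emb_lt[OF L(1,3) p(2)] in simp)
    finally show "(\<Sum>\<rho>\<in>\<Lambda>. \<Sum>i<deg \<rho>. (if i = emb m \<rho> \<mu> 0 then x \<rho> else 0) * \<rho> w $$ (i, emb m \<rho> \<kappa> 0)) = 0"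
      using zero[OF w] by simp
  qed (use L emb_lt p \<rho>0 in auto)
  then show ?thesis by simp
qed

end

section \<open>Contents and the number of children\<close>

lemma carrier_B_0: "carrier (B 0) = {id}"
  using id_in_B[of 0] by (auto simp: carrier_B_iff)

text \<open>In terms of Young diagrams, \<open>(\<tau>, 2 \<delta> y)\<close> stands for a box of content \<open>\<delta> y\<close> in the diagram selected by
  \<open>\<tau>\<close>. Only the numbers of boxes on the diagonals are recorded: in a \<open>well_stacked\<close> multiset they decrease away
  from the main diagonal, and a box is \<open>addable\<close> if it is on the main diagonal or extends a diagonal shorter than
  its inner neighbour.\<close>

definition signed_content :: "complex \<Rightarrow> complex \<Rightarrow> nat \<Rightarrow> complex \<times> complex" where
  "signed_content \<tau> \<delta> y = (\<tau>, 2 * \<delta> * of_nat y)"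

lemma signed_content_eq_iff:
  assumes "\<delta> \<in> {1, - 1}" "\<delta>' \<in> {1, - 1}"
  shows "signed_content \<tau> \<delta> y = signed_content \<tau>' \<delta>' y' \<longleftrightarrow> \<tau> = \<tau>' \<and> y = y' \<and> (y = 0 \<or> \<delta> = \<delta>')"
proof -
  have "(of_nat y :: complex) = - of_nat y' \<longleftrightarrow> of_nat (y + y') = (0 :: complex)"
    by (simp add: eq_neg_iff_add_eq_0)
  then have a: "(of_nat y :: complex) = - of_nat y' \<longleftrightarrow> y = 0 \<and> y' = 0"
    by (simp only: of_nat_eq_0_iff) simp
  then have "- (of_nat y :: complex) = of_nat y' \<longleftrightarrow> y = 0 \<and> y' = 0"
    by (metis minus_equation_iff)
  then show ?thesis using assms a by (auto simp: signed_content_def)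
qed

definition well_stacked :: "(complex \<times> complex) multiset \<Rightarrow> bool" where
  "well_stacked A \<longleftrightarrow> (\<forall>\<tau>. \<forall>\<delta>\<in>{1, - 1}. \<forall>y.
     count A (signed_content \<tau> \<delta> (Suc y)) \<le> count A (signed_content \<tau> \<delta> y))"

definition addable :: "(complex \<times> complex) multiset \<Rightarrow> complex \<times> complex \<Rightarrow> bool" where
  "addable A z \<longleftrightarrow> (\<exists>\<tau>. \<exists>\<delta>\<in>{1, - 1}. \<exists>y. z = signed_content \<tau> \<delta> y \<and>
     (\<forall>y'. y = Suc y' \<longrightarrow> count A z < count A (signed_content \<tau> \<delta> y')))"

lemma addable_add_mset: "addable A z \<Longrightarrow> w \<noteq> z \<Longrightarrow> addable (add_mset w A) z"
  unfolding addable_def by fastforce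

text \<open>Only the comparison of the enlarged diagonal with its inner neighbour can fail, and
  there \<open>addable\<close> provides a strict inequality beforehand.\<close>

lemma well_stacked_add_mset:
  assumes A: "well_stacked A" and z: "addable A z"
  shows "well_stacked (add_mset z A)"
  unfolding well_stacked_def
proof (intro allI ballI)
  fix \<tau> \<delta> :: complex and y assume d: "\<delta> \<in> {1, - 1}"
  obtain \<tau>' \<delta>' y' where d': "\<delta>' \<in> {1, - 1}" and ze: "z = signed_content \<tau>' \<delta>' y'"
    and less: "\<And>y''. y' = Suc y'' \<Longrightarrow> count A z < count A (signed_content \<tau>' \<delta>' y'')"
    using z by (auto simp: addable_def)
  have le: "count A (signed_content \<tau> \<delta> (Suc y)) \<le> count A (signed_content \<tau> \<delta> y)"
    using A d by (auto simp: well_stacked_def)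
  show "count (add_mset z A) (signed_content \<tau> \<delta> (Suc y)) \<le> count (add_mset z A) (signed_content \<tau> \<delta> y)"
  proof (cases "signed_content \<tau> \<delta> (Suc y) = z")
    case True
    then have eq: "\<tau>' = \<tau>" "\<delta>' = \<delta>" "y' = Suc y" unfolding ze by (auto simp: signed_content_eq_iff[OF d d'])
    have "signed_content \<tau> \<delta> y \<noteq> z" unfolding ze eq by (simp add: signed_content_eq_iff[OF d d])
    then show ?thesis using less[OF eq(3)] True eq by auto
  next
    case False
    then show ?thesis using le by auto
  qed
qed

context tower begin

section \<open>Counting common children and parents\<close>

lemma R_0_unique:
  assumes "\<kappa> \<in> R 0" "\<mu> \<in> R 0"
  shows "\<kappa> = \<mu>"
proof (rule ccontr)
  assume ne: "\<kappa> \<noteq> \<mu>"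
  have "(\<Sum>\<rho>\<in>{\<kappa>, \<mu>}. (rep_degree (B 0) \<rho>)\<^sup>2) \<le> card (carrier (B 0))"
    by (rule finite_group_irreps.sum_degree_squares_le[OF irreps]) (use assms in auto)
  then have "(deg \<kappa>)\<^sup>2 + (deg \<mu>)\<^sup>2 \<le> 1" using ne by (simp add: carrier_B_0)
  then show False using deg_pos[OF assms(1)] deg_pos[OF assms(2)]
    by (metis One_nat_def add_le_same_cancel2 le_antisym le_add2 le_trans not_one_le_zero one_le_power Suc_leI le_zero_eq add_leE)
qed

text \<open>By \<open>swap_entry\<close> the block of the swap between \<open>\<kappa>\<close> and
  \<open>\<mu>\<close> is determined by one scalar for each common child, so the condition on all
  its entries becomes one condition per common child.\<close>

lemma swap_coeff_independent:
  assumes \<kappa>: "\<kappa> \<in> R (Suc k)" and \<mu>: "\<mu> \<in> R (Suc k)" and sub: "\<Lambda> \<subseteq> parents (Suc k) \<kappa> \<inter> parents (Suc k) \<mu>"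
    and s: "\<And>\<theta>. \<theta> \<in> ch k \<kappa> \<inter> ch k \<mu> \<Longrightarrow> (\<Sum>\<rho>\<in>\<Lambda>. x \<rho> * swap_coeff k \<rho> \<mu> \<kappa> \<theta>) = 0"
    and one: "\<kappa> = \<mu> \<Longrightarrow> (\<Sum>\<rho>\<in>\<Lambda>. x \<rho>) = 0"
    and flip: "\<kappa> = \<mu> \<Longrightarrow> (\<Sum>\<rho>\<in>\<Lambda>. x \<rho> * flip_eig (Suc k) \<kappa> \<rho>) = 0"
    and \<rho>0: "\<rho>0 \<in> \<Lambda>"
  shows "x \<rho>0 = 0"
proof (rule parents_independent[OF \<kappa> \<mu> sub _ one flip \<rho>0])
  fix a b assume b: "b < deg \<mu>" and a: "a < deg \<kappa>"
  obtain \<theta>' b' where b': "\<theta>' \<in> ch k \<mu>" "b' < deg \<theta>'" "b = emb k \<mu> \<theta>' b'" using emb_cases[OF \<mu> b] by blast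
  obtain \<theta> a' where a': "\<theta> \<in> ch k \<kappa>" "a' < deg \<theta>" "a = emb k \<kappa> \<theta> a'" using emb_cases[OF \<kappa> a] by blast
  have "(\<Sum>\<rho>\<in>\<Lambda>. x \<rho> * \<rho> (adjacent_swap (Suc k)) $$ (emb (Suc k) \<rho> \<mu> b, emb (Suc k) \<rho> \<kappa> a))
      = (\<Sum>\<rho>\<in>\<Lambda>. x \<rho> * (if \<theta>' = \<theta> \<and> b' = a' then swap_coeff k \<rho> \<mu> \<kappa> \<theta> else 0))"
  proof (intro sum.cong refl)
    fix \<rho> assume "\<rho> \<in> \<Lambda>"
    then have "\<rho> \<in> R (Suc (Suc k))" "\<kappa> \<in> ch (Suc k) \<rho>" "\<mu> \<in> ch (Suc k) \<rho>" using sub by (auto simp: parents_def)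
    then show "x \<rho> * \<rho> (adjacent_swap (Suc k)) $$ (emb (Suc k) \<rho> \<mu> b, emb (Suc k) \<rho> \<kappa> a)
      = x \<rho> * (if \<theta>' = \<theta> \<and> b' = a' then swap_coeff k \<rho> \<mu> \<kappa> \<theta> else 0)"
      using swap_entry[of \<rho> k \<kappa> \<theta> a' \<mu> \<theta>' b'] a' b' by simp
  qed
  also have "\<dots> = 0"
  proof (cases "\<theta>' = \<theta> \<and> b' = a'")
    case True
    then show ?thesis using s[of \<theta>] a' b' by simp
  next
    case False
    then show ?thesis by (intro sum.neutral) auto
  qed
  finally show "(\<Sum>\<rho>\<in>\<Lambda>. x \<rho> * \<rho> (adjacent_swap (Suc k)) $$ (emb (Suc k) \<rho> \<mu> b, emb (Suc k) \<rho> \<kappa> a)) = 0" .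
qed

text \<open>If all these scalars vanished, the family consisting of \<open>\<rho>\<close> alone
  would be dependent: an irreducible \<open>\<rho>\<close> must connect its summands
  \<open>\<kappa>\<close> and \<open>\<mu>\<close>, and only the swap can do this.\<close>

lemma common_child:
  assumes \<rho>: "\<rho> \<in> R (Suc (Suc m))" "\<kappa> \<in> ch (Suc m) \<rho>" "\<mu> \<in> ch (Suc m) \<rho>" and ne: "\<kappa> \<noteq> \<mu>"
  shows "\<exists>\<theta>\<in>ch m \<kappa> \<inter> ch m \<mu>. swap_coeff m \<rho> \<mu> \<kappa> \<theta> \<noteq> 0"
proof (rule ccontr)
  assume no: "\<not> ?thesis"
  have "(1 :: complex) = 0"
    by (rule swap_coeff_independent[OF ch_in_R[OF \<rho>(1,2)] ch_in_R[OF \<rho>(1,3)], of "{\<rho>}" "\<lambda>_. 1" \<rho>])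
      (use no \<rho> ne in \<open>auto simp: parents_def\<close>)
  then show False by simp
qed

text \<open>Two common children would have \<open>\<kappa>\<close> and \<open>\<mu>\<close> as
  common parents. Common parents of distinct representations are independent in the swap
  coefficients, which are indexed by common children one level lower, so the induction hypothesis
  leaves room for one only.\<close>

lemma common_children_le_1:
  assumes "\<kappa> \<in> R (Suc m)" "\<mu> \<in> R (Suc m)" "\<kappa> \<noteq> \<mu>"
  shows "card (ch m \<kappa> \<inter> ch m \<mu>) \<le> 1"
  using assms
proof (induction m arbitrary: \<kappa> \<mu>)
  case 0
  have "\<theta> = \<theta>'" if "\<theta> \<in> ch 0 \<kappa> \<inter> ch 0 \<mu>" "\<theta>' \<in> ch 0 \<kappa> \<inter> ch 0 \<mu>" for \<theta> \<theta>'
    using R_0_unique ch_in_R[of \<kappa> 0] 0 that by auto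
  then show ?case using card_le_Suc0_iff_eq[of "ch 0 \<kappa> \<inter> ch 0 \<mu>"] finite_ch[OF 0(1)] by auto
next
  case (Suc k)
  note fin = finite_ch[OF Suc.prems(1)]
  have "\<theta> = \<theta>'" if t: "\<theta> \<in> ch (Suc k) \<kappa> \<inter> ch (Suc k) \<mu>" "\<theta>' \<in> ch (Suc k) \<kappa> \<inter> ch (Suc k) \<mu>" for \<theta> \<theta>'
  proof (rule ccontr)
    assume ne: "\<theta> \<noteq> \<theta>'"
    have tR: "\<theta> \<in> R (Suc k)" "\<theta>' \<in> R (Suc k)" using ch_in_R[OF Suc.prems(1)] t by auto
    have sub: "{\<kappa>, \<mu>} \<subseteq> parents (Suc k) \<theta> \<inter> parents (Suc k) \<theta>'" using t Suc.prems by (auto simp: parents_def)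
    have "card {\<kappa>, \<mu>} \<le> card (ch k \<theta> \<inter> ch k \<theta>')"
    proof (rule card_le_of_independent_rows[where M = "\<lambda>\<rho> \<eta>. swap_coeff k \<rho> \<theta>' \<theta> \<eta>"])
      fix x assume x: "\<forall>\<eta>\<in>ch k \<theta> \<inter> ch k \<theta>'. (\<Sum>\<rho>\<in>{\<kappa>, \<mu>}. x \<rho> * swap_coeff k \<rho> \<theta>' \<theta> \<eta>) = 0"
      show "\<forall>\<rho>\<in>{\<kappa>, \<mu>}. x \<rho> = 0"
      proof
        fix \<rho> assume "\<rho> \<in> {\<kappa>, \<mu>}"
        then show "x \<rho> = 0"
          by (rule swap_coeff_independent[OF tR sub, of x, rotated 3]) (use x ne in auto)
      qed
    qed (use finite_ch tR in auto)
    then show False using Suc.IH[OF tR ne] Suc.prems(3) by simp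
  qed
  then show ?case using card_le_Suc0_iff_eq[of "ch (Suc k) \<kappa> \<inter> ch (Suc k) \<mu>"] fin by auto
qed

lemma common_child_unique:
  assumes "\<kappa> \<in> R (Suc m)" "\<mu> \<in> R (Suc m)" "\<kappa> \<noteq> \<mu>" "\<theta> \<in> ch m \<kappa>" "\<theta> \<in> ch m \<mu>" "\<theta>' \<in> ch m \<kappa>" "\<theta>' \<in> ch m \<mu>"
  shows "\<theta> = \<theta>'"
  using common_children_le_1[OF assms(1-3)] card_le_Suc0_iff_eq[of "ch m \<kappa> \<inter> ch m \<mu>"] finite_ch[OF assms(1)] assms(4-) by auto

definition child_count :: "nat \<Rightarrow> B_rep \<Rightarrow> nat" where
  "child_count m \<kappa> = (case m of 0 \<Rightarrow> 0 | Suc k \<Rightarrow> card (ch k \<kappa>))"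

text \<open>A parent is recorded by the vector of its diagonal swap coefficients, one for each
  child, together with 1 and its flip eigenvalue; these vectors are independent. On level 0 only the
  last two coordinates remain, which \<open>bool\<close> indexes.\<close>

lemma card_parents_le:
  assumes \<kappa>: "\<kappa> \<in> R m"
  shows "card (parents m \<kappa>) \<le> child_count m \<kappa> + 2"
proof (cases m)
  case 0
  have "card (parents 0 \<kappa>) \<le> card (UNIV :: bool set)"
  proof (rule card_le_of_independent_rows[where M = "\<lambda>\<rho> b. if b then 1 else flip_eig 0 \<kappa> \<rho>"])
    fix x assume x: "\<forall>b\<in>UNIV. (\<Sum>\<rho>\<in>parents 0 \<kappa>. x \<rho> * (if b then 1 else flip_eig 0 \<kappa> \<rho>)) = 0"
    show "\<forall>\<rho>\<in>parents 0 \<kappa>. x \<rho> = 0"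
    proof
      fix \<rho> assume "\<rho> \<in> parents 0 \<kappa>"
      then show "x \<rho> = 0"
        using x[rule_format, of True] x[rule_format, of False] \<kappa> 0
        by (intro parents_independent[of \<kappa> 0 \<kappa> "parents 0 \<kappa>" x \<rho>]) auto
    qed
  qed (simp_all add: finite_parents)
  then show ?thesis using 0 by simp
next
  case (Suc k)
  note \<kappa>' = \<kappa>[unfolded Suc]
  have "card (parents (Suc k) \<kappa>) \<le> card (Inl ` ch k \<kappa> \<union> Inr ` (UNIV :: bool set))"
  proof (rule card_le_of_independent_rows[where
        M = "\<lambda>\<rho> c. case c of Inl \<theta> \<Rightarrow> swap_coeff k \<rho> \<kappa> \<kappa> \<theta> | Inr b \<Rightarrow> if b then 1 else flip_eig (Suc k) \<kappa> \<rho>"])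
    fix x assume x: "\<forall>c\<in>Inl ` ch k \<kappa> \<union> Inr ` UNIV. (\<Sum>\<rho>\<in>parents (Suc k) \<kappa>. x \<rho> *
      (case c of Inl \<theta> \<Rightarrow> swap_coeff k \<rho> \<kappa> \<kappa> \<theta> | Inr b \<Rightarrow> if b then 1 else flip_eig (Suc k) \<kappa> \<rho>)) = 0"
    have 1: "(\<Sum>\<rho>\<in>parents (Suc k) \<kappa>. x \<rho>) = 0" using bspec[OF x UnI2[OF rangeI[of Inr True]]] by simp
    have 2: "(\<Sum>\<rho>\<in>parents (Suc k) \<kappa>. x \<rho> * flip_eig (Suc k) \<kappa> \<rho>) = 0" using bspec[OF x UnI2[OF rangeI[of Inr False]]] by simp
    have 3: "(\<Sum>\<rho>\<in>parents (Suc k) \<kappa>. x \<rho> * swap_coeff k \<rho> \<kappa> \<kappa> \<theta>) = 0" if "\<theta> \<in> ch k \<kappa>" for \<theta>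
      using x[rule_format, of "Inl \<theta>"] that by simp
    show "\<forall>\<rho>\<in>parents (Suc k) \<kappa>. x \<rho> = 0"
    proof
      fix \<rho> assume \<rho>: "\<rho> \<in> parents (Suc k) \<kappa>"
      show "x \<rho> = 0"
        by (rule swap_coeff_independent[OF \<kappa>' \<kappa>' _ _ 1 2 \<rho>]) (use 3 in auto)
    qed
  qed (simp_all add: finite_parents finite_ch[OF \<kappa>'])
  also have "\<dots> = card (ch k \<kappa>) + 2"
    using finite_ch[OF \<kappa>'] by (subst card_Un_disjoint) (auto simp: card_image)
  finally show ?thesis using Suc by (simp add: child_count_def)
qed

text \<open>The right-hand side is the degree of the representation induced from
  \<open>\<kappa>\<close>. A linear relation between the columns of the parents needs to be checked
  only at coset representatives, provided that all columns of the block \<open>\<kappa>\<close> are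
  included.\<close>

lemma sum_deg_parents_le:
  assumes \<kappa>: "\<kappa> \<in> R m"
  shows "(\<Sum>\<rho>\<in>parents m \<kappa>. deg \<rho>) \<le> 2 * Suc m * deg \<kappa>"
proof -
  have p: "0 < deg \<kappa>" by (rule deg_pos[OF \<kappa>])
  have P: "\<rho> \<in> R (Suc m)" "\<kappa> \<in> ch m \<rho>" if "\<rho> \<in> parents m \<kappa>" for \<rho> using that by (auto simp: parents_def)
  have "card (SIGMA \<rho>:parents m \<kappa>. {..<deg \<rho>}) \<le> card (letters (Suc m) \<times> {..<deg \<kappa>})"
  proof (rule card_le_of_independent_rows[where
        M = "\<lambda>(\<rho>, i) (j, a). \<rho> (coset_rep (Suc m) j) $$ (i, emb m \<rho> \<kappa> a)"])
    fix x assume x: "\<forall>c\<in>letters (Suc m) \<times> {..<deg \<kappa>}. (\<Sum>r\<in>(SIGMA \<rho>:parents m \<kappa>. {..<deg \<rho>}).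
       x r * (case r of (\<rho>, i) \<Rightarrow> \<lambda>(j, a). \<rho> (coset_rep (Suc m) j) $$ (i, emb m \<rho> \<kappa> a)) c) = 0"
    have x': "(\<Sum>\<rho>\<in>parents m \<kappa>. \<Sum>i<deg \<rho>. x (\<rho>, i) * \<rho> (coset_rep (Suc m) j) $$ (i, emb m \<rho> \<kappa> a)) = 0"
      if "j \<in> letters (Suc m)" "a < deg \<kappa>" for j a
      using x[rule_format, of "(j, a)"] that by (simp add: sum.Sigma finite_parents case_prod_unfold del: coset_rep.simps)
    have "x (\<rho>, i) = 0" if \<rho>: "\<rho> \<in> parents m \<kappa>" "i < deg \<rho>" for \<rho> i
    proof (rule column_independent[where n = "Suc m" and \<Lambda> = "parents m \<kappa>" and j = "\<lambda>\<rho>. emb m \<rho> \<kappa> 0" and a = "\<lambda>\<rho> i. x (\<rho>, i)"])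
      fix w assume w: "w \<in> carrier (B (Suc m))"
      have "w \<in> (\<lambda>(j, h). coset_rep (Suc m) j \<circ> h) ` (letters (Suc m) \<times> carrier (B m))"
        using bij_betw_imp_surj_on[OF coset_decomposition[of m]] w by simp
      then obtain j h where j: "j \<in> letters (Suc m)" and h: "h \<in> carrier (B m)" and wjh: "w = coset_rep (Suc m) j \<circ> h"
        by auto
      have h': "h \<in> carrier (B (Suc m))" using h carrier_B_mono[of m "Suc m"] by auto
      let ?c = "coset_rep (Suc m) j"
      have "(\<Sum>\<rho>\<in>parents m \<kappa>. \<Sum>i<deg \<rho>. x (\<rho>, i) * \<rho> w $$ (i, emb m \<rho> \<kappa> 0))
         = (\<Sum>\<rho>\<in>parents m \<kappa>. \<Sum>i<deg \<rho>. \<Sum>a<deg \<kappa>. x (\<rho>, i) * \<rho> ?c $$ (i, emb m \<rho> \<kappa> a) * \<kappa> h $$ (a, 0))"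
      proof (intro sum.cong refl)
        fix \<rho> i assume r: "\<rho> \<in> parents m \<kappa>" and i: "i \<in> {..<deg \<rho>}"
        have "\<rho> w $$ (i, emb m \<rho> \<kappa> 0) = (\<Sum>z<deg \<rho>. \<rho> ?c $$ (i, z) * \<rho> h $$ (z, emb m \<rho> \<kappa> 0))"
          unfolding wjh by (rule comp_entry[OF P(1)[OF r] coset_rep(1)[OF j] h' _ emb_lt[OF P[OF r] p]]) (use i in auto)
        also have "\<dots> = (\<Sum>a<deg \<kappa>. \<rho> ?c $$ (i, emb m \<rho> \<kappa> a) * \<kappa> h $$ (a, 0))"
          by (rule embeddedD(3)[OF embedded_emb[OF P[OF r]] h p])
        finally show "x (\<rho>, i) * \<rho> w $$ (i, emb m \<rho> \<kappa> 0) = (\<Sum>a<deg \<kappa>. x (\<rho>, i) * \<rho> ?c $$ (i, emb m \<rho> \<kappa> a) * \<kappa> h $$ (a, 0))"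
          by (simp add: sum_distrib_left mult.assoc del: coset_rep.simps)
      qed
      also have "\<dots> = (\<Sum>\<rho>\<in>parents m \<kappa>. \<Sum>a<deg \<kappa>. \<Sum>i<deg \<rho>. x (\<rho>, i) * \<rho> ?c $$ (i, emb m \<rho> \<kappa> a) * \<kappa> h $$ (a, 0))"
        by (intro sum.cong[OF refl] sum.swap)
      also have "\<dots> = (\<Sum>a<deg \<kappa>. \<Sum>\<rho>\<in>parents m \<kappa>. \<Sum>i<deg \<rho>. x (\<rho>, i) * \<rho> ?c $$ (i, emb m \<rho> \<kappa> a) * \<kappa> h $$ (a, 0))"
        by (rule sum.swap)
      also have "\<dots> = (\<Sum>a<deg \<kappa>. (\<Sum>\<rho>\<in>parents m \<kappa>. \<Sum>i<deg \<rho>. x (\<rho>, i) * \<rho> ?c $$ (i, emb m \<rho> \<kappa> a)) * \<kappa> h $$ (a, 0))"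
        by (simp add: sum_distrib_right del: coset_rep.simps)
      also have "\<dots> = 0" by (rule sum.neutral) (simp add: x'[OF j] del: coset_rep.simps)
      finally show "(\<Sum>\<rho>\<in>parents m \<kappa>. \<Sum>i<deg \<rho>. x (\<rho>, i) * \<rho> w $$ (i, emb m \<rho> \<kappa> 0)) = 0" .
    qed (use P emb_lt p \<rho> in auto)
    then show "\<forall>r\<in>(SIGMA \<rho>:parents m \<kappa>. {..<deg \<rho>}). x r = 0" by auto
  qed (auto simp: finite_parents)
  then show ?thesis by (simp add: finite_parents card_letters card_cartesian_product)
qed

section \<open>Contents as joint eigenvalues of sign change and Jucys-Murphy sum\<close>

definition content :: "nat \<Rightarrow> B_rep \<Rightarrow> B_rep \<Rightarrow> complex \<times> complex" where
  "content m \<kappa> \<rho> = (flip_eig m \<kappa> \<rho>, jm_eig m \<kappa> \<rho>)"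

text \<open>The swap coefficient at the unique common child is nonzero and can be cancelled in
  \<open>swap_flip\<close> and \<open>swap_jm\<close>, whose correction term is absent for distinct
  children. In terms of diagrams, two boxes are added in the opposite order.\<close>

lemma content_swap:
  assumes \<rho>: "\<rho> \<in> R (Suc (Suc m))" "\<kappa> \<in> ch (Suc m) \<rho>" "\<mu> \<in> ch (Suc m) \<rho>" and ne: "\<kappa> \<noteq> \<mu>"
    and \<theta>: "\<theta> \<in> ch m \<kappa>" "\<theta> \<in> ch m \<mu>"
  shows "content m \<theta> \<kappa> = content (Suc m) \<mu> \<rho>"
proof -
  obtain \<theta>' where t: "\<theta>' \<in> ch m \<kappa>" "\<theta>' \<in> ch m \<mu>" "swap_coeff m \<rho> \<mu> \<kappa> \<theta>' \<noteq> 0" using common_child[OF \<rho> ne] by blast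
  have "\<theta>' = \<theta>" by (rule common_child_unique[OF ch_in_R[OF \<rho>(1,2)] ch_in_R[OF \<rho>(1,3)] ne t(1,2) \<theta>])
  then have nz: "swap_coeff m \<rho> \<mu> \<kappa> \<theta> \<noteq> 0" using t by simp
  then show ?thesis
    using swap_flip[OF \<rho>(1,2) \<theta>(1) \<rho>(3) \<theta>(2)] swap_jm[OF \<rho>(1,2) \<theta>(1) \<rho>(3) \<theta>(2)] ne
    by (auto simp: content_def)
qed

text \<open>Equal contents would, by \<open>content_swap\<close>, make two successive contents on
  the path through \<open>\<theta>\<close> and \<open>\<kappa>\<close> equal, and the diagonal case
  of \<open>swap_jm\<close> would read 0 = 1 + 1.\<close>

lemma content_inj:
  assumes \<rho>: "\<rho> \<in> R (Suc m)" and \<kappa>: "\<kappa> \<in> ch m \<rho>" "\<mu> \<in> ch m \<rho>" and eq: "content m \<kappa> \<rho> = content m \<mu> \<rho>"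
  shows "\<kappa> = \<mu>"
proof (cases m)
  case 0
  then show ?thesis using R_0_unique ch_in_R \<rho> \<kappa> by auto
next
  case (Suc k)
  show ?thesis
  proof (rule ccontr)
    assume ne: "\<kappa> \<noteq> \<mu>"
    note \<rho>' = \<rho>[unfolded Suc] and \<kappa>' = \<kappa>[unfolded Suc]
    obtain \<theta> where t: "\<theta> \<in> ch k \<kappa>" "\<theta> \<in> ch k \<mu>" using common_child[OF \<rho>' \<kappa>' ne] by blast
    have "content k \<theta> \<kappa> = content (Suc k) \<kappa> \<rho>" using content_swap[OF \<rho>' \<kappa>' ne t] eq Suc by simp
    then have "0 = 1 + flip_eig (Suc k) \<kappa> \<rho> * flip_eig (Suc k) \<kappa> \<rho>"
      using swap_jm[OF \<rho>' \<kappa>'(1) t(1) \<kappa>'(1) t(1)] by (simp add: content_def)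
    then show False using flip_eig_square[OF \<rho>' \<kappa>'(1)] by simp
  qed
qed

text \<open>With a single child the relevant row of the swap has one nonzero entry, so s s = 1 makes
  the coefficient a square root of 1. It can then be cancelled in both relations.\<close>

lemma only_child:
  assumes \<rho>: "\<rho> \<in> R (Suc (Suc m))" and only: "ch (Suc m) \<rho> = {\<kappa>}" and \<theta>: "\<theta> \<in> ch m \<kappa>"
  shows "swap_coeff m \<rho> \<kappa> \<kappa> \<theta> * swap_coeff m \<rho> \<kappa> \<kappa> \<theta> = 1"
    and "flip_eig m \<theta> \<kappa> = flip_eig (Suc m) \<kappa> \<rho>"
    and "jm_eig (Suc m) \<kappa> \<rho> = jm_eig m \<theta> \<kappa> + 2 * swap_coeff m \<rho> \<kappa> \<kappa> \<theta>"
proof -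
  have \<kappa>: "\<kappa> \<in> ch (Suc m) \<rho>" using only by simp
  note kR = ch_in_R[OF \<rho> \<kappa>]
  note tR = ch_in_R[OF kR \<theta>]
  have p: "0 < deg \<theta>" by (rule deg_pos[OF tR])
  let ?a = "swap_coeff m \<rho> \<kappa> \<kappa> \<theta>" and ?s = "adjacent_swap (Suc m)"
  let ?Q = "emb (Suc m) \<rho> \<kappa> (emb m \<kappa> \<theta> 0)"
  note ek = emb_lt[OF kR \<theta> p]
  have Q: "?Q < deg \<rho>" using emb_lt[OF \<rho> \<kappa> ek] .
  have s: "?s \<in> carrier (B (Suc (Suc m)))" by (rule adjacent_swap_in_B) auto
  have "1 = \<rho> (?s \<circ> ?s) $$ (?Q, ?Q)" using R_id_entry[OF \<rho> Q Q] by (simp add: adjacent_swap_involution)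
  also have "\<dots> = (\<Sum>z<deg \<rho>. \<rho> ?s $$ (?Q, z) * \<rho> ?s $$ (z, ?Q))" by (rule comp_entry[OF \<rho> s s Q Q])
  also have "\<dots> = (\<Sum>y<deg \<kappa>. \<rho> ?s $$ (?Q, emb (Suc m) \<rho> \<kappa> y) * \<rho> ?s $$ (emb (Suc m) \<rho> \<kappa> y, ?Q))"
    unfolding sum_blocks[OF \<rho>] only by simp
  also have "\<dots> = ?a * \<rho> ?s $$ (?Q, ?Q)"
    by (rule scalar_row[OF kR \<theta> p, of "\<lambda>x y. \<rho> ?s $$ (emb (Suc m) \<rho> \<kappa> x, emb (Suc m) \<rho> \<kappa> y)"
        ?a "\<lambda>y. \<rho> ?s $$ (emb (Suc m) \<rho> \<kappa> y, ?Q)"])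
      (use swap_entry[OF \<rho> \<kappa> _ _ \<kappa> \<theta> p] in auto)
  finally show sq: "?a * ?a = 1" by (simp add: swap_coeff_def)
  then have nz: "?a \<noteq> 0" by auto
  then show fl: "flip_eig m \<theta> \<kappa> = flip_eig (Suc m) \<kappa> \<rho>" using swap_flip[OF \<rho> \<kappa> \<theta> \<kappa> \<theta>] by simp
  have "jm_eig (Suc m) \<kappa> \<rho> * ?a = ?a * jm_eig m \<theta> \<kappa> + 2"
    using swap_jm[OF \<rho> \<kappa> \<theta> \<kappa> \<theta>] flip_eig_square[OF \<rho> \<kappa>] fl by simp
  then have "(jm_eig (Suc m) \<kappa> \<rho> * ?a) * ?a = (?a * jm_eig m \<theta> \<kappa> + 2) * ?a" by simp
  then have "jm_eig (Suc m) \<kappa> \<rho> * (?a * ?a) = jm_eig m \<theta> \<kappa> * (?a * ?a) + 2 * ?a" by (simp add: algebra_simps)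
  then show "jm_eig (Suc m) \<kappa> \<rho> = jm_eig m \<theta> \<kappa> + 2 * ?a" unfolding sq by simp
qed

text \<open>Two successive only children force the last swap to be a scalar a on all of
  \<open>\<rho>\<close>, with a a = 1. The diagonal entry of s s' s is then a, and that of s' s s'
  is a a b = b.\<close>

lemma only_child_braid:
  assumes \<rho>: "\<rho> \<in> R (Suc (Suc (Suc m)))" and only: "ch (Suc (Suc m)) \<rho> = {\<kappa>}" "ch (Suc m) \<kappa> = {\<theta>}" and \<eta>: "\<eta> \<in> ch m \<theta>"
  shows "swap_coeff m \<kappa> \<theta> \<theta> \<eta> = swap_coeff (Suc m) \<rho> \<kappa> \<kappa> \<theta>"
proof -
  have \<kappa>: "\<kappa> \<in> ch (Suc (Suc m)) \<rho>" and \<theta>: "\<theta> \<in> ch (Suc m) \<kappa>" using only by auto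
  note kR = ch_in_R[OF \<rho> \<kappa>]
  note tR = ch_in_R[OF kR \<theta>]
  have p: "0 < deg \<eta>" by (rule deg_pos[OF ch_in_R[OF tR \<eta>]])
  let ?a = "swap_coeff (Suc m) \<rho> \<kappa> \<kappa> \<theta>" and ?b = "swap_coeff m \<kappa> \<theta> \<theta> \<eta>"
  let ?s = "adjacent_swap (Suc m)" and ?s' = "adjacent_swap (Suc (Suc m))"
  have a2: "?a * ?a = 1" by (rule only_child(1)[OF \<rho> only(1) \<theta>])
  have s': "\<rho> ?s' $$ (x, y) = (if x = y then ?a else 0)" if xy: "x < deg \<rho>" "y < deg \<rho>" for x y
  proof -
    obtain x' where x': "x' < deg \<kappa>" "x = emb (Suc (Suc m)) \<rho> \<kappa> x'" by (rule emb_cases[OF \<rho> xy(1)]) (use only that in auto)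
    obtain x'' where x'': "x'' < deg \<theta>" "x' = emb (Suc m) \<kappa> \<theta> x''" by (rule emb_cases[OF kR x'(1)]) (use only that in auto)
    obtain y' where y': "y' < deg \<kappa>" "y = emb (Suc (Suc m)) \<rho> \<kappa> y'" by (rule emb_cases[OF \<rho> xy(2)]) (use only that in auto)
    obtain y'' where y'': "y'' < deg \<theta>" "y' = emb (Suc m) \<kappa> \<theta> y''" by (rule emb_cases[OF kR y'(1)]) (use only that in auto)
    have "x = y \<longleftrightarrow> x'' = y''"
      using emb_eq_iff[OF \<rho> \<kappa> x'(1) \<kappa> y'(1)] emb_eq_iff[OF kR \<theta> x''(1) \<theta> y''(1)] x' y' x'' y'' by simp
    then show ?thesis using swap_entry[OF \<rho> \<kappa> \<theta> y''(1) \<kappa> \<theta> x''(1)] x' y' x'' y'' by simp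
  qed
  have el: "?s \<in> carrier (B (Suc (Suc m)))" "?s \<in> carrier (B (Suc (Suc (Suc m))))" "?s' \<in> carrier (B (Suc (Suc (Suc m))))"
    by (auto intro!: adjacent_swap_in_B)
  have left: "\<rho> (?s' \<circ> g) $$ (x, y) = ?a * \<rho> g $$ (x, y)" and right: "\<rho> (g \<circ> ?s') $$ (x, y) = ?a * \<rho> g $$ (x, y)"
    if "g \<in> carrier (B (Suc (Suc (Suc m))))" "x < deg \<rho>" "y < deg \<rho>" for g x y
  proof -
    have "\<rho> (?s' \<circ> g) $$ (x, y) = (\<Sum>z<deg \<rho>. if x = z then ?a * \<rho> g $$ (x, y) else 0)"
      unfolding comp_entry[OF \<rho> el(3) that] using that by (intro sum.cong refl) (auto simp: s')
    then show "\<rho> (?s' \<circ> g) $$ (x, y) = ?a * \<rho> g $$ (x, y)" using that by simp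
    have "\<rho> (g \<circ> ?s') $$ (x, y) = (\<Sum>z<deg \<rho>. if z = y then ?a * \<rho> g $$ (x, y) else 0)"
      unfolding comp_entry[OF \<rho> that(1) el(3) that(2,3)] using that by (intro sum.cong refl) (auto simp: s')
    then show "\<rho> (g \<circ> ?s') $$ (x, y) = ?a * \<rho> g $$ (x, y)" using that by simp
  qed
  note et = emb_lt[OF tR \<eta> p]
  note ek = emb_lt[OF kR \<theta> et]
  let ?Q = "emb (Suc (Suc m)) \<rho> \<kappa> (emb (Suc m) \<kappa> \<theta> (emb m \<theta> \<eta> 0))"
  have Q: "?Q < deg \<rho>" by (rule emb_lt[OF \<rho> \<kappa> ek])
  have b: "\<rho> ?s $$ (?Q, ?Q) = ?b"
    using emb_block[OF \<rho> el(1) \<kappa> \<kappa> ek ek] by (simp add: swap_coeff_def)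
  have "\<rho> (?s \<circ> ?s' \<circ> ?s) $$ (?Q, ?Q) = (\<Sum>z<deg \<rho>. \<rho> (?s \<circ> ?s') $$ (?Q, z) * \<rho> ?s $$ (z, ?Q))"
    by (rule comp_entry[OF \<rho> B_comp[OF el(2,3)] el(2) Q Q])
  also have "\<dots> = ?a * (\<Sum>z<deg \<rho>. \<rho> ?s $$ (?Q, z) * \<rho> ?s $$ (z, ?Q))"
    unfolding sum_distrib_left by (intro sum.cong refl) (simp add: right[OF el(2) Q])
  also have "\<dots> = ?a * \<rho> (?s \<circ> ?s) $$ (?Q, ?Q)" unfolding comp_entry[OF \<rho> el(2,2) Q Q] ..
  also have "\<dots> = ?a" using R_id_entry[OF \<rho> Q Q] by (simp add: adjacent_swap_involution)
  finally have 1: "\<rho> (?s \<circ> ?s' \<circ> ?s) $$ (?Q, ?Q) = ?a" .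
  have "\<rho> (?s' \<circ> ?s \<circ> ?s') $$ (?Q, ?Q) = ?a * (?a * ?b)"
    by (simp add: right[OF B_comp[OF el(3,2)] Q Q] left[OF el(2) Q Q] b)
  also have "\<dots> = ?b" using a2 by (simp add: mult.assoc[symmetric])
  finally show ?thesis using 1 braid[of m] by simp
qed

text \<open>The braid relation passes the increment d on to the next lower level. There all children
  of \<open>\<theta>\<close> have the same content, so by \<open>content_inj\<close> there is again
  only one. The path thus descends without branching to level 0, where the sum is empty: the shape
  is a single row or column.\<close>

lemma only_child_chain:
  assumes "\<rho> \<in> R (Suc (Suc m))" "ch (Suc m) \<rho> = {\<kappa>}" "ch m \<kappa> = {\<theta>}" "jm_eig (Suc m) \<kappa> \<rho> = jm_eig m \<theta> \<kappa> + d"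
  shows "jm_eig (Suc m) \<kappa> \<rho> = of_nat (Suc m) * d"
  using assms
proof (induction m arbitrary: \<rho> \<kappa> \<theta>)
  case 0
  then show ?case by (simp add: jm_eig_def[of 0] jm_def)
next
  case (Suc m)
  note \<rho> = Suc.prems(1) and only = Suc.prems(2,3)
  have \<kappa>: "\<kappa> \<in> ch (Suc (Suc m)) \<rho>" and \<theta>: "\<theta> \<in> ch (Suc m) \<kappa>" using only by auto
  note kR = ch_in_R[OF \<rho> \<kappa>]
  note tR = ch_in_R[OF kR \<theta>]
  have d: "d = 2 * swap_coeff (Suc m) \<rho> \<kappa> \<kappa> \<theta>" using only_child(3)[OF \<rho> only(1) \<theta>] Suc.prems(4) by simp
  have c: "flip_eig m \<eta> \<theta> = flip_eig (Suc m) \<theta> \<kappa>" "jm_eig (Suc m) \<theta> \<kappa> = jm_eig m \<eta> \<theta> + d" if "\<eta> \<in> ch m \<theta>" for \<eta>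
    using only_child(2,3)[OF kR only(2) that] only_child_braid[OF \<rho> only that] d by auto
  then have "content m \<eta> \<theta> = content m \<eta>' \<theta>" if "\<eta> \<in> ch m \<theta>" "\<eta>' \<in> ch m \<theta>" for \<eta> \<eta>'
    using c(1)[OF that(1)] c(1)[OF that(2)] c(2)[OF that(1)] c(2)[OF that(2)] by (simp add: content_def)
  then have eq: "\<eta> = \<eta>'" if "\<eta> \<in> ch m \<theta>" "\<eta>' \<in> ch m \<theta>" for \<eta> \<eta>'
    using content_inj[OF tR that] that by blast
  obtain \<eta> where \<eta>: "\<eta> \<in> ch m \<theta>" using ch_nonempty[OF tR] by blast
  then have "ch m \<theta> = {\<eta>}" using eq by blast
  then have "jm_eig (Suc m) \<theta> \<kappa> = of_nat (Suc m) * d" by (rule Suc.IH[OF kR only(2) _ c(2)[OF \<eta>]])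
  then show ?case using Suc.prems(4) by (simp add: algebra_simps of_nat_Suc)
qed

end

text \<open>Listed from the outermost drop inwards, the values at the drops are at least 1, 2, 3 and
  so on. The induction adds a new smallest drop and also carries the bound
  \<open>card Y \<le> N x\<close> for x not beyond any drop.\<close>

lemma antitone_drops:
  fixes N :: "nat \<Rightarrow> nat"
  assumes anti: "\<And>y. N (Suc y) \<le> N y" and Y: "finite Y" "\<And>y. y \<in> Y \<Longrightarrow> N (Suc y) < N y"
  shows "card Y * (card Y + 1) \<le> 2 * (\<Sum>y\<in>Y. N y)"
proof -
  have mono: "N y \<le> N x" if "x \<le> y" for x y using that anti by (induction y rule: dec_induct) (auto intro: order_trans)
  have "(\<forall>y\<in>Y. N (Suc y) < N y) \<longrightarrow> card Y * (card Y + 1) \<le> 2 * (\<Sum>y\<in>Y. N y) \<and> (\<forall>x. (\<forall>y\<in>Y. x \<le> y) \<longrightarrow> card Y \<le> N x)"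
    using Y(1)
  proof (induction Y rule: finite_linorder_min_induct)
    case empty
    then show ?case by simp
  next
    case (insert b A)
    show ?case
    proof (intro impI conjI allI)
      assume s: "\<forall>y\<in>insert b A. N (Suc y) < N y"
      have IH: "card A * (card A + 1) \<le> 2 * (\<Sum>y\<in>A. N y)" "\<And>x. \<forall>y\<in>A. x \<le> y \<Longrightarrow> card A \<le> N x"
        using insert.IH s by auto
      have "card A \<le> N (Suc b)" by (rule IH(2)) (use insert.hyps in auto)
      then have Nb: "Suc (card A) \<le> N b" using s by auto
      have b: "b \<notin> A" using insert.hyps by auto
      show "card (insert b A) * (card (insert b A) + 1) \<le> 2 * (\<Sum>y\<in>insert b A. N y)"
        using IH(1) Nb b insert.hyps(1) by simp
      fix x assume "\<forall>y\<in>insert b A. x \<le> y"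
      then have "N b \<le> N x" using mono by simp
      then show "card (insert b A) \<le> N x" using Nb b insert.hyps(1) by simp
    qed
  qed
  then show ?thesis using Y(2) by blast
qed

section \<open>Path independence of contents and the bound on the number of children\<close>

context tower begin

text \<open>The multiset of contents along a path from \<open>\<rho>\<close> down to \<open>B 0\<close>; by \<open>contents_child\<close> it does not
  depend on the path.\<close>

fun contents :: "nat \<Rightarrow> B_rep \<Rightarrow> (complex \<times> complex) multiset" where
  "contents 0 \<rho> = {#}"
| "contents (Suc m) \<rho> = (let \<kappa> = (SOME \<kappa>. \<kappa> \<in> ch m \<rho>) in add_mset (content m \<kappa> \<rho>) (contents m \<kappa>))"

text \<open>Paths through two different children can be routed through a common child; they then
  collect the same two contents in opposite order.\<close>

lemma contents_child:
  assumes "\<rho> \<in> R (Suc m)" "\<kappa> \<in> ch m \<rho>"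
  shows "contents (Suc m) \<rho> = add_mset (content m \<kappa> \<rho>) (contents m \<kappa>)"
  using assms
proof (induction m arbitrary: \<rho> \<kappa>)
  case 0
  have "(SOME \<kappa>. \<kappa> \<in> ch 0 \<rho>) \<in> ch 0 \<rho>" using someI[of "\<lambda>\<kappa>. \<kappa> \<in> ch 0 \<rho>", OF 0(2)] .
  then have "(SOME \<kappa>. \<kappa> \<in> ch 0 \<rho>) = \<kappa>" using R_0_unique ch_in_R 0 by blast
  then show ?case by (simp add: Let_def)
next
  case (Suc m)
  define \<mu> where "\<mu> = (SOME \<kappa>. \<kappa> \<in> ch (Suc m) \<rho>)"
  have \<mu>: "\<mu> \<in> ch (Suc m) \<rho>" unfolding \<mu>_def using someI[of "\<lambda>\<kappa>. \<kappa> \<in> ch (Suc m) \<rho>", OF Suc.prems(2)] .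
  have e: "contents (Suc (Suc m)) \<rho> = add_mset (content (Suc m) \<mu> \<rho>) (contents (Suc m) \<mu>)"
    by (simp add: \<mu>_def Let_def)
  show ?case
  proof (cases "\<mu> = \<kappa>")
    case True
    then show ?thesis using e by simp
  next
    case False
    note \<rho> = Suc.prems(1) and \<kappa> = Suc.prems(2)
    obtain \<theta> where t: "\<theta> \<in> ch m \<mu>" "\<theta> \<in> ch m \<kappa>" using common_child[OF \<rho> \<mu> \<kappa> False] by blast
    have "contents (Suc m) \<mu> = add_mset (content m \<theta> \<mu>) (contents m \<theta>)"
      by (rule Suc.IH[OF ch_in_R[OF \<rho> \<mu>] t(1)])
    moreover have "contents (Suc m) \<kappa> = add_mset (content m \<theta> \<kappa>) (contents m \<theta>)"
      by (rule Suc.IH[OF ch_in_R[OF \<rho> \<kappa>] t(2)])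
    moreover have "content m \<theta> \<mu> = content (Suc m) \<kappa> \<rho>" by (rule content_swap[OF \<rho> \<mu> \<kappa> False t])
    moreover have "content m \<theta> \<kappa> = content (Suc m) \<mu> \<rho>"
      by (rule content_swap[OF \<rho> \<kappa> \<mu> _ t(2,1)]) (use False in auto)
    ultimately show ?thesis unfolding e by (simp add: add_mset_commute)
  qed
qed

lemma size_contents: "\<rho> \<in> R m \<Longrightarrow> size (contents m \<rho>) = m"
proof (induction m arbitrary: \<rho>)
  case (Suc m)
  obtain \<kappa> where k: "\<kappa> \<in> ch m \<rho>" using ch_nonempty[OF Suc.prems] by blast
  show ?case unfolding contents_child[OF Suc.prems k] using Suc.IH[OF ch_in_R[OF Suc.prems k]] by simp
qed simp

text \<open>Both claims advance together: a multiset stays stacked because the new content is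
  addable. If \<open>\<rho>\<close> has a second child \<open>\<mu>\<close>, addability is inherited
  from the path through \<open>\<mu>\<close>, and the extra content differs by
  \<open>content_inj\<close>. The real case is that of an only child.\<close>

lemma contents_well_stacked_addable:
  "(\<forall>\<kappa>\<in>R m. well_stacked (contents m \<kappa>)) \<and>
    (\<forall>\<rho>\<in>R (Suc m). \<forall>\<kappa>\<in>ch m \<rho>. addable (contents m \<kappa>) (content m \<kappa> \<rho>))"
proof (induction m)
  case 0
  show ?case
  proof (intro conjI ballI)
    show "well_stacked (contents 0 \<kappa>)" for \<kappa> by (simp add: well_stacked_def)
    fix \<rho> \<kappa>
    have "content 0 \<kappa> \<rho> = signed_content (flip_eig 0 \<kappa> \<rho>) 1 0"
      by (simp add: content_def signed_content_def jm_eig_def jm_def)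
    then show "addable (contents 0 \<kappa>) (content 0 \<kappa> \<rho>)" unfolding addable_def by blast
  qed
next
  case (Suc m)
  have IH1: "well_stacked (contents m \<kappa>)" if "\<kappa> \<in> R m" for \<kappa> using Suc that by blast
  have IH2: "addable (contents m \<kappa>) (content m \<kappa> \<rho>)" if "\<rho> \<in> R (Suc m)" "\<kappa> \<in> ch m \<rho>" for \<rho> \<kappa> using Suc that by blast
  show ?case
  proof (intro conjI ballI)
    fix \<kappa> assume 1: "\<kappa> \<in> R (Suc m)"
    obtain \<theta> where t: "\<theta> \<in> ch m \<kappa>" using ch_nonempty[OF 1] by blast
    show "well_stacked (contents (Suc m) \<kappa>)" unfolding contents_child[OF 1 t]
      by (rule well_stacked_add_mset[OF IH1[OF ch_in_R[OF 1 t]] IH2[OF 1 t]])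
  next
    fix \<rho> \<kappa> assume \<rho>: "\<rho> \<in> R (Suc (Suc m))" and \<kappa>: "\<kappa> \<in> ch (Suc m) \<rho>"
    note kR = ch_in_R[OF \<rho> \<kappa>]
    show "addable (contents (Suc m) \<kappa>) (content (Suc m) \<kappa> \<rho>)"
    proof (cases "\<exists>\<mu>\<in>ch (Suc m) \<rho>. \<mu> \<noteq> \<kappa>")
      case True
      then obtain \<mu> where \<mu>: "\<mu> \<in> ch (Suc m) \<rho>" "\<mu> \<noteq> \<kappa>" by blast
      note mR = ch_in_R[OF \<rho> \<mu>(1)]
      obtain \<theta> where t: "\<theta> \<in> ch m \<mu>" "\<theta> \<in> ch m \<kappa>" using common_child[OF \<rho> \<mu>(1) \<kappa> \<mu>(2)] by blast
      have 1: "content m \<theta> \<mu> = content (Suc m) \<kappa> \<rho>" by (rule content_swap[OF \<rho> \<mu>(1) \<kappa> \<mu>(2) t])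
      have 2: "content m \<theta> \<kappa> = content (Suc m) \<mu> \<rho>"
        by (rule content_swap[OF \<rho> \<kappa> \<mu>(1) _ t(2,1)]) (use \<mu> in auto)
      have "content (Suc m) \<mu> \<rho> \<noteq> content (Suc m) \<kappa> \<rho>" using content_inj[OF \<rho> \<mu>(1) \<kappa>] \<mu>(2) by blast
      then show ?thesis unfolding contents_child[OF kR t(2)] 2
        using IH2[OF mR t(1)] unfolding 1 by (intro addable_add_mset)
    next
      case False
      then have only: "ch (Suc m) \<rho> = {\<kappa>}" using \<kappa> by blast
      define \<tau> where "\<tau> = flip_eig (Suc m) \<kappa> \<rho>"
      have child: "\<exists>a\<in>{1, - 1}. content m \<theta> \<kappa> = (\<tau>, jm_eig (Suc m) \<kappa> \<rho> - 2 * a)" if t: "\<theta> \<in> ch m \<kappa>" for \<theta>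
      proof -
        have "swap_coeff m \<rho> \<kappa> \<kappa> \<theta> \<in> {1, - 1}"
          using only_child(1)[OF \<rho> only t] by (simp add: square_eq_1_iff)
        then show ?thesis using only_child(2,3)[OF \<rho> only t] by (intro bexI) (auto simp: content_def \<tau>_def)
      qed
      obtain \<theta> where t: "\<theta> \<in> ch m \<kappa>" using ch_nonempty[OF kR] by blast
      obtain a where a: "a \<in> {1, - 1}" "content m \<theta> \<kappa> = (\<tau>, jm_eig (Suc m) \<kappa> \<rho> - 2 * a)" using child[OF t] by blast
      obtain \<tau>' \<delta>' y' where d': "\<delta>' \<in> {1, - 1}" "content m \<theta> \<kappa> = signed_content \<tau>' \<delta>' y'"
        using IH2[OF kR t] unfolding addable_def by blast
      have jm': "jm_eig (Suc m) \<kappa> \<rho> = 2 * (\<delta>' * of_nat y' + a)"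
        using a(2) d'(2) by (simp add: signed_content_def algebra_simps)
      \<comment> \<open>The eigenvalue differs from 2 \<delta>' y' by 2 or -2. The step leads
        outwards if a = \<delta>' or if it starts on the main diagonal, and inwards
        otherwise.\<close>
      have "\<exists>\<delta>\<in>{1, - 1}. \<exists>y. jm_eig (Suc m) \<kappa> \<rho> = 2 * \<delta> * of_nat y"
      proof (cases "a = \<delta>' \<or> y' = 0")
        case True
        then have "jm_eig (Suc m) \<kappa> \<rho> = 2 * a * of_nat (Suc y')"
          unfolding jm' by (auto simp: algebra_simps of_nat_Suc)
        then show ?thesis using a(1) by blast
      next
        case False
        then obtain y'' where "y' = Suc y''" using not0_implies_Suc by blast
        moreover have "a = - \<delta>'" using False a(1) d'(1) by auto
        ultimately have "jm_eig (Suc m) \<kappa> \<rho> = 2 * \<delta>' * of_nat y''"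
          unfolding jm' by (simp add: algebra_simps of_nat_Suc)
        then show ?thesis using d'(1) by blast
      qed
      then obtain \<delta> y where d: "\<delta> \<in> {1, - 1}" and y: "jm_eig (Suc m) \<kappa> \<rho> = 2 * \<delta> * of_nat y" by blast
      have ck: "content (Suc m) \<kappa> \<rho> = signed_content \<tau> \<delta> y" by (simp add: content_def \<tau>_def signed_content_def y)
      have "count (contents (Suc m) \<kappa>) (content (Suc m) \<kappa> \<rho>) < count (contents (Suc m) \<kappa>) (signed_content \<tau> \<delta> z)"
        if yz: "y = Suc z" for z
      proof (cases "\<exists>\<eta>\<in>ch m \<kappa>. content m \<eta> \<kappa> = signed_content \<tau> \<delta> z")
        case True
        then obtain \<eta> where \<eta>: "\<eta> \<in> ch m \<kappa>" "content m \<eta> \<kappa> = signed_content \<tau> \<delta> z" by blast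
        have "count (contents m \<eta>) (signed_content \<tau> \<delta> y) \<le> count (contents m \<eta>) (signed_content \<tau> \<delta> z)"
          using IH1[OF ch_in_R[OF kR \<eta>(1)]] d unfolding well_stacked_def yz by blast
        moreover have "signed_content \<tau> \<delta> y \<noteq> signed_content \<tau> \<delta> z" unfolding yz by (simp add: signed_content_eq_iff[OF d d])
        ultimately show ?thesis unfolding contents_child[OF kR \<eta>(1)] ck \<eta>(2) by simp
      next
        case False
        \<comment> \<open>No child of \<open>\<kappa>\<close> sits on the inner neighbour, so all
          sit on the outer one, and \<open>content_inj\<close> leaves a single child. Then
          \<open>only_child_chain\<close> gives the eigenvalue -2 (m + 1) \<delta>, which has the
          wrong sign.\<close>
        have up: "content m \<eta> \<kappa> = (\<tau>, jm_eig (Suc m) \<kappa> \<rho> + 2 * \<delta>)" if e: "\<eta> \<in> ch m \<kappa>" for \<eta>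
        proof -
          obtain b where b: "b \<in> {1, - 1}" "content m \<eta> \<kappa> = (\<tau>, jm_eig (Suc m) \<kappa> \<rho> - 2 * b)" using child[OF e] by blast
          have "b \<noteq> \<delta>"
          proof
            assume "b = \<delta>"
            then have "content m \<eta> \<kappa> = signed_content \<tau> \<delta> z"
              using b(2) by (simp add: signed_content_def y yz algebra_simps of_nat_Suc)
            then show False using False e by blast
          qed
          then have "b = - \<delta>" using b(1) d by auto
          then show ?thesis using b(2) by simp
        qed
        have "\<eta> = \<theta>" if "\<eta> \<in> ch m \<kappa>" for \<eta>
          using content_inj[OF kR that t] up[OF that] up[OF t] by simp
        then have only': "ch m \<kappa> = {\<theta>}" using t by blast
        have "jm_eig (Suc m) \<kappa> \<rho> = jm_eig m \<theta> \<kappa> + - (2 * \<delta>)" using up[OF t] by (simp add: content_def)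
        then have "jm_eig (Suc m) \<kappa> \<rho> = of_nat (Suc m) * (- (2 * \<delta>))" by (rule only_child_chain[OF \<rho> only only'])
        then have "\<delta> * of_nat y = - (\<delta> * of_nat (Suc m))" unfolding y by (simp add: algebra_simps)
        then have "\<delta> * of_nat (y + Suc m) = 0" unfolding of_nat_add distrib_left by simp
        then have "(of_nat (y + Suc m) :: complex) = 0" using d by auto
        then show ?thesis unfolding of_nat_eq_0_iff by simp
      qed
      then show ?thesis unfolding addable_def using d ck by blast
    qed
  qed
qed

lemma contents_well_stacked: "\<kappa> \<in> R m \<Longrightarrow> well_stacked (contents m \<kappa>)"
  and content_addable: "\<rho> \<in> R (Suc m) \<Longrightarrow> \<kappa> \<in> ch m \<rho> \<Longrightarrow> addable (contents m \<kappa>) (content m \<kappa> \<rho>)"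
  using contents_well_stacked_addable by blast+

text \<open>Children correspond to removable boxes. In each half of each of the two diagrams, k
  removable boxes require k (k + 1) / 2 boxes altogether, and the total number of boxes is
  m.\<close>

lemma child_count_bound:
  assumes \<rho>: "\<rho> \<in> R m"
  shows "(child_count m \<rho>)\<^sup>2 + 4 * child_count m \<rho> \<le> 8 * m"
proof (cases m)
  case 0
  then show ?thesis by (simp add: child_count_def)
next
  case (Suc k)
  note \<rho>' = \<rho>[unfolded Suc]
  define Z where "Z = (\<lambda>\<kappa>. content k \<kappa> \<rho>) ` ch k \<rho>"
  define M where "M = contents (Suc k) \<rho>"
  define G :: "(complex \<times> complex) set" where "G = {1, - 1} \<times> {1, - 1}"
  \<comment> \<open>The pair g names a half diagram: \<open>fst g\<close> the diagram and
    \<open>snd g\<close> the direction. The main diagonal belongs to both directions and is assigned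
    to direction 1, so that every content is counted once.\<close>
  define Y where "Y g = {y. signed_content (fst g) (snd g) y \<in> Z \<and> (snd g = - 1 \<longrightarrow> y > 0)}" for g
  have finZ: "finite Z" using finite_ch[OF \<rho>'] by (simp add: Z_def)
  have G: "snd g \<in> {1, - 1}" if "g \<in> G" for g using that by (auto simp: G_def)
  have inj: "inj_on (\<lambda>(g, y). signed_content (fst g) (snd g) y) (Sigma G Y)"
  proof (rule inj_onI)
    fix p q assume p: "p \<in> Sigma G Y" and q: "q \<in> Sigma G Y"
      and pq: "(case p of (g, y) \<Rightarrow> signed_content (fst g) (snd g) y) = (case q of (g, y) \<Rightarrow> signed_content (fst g) (snd g) y)"
    obtain a b y c d z where e: "p = ((a, b), y)" "q = ((c, d), z)" by (metis prod.exhaust)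
    have g: "(a, b) \<in> G" "(c, d) \<in> G" and y: "y \<in> Y (a, b)" "z \<in> Y (c, d)"
      and eq: "signed_content (fst (a, b)) (snd (a, b)) y = signed_content (fst (c, d)) (snd (c, d)) z"
      using p q pq e by auto
    have bd: "b \<in> {1, - 1}" "d \<in> {1, - 1}" using g by (auto simp: G_def)
    have "a = c \<and> y = z \<and> (y = 0 \<or> b = d)" using eq unfolding fst_conv snd_conv signed_content_eq_iff[OF bd] .
    moreover have "b = d"
    proof (rule ccontr)
      assume ne: "b \<noteq> d"
      then have "y = 0" "z = 0" using calculation by auto
      moreover have "b = - 1 \<or> d = - 1" using bd ne by auto
      ultimately show False using y unfolding Y_def by auto
    qed
    ultimately show "p = q" using e by simp
  qed
  have img: "(\<lambda>(g, y). signed_content (fst g) (snd g) y) ` Sigma G Y = Z"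
  proof (intro subset_antisym subsetI)
    fix z assume "z \<in> Z"
    then obtain \<kappa> where \<kappa>: "\<kappa> \<in> ch k \<rho>" "z = content k \<kappa> \<rho>" by (auto simp: Z_def)
    obtain \<tau> \<delta> y where s: "\<delta> \<in> {1, - 1}" "z = signed_content \<tau> \<delta> y"
      using content_addable[OF \<rho>' \<kappa>(1)] \<kappa>(2) unfolding addable_def by blast
    have "\<tau> * \<tau> = 1" using flip_eig_square[OF \<rho>' \<kappa>(1)] s(2) \<kappa>(2) by (simp add: content_def signed_content_def)
    then have \<tau>: "\<tau> \<in> {1, - 1}" by (simp add: square_eq_1_iff)
    show "z \<in> (\<lambda>(g, y). signed_content (fst g) (snd g) y) ` Sigma G Y"
    proof (cases "\<delta> = - 1 \<and> y = 0")
      case True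
      then have "z = signed_content \<tau> 1 0" using s(2) by (simp add: signed_content_def)
      then show ?thesis using \<tau> \<open>z \<in> Z\<close> by (intro image_eqI[of _ _ "((\<tau>, 1), 0)"]) (auto simp: G_def Y_def)
    next
      case False
      then show ?thesis using \<tau> s \<open>z \<in> Z\<close> by (intro image_eqI[of _ _ "((\<tau>, \<delta>), y)"]) (auto simp: G_def Y_def)
    qed
  qed (auto simp: Y_def)
  have finY: "finite (Y g)" if "g \<in> G" for g
  proof -
    have "signed_content (fst g) (snd g) ` Y g \<subseteq> Z" by (auto simp: Y_def)
    then have "finite (signed_content (fst g) (snd g) ` Y g)" using finZ by (rule finite_subset)
    then show ?thesis
      by (rule finite_imageD) (auto simp: inj_on_def signed_content_eq_iff[OF G[OF that] G[OF that]])
  qed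
  have finG: "finite G" by (simp add: G_def)
  have "card (ch k \<rho>) = card Z"
    unfolding Z_def using content_inj[OF \<rho>'] by (intro card_image[symmetric] inj_onI) blast
  also have "\<dots> = card (Sigma G Y)" unfolding img[symmetric] by (rule card_image[OF inj])
  also have "\<dots> = (\<Sum>g\<in>G. card (Y g))" by (rule card_SigmaI) (use finG finY in auto)
  finally have c: "child_count m \<rho> = (\<Sum>g\<in>G. card (Y g))" by (simp add: child_count_def Suc)
  have "(\<Sum>g\<in>G. card (Y g) * (card (Y g) + 1)) \<le> (\<Sum>g\<in>G. 2 * (\<Sum>y\<in>Y g. count M (signed_content (fst g) (snd g) y)))"
  proof (rule sum_mono, rule antitone_drops)
    fix g y assume g: "g \<in> G"
    show "count M (signed_content (fst g) (snd g) (Suc y)) \<le> count M (signed_content (fst g) (snd g) y)"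
      using contents_well_stacked[OF \<rho>'] G[OF g] unfolding well_stacked_def M_def by blast
    \<comment> \<open>Without the box of the child \<open>\<kappa>\<close> the diagonals still
      decrease weakly; putting it back on diagonal y makes the drop after y strict.\<close>
    show "count M (signed_content (fst g) (snd g) (Suc y)) < count M (signed_content (fst g) (snd g) y)" if "y \<in> Y g"
    proof -
      obtain \<kappa> where \<kappa>: "\<kappa> \<in> ch k \<rho>" "signed_content (fst g) (snd g) y = content k \<kappa> \<rho>" using \<open>y \<in> Y g\<close> by (auto simp: Y_def Z_def)
      have "count (contents k \<kappa>) (signed_content (fst g) (snd g) (Suc y)) \<le> count (contents k \<kappa>) (signed_content (fst g) (snd g) y)"
        using contents_well_stacked[OF ch_in_R[OF \<rho>' \<kappa>(1)]] G[OF g] unfolding well_stacked_def by blast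
      moreover have "signed_content (fst g) (snd g) (Suc y) \<noteq> signed_content (fst g) (snd g) y"
        by (simp add: signed_content_eq_iff[OF G[OF g] G[OF g]])
      ultimately show ?thesis unfolding M_def contents_child[OF \<rho>' \<kappa>(1)] \<kappa>(2)[symmetric] by simp
    qed
  qed (rule finY)
  also have "\<dots> = 2 * (\<Sum>(g, y)\<in>Sigma G Y. count M (signed_content (fst g) (snd g) y))"
    using finG finY by (simp add: sum_distrib_left sum.Sigma case_prod_unfold)
  also have "(\<Sum>(g, y)\<in>Sigma G Y. count M (signed_content (fst g) (snd g) y)) = (\<Sum>z\<in>Z. count M z)"
    unfolding img[symmetric] sum.reindex[OF inj] by (simp add: case_prod_unfold comp_def)
  also have "(\<Sum>z\<in>Z. count M z) \<le> (\<Sum>z\<in>Z \<union> set_mset M. count M z)"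
    by (rule sum_mono2) (use finZ in auto)
  also have "\<dots> = size M" unfolding size_multiset_overloaded_eq by (rule sum.mono_neutral_right) (use finZ in \<open>auto simp: not_in_iff\<close>)
  also have "size M = m" unfolding M_def using size_contents[OF \<rho>'] Suc by simp
  finally have le: "(\<Sum>g\<in>G. card (Y g) * (card (Y g) + 1)) \<le> 2 * m" by simp
  \<comment> \<open>Cauchy-Schwarz for the four half diagrams: with counts k_g of sum c,
    \<open>le\<close> says that the sum of k_g^2 plus c is at most 2 m, hence c^2 <= 4 (2 m -
    c).\<close>
  have four: "(a + b + c + d)\<^sup>2 \<le> 4 * (a\<^sup>2 + b\<^sup>2 + c\<^sup>2 + d\<^sup>2)" for a b c d :: nat
  proof -
    have "0 \<le> (real a - b)\<^sup>2 + (real a - c)\<^sup>2 + (real a - d)\<^sup>2 + (real b - c)\<^sup>2 + (real b - d)\<^sup>2 + (real c - d)\<^sup>2"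
      by simp
    then have "(real a + b + c + d)\<^sup>2 \<le> 4 * ((real a)\<^sup>2 + (real b)\<^sup>2 + (real c)\<^sup>2 + (real d)\<^sup>2)"
      by (simp add: power2_eq_square algebra_simps)
    then have "real ((a + b + c + d)\<^sup>2) \<le> real (4 * (a\<^sup>2 + b\<^sup>2 + c\<^sup>2 + d\<^sup>2))" by simp
    then show ?thesis by (simp only: of_nat_le_iff)
  qed
  have G4: "(\<Sum>g\<in>G. F g) = F (1, 1) + F (1, - 1) + F (- 1, 1) + F (- 1, - 1)" for F :: "complex \<times> complex \<Rightarrow> nat"
    by (simp add: G_def sum.cartesian_product[of "\<lambda>a b. F (a, b)", simplified, symmetric])
  have "(child_count m \<rho>)\<^sup>2 \<le> 4 * (\<Sum>g\<in>G. (card (Y g))\<^sup>2)" unfolding c G4 by (rule four)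
  moreover have "(\<Sum>g\<in>G. card (Y g) * (card (Y g) + 1)) = (\<Sum>g\<in>G. (card (Y g))\<^sup>2) + child_count m \<rho>"
    unfolding c by (simp add: power2_eq_square sum.distrib)
  ultimately show ?thesis using le by linarith
qed

end

section \<open>Cost of linear forms\<close>

lemma run_append: "run inp vs (p @ q) = Option.bind (run inp vs p) (\<lambda>ws. run inp ws q)"
  by (induction inp vs p rule: run.induct) (auto intro!: bind_option_cong simp: Option.bind_assoc)

lemma run_length: "run inp vs p = Some ws \<Longrightarrow> length ws = length vs + length p"
  by (induction inp vs p arbitrary: ws rule: run.induct) (auto simp: bind_eq_Some_conv)

lemma operand_val_append: "operand_val inp vs x = Some c \<Longrightarrow> operand_val inp (vs @ ws) x = Some c"
  by (cases x) (auto simp: nth_append split: if_splits)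

text \<open>The operand is fixed before \<open>f\<close>, like \<open>out\<close> in
  \<open>computes_fourier\<close>. Membership of any form also asserts that the program succeeds for
  every \<open>f\<close>.\<close>

definition available :: "('g, 'b) monoid_scheme \<Rightarrow> 'g instr list \<Rightarrow> (('g \<Rightarrow> complex) \<Rightarrow> complex) set" where
  "available G p = {\<phi>. \<exists>x. \<forall>f. \<exists>vs. run ((Some \<circ> f) |` carrier G) [] p = Some vs \<and>
     operand_val ((Some \<circ> f) |` carrier G) vs x = Some (\<phi> f)}"

lemma const_available: "\<phi> \<in> available G p \<Longrightarrow> (\<lambda>_. c) \<in> available G p"
  unfolding available_def by (rule CollectI, rule exI[of _ "Const c"]) auto

lemma available_step:
  assumes \<phi>: "\<phi> \<in> available G p" and \<psi>: "\<psi> \<in> available G p" and c: "\<And>x y. arith_val c x y = Some (F x y)"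
  shows "\<exists>a b. insert (\<lambda>f. F (\<phi> f) (\<psi> f)) (available G p) \<subseteq> available G (p @ [(c, a, b)])"
proof -
  obtain a where a: "\<And>f. \<exists>vs. run ((Some \<circ> f) |` carrier G) [] p = Some vs \<and> operand_val ((Some \<circ> f) |` carrier G) vs a = Some (\<phi> f)"
    using \<phi> unfolding available_def by blast
  obtain b where b: "\<And>f. \<exists>vs. run ((Some \<circ> f) |` carrier G) [] p = Some vs \<and> operand_val ((Some \<circ> f) |` carrier G) vs b = Some (\<psi> f)"
    using \<psi> unfolding available_def by blast
  have step: "\<exists>vs. run ((Some \<circ> f) |` carrier G) [] p = Some vs \<and> length vs = length p \<and>
      run ((Some \<circ> f) |` carrier G) [] (p @ [(c, a, b)]) = Some (vs @ [F (\<phi> f) (\<psi> f)])" for f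
  proof -
    obtain vs where vs: "run ((Some \<circ> f) |` carrier G) [] p = Some vs"
      "operand_val ((Some \<circ> f) |` carrier G) vs a = Some (\<phi> f)" "operand_val ((Some \<circ> f) |` carrier G) vs b = Some (\<psi> f)"
      using a[of f] b[of f] by auto
    then show ?thesis using run_length[OF vs(1)] by (auto simp: run_append c)
  qed
  have "\<chi> \<in> available G (p @ [(c, a, b)])" if \<chi>: "\<chi> \<in> available G p" for \<chi>
  proof -
    obtain x where x: "\<And>f. \<exists>vs. run ((Some \<circ> f) |` carrier G) [] p = Some vs \<and> operand_val ((Some \<circ> f) |` carrier G) vs x = Some (\<chi> f)"
      using \<chi> unfolding available_def by blast
    have "\<exists>ws. run ((Some \<circ> f) |` carrier G) [] (p @ [(c, a, b)]) = Some ws \<and> operand_val ((Some \<circ> f) |` carrier G) ws x = Some (\<chi> f)" for f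
      using step[of f] x[of f] operand_val_append by fastforce
    then show ?thesis unfolding available_def by blast
  qed
  moreover have "(\<lambda>f. F (\<phi> f) (\<psi> f)) \<in> available G (p @ [(c, a, b)])"
  proof -
    have "\<exists>ws. run ((Some \<circ> f) |` carrier G) [] (p @ [(c, a, b)]) = Some ws \<and>
       operand_val ((Some \<circ> f) |` carrier G) ws (Result (length p)) = Some (F (\<phi> f) (\<psi> f))" for f
      using step[of f] by (auto simp: nth_append)
    then show ?thesis unfolding available_def by blast
  qed
  ultimately show ?thesis by blast
qed

text \<open>The zero form is demanded only to guarantee that \<open>p\<close> does not fail, so that all constants are available.\<close>

definition cost_at_most :: "('g, 'b) monoid_scheme \<Rightarrow> nat \<Rightarrow> (('g \<Rightarrow> complex) \<Rightarrow> complex) set \<Rightarrow>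
    (('g \<Rightarrow> complex) \<Rightarrow> complex) set \<Rightarrow> bool" where
  "cost_at_most G C S T \<longleftrightarrow> (\<forall>p. insert (\<lambda>_. 0) S \<subseteq> available G p \<longrightarrow>
     (\<exists>q. available G p \<union> T \<subseteq> available G q \<and> additions q \<le> additions p + C \<and>
       multiplications q \<le> multiplications p + C))"

lemma cost_at_most_subset: "T \<subseteq> insert (\<lambda>_. 0) S \<Longrightarrow> cost_at_most G C S T"
  unfolding cost_at_most_def by (intro allI impI) (rule exI, auto)

lemma cost_at_most_mono:
  assumes "cost_at_most G C S T" "S \<subseteq> S'" "T' \<subseteq> T" "C \<le> C'"
  shows "cost_at_most G C' S' T'"
  unfolding cost_at_most_def
proof (intro allI impI)
  fix p assume "insert (\<lambda>_. 0) S' \<subseteq> available G p"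
  then have "insert (\<lambda>_. 0) S \<subseteq> available G p" using assms(2) by blast
  then obtain q where "available G p \<union> T \<subseteq> available G q" "additions q \<le> additions p + C" "multiplications q \<le> multiplications p + C"
    using assms(1) unfolding cost_at_most_def by blast
  then show "\<exists>q. available G p \<union> T' \<subseteq> available G q \<and> additions q \<le> additions p + C' \<and> multiplications q \<le> multiplications p + C'"
    using assms(3,4) by (intro exI[of _ q]) auto
qed

lemma cost_at_most_trans:
  assumes "cost_at_most G C S T" "cost_at_most G D (S \<union> T) U"
  shows "cost_at_most G (C + D) S (T \<union> U)"
  unfolding cost_at_most_def
proof (intro allI impI)
  fix p assume p: "insert (\<lambda>_. 0) S \<subseteq> available G p"
  then obtain q where q: "available G p \<union> T \<subseteq> available G q" "additions q \<le> additions p + C" "multiplications q \<le> multiplications p + C"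
    using assms(1) unfolding cost_at_most_def by blast
  then have "insert (\<lambda>_. 0) (S \<union> T) \<subseteq> available G q" using p by blast
  then obtain r where "available G q \<union> U \<subseteq> available G r" "additions r \<le> additions q + D" "multiplications r \<le> multiplications q + D"
    using assms(2) unfolding cost_at_most_def by blast
  then show "\<exists>r. available G p \<union> (T \<union> U) \<subseteq> available G r \<and> additions r \<le> additions p + (C + D) \<and> multiplications r \<le> multiplications p + (C + D)"
    using q by (intro exI[of _ r]) auto
qed

lemma cost_at_most_UN:
  assumes "finite I" "\<And>i. i \<in> I \<Longrightarrow> cost_at_most G (C i) S (T i)"
  shows "cost_at_most G (\<Sum>i\<in>I. C i) S (\<Union>i\<in>I. T i)"
  using assms
proof (induction I rule: finite_induct)
  case empty
  then show ?case by (intro cost_at_most_subset) auto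
next
  case (insert i I)
  have "cost_at_most G (C i + (\<Sum>i\<in>I. C i)) S (T i \<union> (\<Union>i\<in>I. T i))"
  proof (rule cost_at_most_trans)
    show "cost_at_most G (\<Sum>i\<in>I. C i) (S \<union> T i) (\<Union>i\<in>I. T i)"
      by (rule cost_at_most_mono[OF insert.IH]) (use insert.prems in auto)
  qed (use insert.prems in auto)
  then show ?case using insert.hyps by simp
qed

text \<open>The unit of cost is a multiplication by a constant followed by an addition. It raises
  both counters by one, so one bound serves for additions and multiplications.\<close>

lemma cost_add_multiple:
  assumes "\<psi> \<in> insert (\<lambda>_. 0) S" "\<phi> \<in> insert (\<lambda>_. 0) S"
  shows "cost_at_most G 1 S {\<lambda>f. \<psi> f + a * \<phi> f}"
  unfolding cost_at_most_def
proof (intro allI impI)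
  fix p assume p: "insert (\<lambda>_. 0) S \<subseteq> available G p"
  then have "\<phi> \<in> available G p" "\<psi> \<in> available G p" using assms by auto
  obtain x y where q: "insert (\<lambda>f. a * \<phi> f) (available G p) \<subseteq> available G (p @ [(Mul, x, y)])"
    using available_step[OF const_available[OF \<open>\<phi> \<in> available G p\<close>] \<open>\<phi> \<in> available G p\<close>, of Mul "(*)" a] by auto
  then have "\<psi> \<in> available G (p @ [(Mul, x, y)])" "(\<lambda>f. a * \<phi> f) \<in> available G (p @ [(Mul, x, y)])"
    using \<open>\<psi> \<in> available G p\<close> by auto
  from available_step[OF this, of Add "(+)"] obtain z w
    where "insert (\<lambda>f. \<psi> f + a * \<phi> f) (available G (p @ [(Mul, x, y)])) \<subseteq> available G ((p @ [(Mul, x, y)]) @ [(Add, z, w)])" by auto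
  then show "\<exists>q. available G p \<union> {\<lambda>f. \<psi> f + a * \<phi> f} \<subseteq> available G q \<and> additions q \<le> additions p + 1 \<and> multiplications q \<le> multiplications p + 1"
    using q by (intro exI[of _ "(p @ [(Mul, x, y)]) @ [(Add, z, w)]"]) (auto simp: additions_def multiplications_def)
qed

text \<open>The leading form without coefficient is free; for \<open>induced\<close> it is the
  contribution of the coset with representative 1.\<close>

lemma cost_linear_combination:
  assumes "finite I" "\<phi>0 \<in> insert (\<lambda>_. 0) S" "\<And>i. i \<in> I \<Longrightarrow> \<phi> i \<in> S"
  shows "cost_at_most G (card I) S {\<lambda>f. \<phi>0 f + (\<Sum>i\<in>I. a i * \<phi> i f)}"
  using assms(1,3)
proof (induction I rule: finite_induct)
  case empty
  then show ?case using assms(2) by (intro cost_at_most_subset) auto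
next
  case (insert i I)
  let ?\<psi> = "\<lambda>f. \<phi>0 f + (\<Sum>i\<in>I. a i * \<phi> i f)"
  have c: "cost_at_most G (card I + 1) S ({?\<psi>} \<union> {\<lambda>f. ?\<psi> f + a i * \<phi> i f})"
    by (rule cost_at_most_trans[OF insert.IH cost_add_multiple]) (use insert.prems in auto)
  have "(\<lambda>f. ?\<psi> f + a i * \<phi> i f) = (\<lambda>f. \<phi>0 f + (\<Sum>i\<in>insert i I. a i * \<phi> i f))"
    using insert.hyps by (simp add: algebra_simps)
  then show ?case using cost_at_most_mono[OF c order_refl Un_upper2 order_refl] insert.hyps by simp
qed

lemma fourier_at_entry:
  assumes r: "rep G d \<rho>" and G: "group G" and fin: "finite (carrier G)" and ij: "i < d" "j < d"
  shows "fourier_at G f \<rho> $$ (i, j) = (\<Sum>s\<in>carrier G. f s * \<rho> s $$ (i, j))"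
proof -
  interpret group G by fact
  interpret M: ring "ring_mat TYPE(complex) d ()" by (rule ring_mat)
  have car: "\<rho> s \<in> carrier_mat d d" if "s \<in> carrier G" for s using repD(1)[OF r that] .
  have "finsum (ring_mat TYPE(complex) d ()) (\<lambda>s. f s \<cdot>\<^sub>m \<rho> s) A \<in> carrier_mat d d \<and>
      finsum (ring_mat TYPE(complex) d ()) (\<lambda>s. f s \<cdot>\<^sub>m \<rho> s) A $$ (i, j) = (\<Sum>s\<in>A. f s * \<rho> s $$ (i, j))"
    if "finite A" "A \<subseteq> carrier G" for A
    using that
  proof (induction A rule: finite_induct)
    case empty
    then show ?case using ij by (simp add: ring_mat_simps)
  next
    case (insert s A)
    have "finsum (ring_mat TYPE(complex) d ()) (\<lambda>s. f s \<cdot>\<^sub>m \<rho> s) (insert s A)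
       = f s \<cdot>\<^sub>m \<rho> s + finsum (ring_mat TYPE(complex) d ()) (\<lambda>s. f s \<cdot>\<^sub>m \<rho> s) A"
      using insert.hyps insert.prems car by (subst M.finsum_insert) (auto simp: ring_mat_simps)
    then show ?case using insert car[of s] ij by auto
  qed
  then show ?thesis using fin by (simp add: fourier_at_def repD(4)[OF r])
qed

section \<open>The recursive transform and its cost\<close>

context tower begin

text \<open>The \<open>\<rho>\<close>-component, in column \<open>\<kappa>\<close>, of the Fourier transform of a function on the cosets of \<open>B m\<close>
  with values \<open>v\<close> in the space of \<open>\<kappa>\<close>; the argument \<open>f\<close> lets \<open>v\<close> consist of forms.\<close>

definition induced :: "nat \<Rightarrow> B_rep \<Rightarrow> (int \<Rightarrow> nat \<Rightarrow> 'f \<Rightarrow> complex) \<Rightarrow>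
    B_rep \<Rightarrow> nat \<Rightarrow> 'f \<Rightarrow> complex" where
  "induced m \<kappa> v \<rho> x f = (\<Sum>j\<in>letters (Suc m). \<Sum>a<deg \<kappa>. \<rho> (coset_rep (Suc m) j) $$ (x, emb m \<rho> \<kappa> a) * v j a f)"

definition children :: "nat \<Rightarrow> B_rep \<Rightarrow> B_rep set" where
  "children m \<kappa> = (case m of 0 \<Rightarrow> {} | Suc k \<Rightarrow> ch k \<kappa>)"

lemma parentsD: "\<rho> \<in> parents m \<kappa> \<Longrightarrow> \<rho> \<in> R (Suc m)" "\<rho> \<in> parents m \<kappa> \<Longrightarrow> \<kappa> \<in> ch m \<rho>"
  by (auto simp: parents_def)

text \<open>The factor c acts inside the block \<open>\<mu>\<close>, and the swap is scalar on
  copies of \<open>\<theta>\<close>, so only the copy of \<open>\<theta>\<close> inside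
  \<open>\<mu>\<close>, if there is one, contributes.\<close>

lemma coset_swap_entry:
  assumes \<rho>: "\<rho> \<in> R (Suc (Suc k))" and \<kappa>: "\<kappa> \<in> ch (Suc k) \<rho>" "\<theta> \<in> ch k \<kappa>" "a < deg \<theta>"
    and \<mu>: "\<mu> \<in> ch (Suc k) \<rho>" "b < deg \<mu>" and c: "c \<in> carrier (B (Suc k))"
  shows "\<rho> (c \<circ> adjacent_swap (Suc k)) $$ (emb (Suc k) \<rho> \<mu> b, emb (Suc k) \<rho> \<kappa> (emb k \<kappa> \<theta> a))
    = (if \<theta> \<in> ch k \<mu> then swap_coeff k \<rho> \<mu> \<kappa> \<theta> * \<mu> c $$ (b, emb k \<mu> \<theta> a) else 0)"
proof -
  note kR = ch_in_R[OF \<rho> \<kappa>(1)] and mR = ch_in_R[OF \<rho> \<mu>(1)]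
  let ?s = "adjacent_swap (Suc k)" and ?q = "emb (Suc k) \<rho> \<kappa> (emb k \<kappa> \<theta> a)"
  have q: "?q < deg \<rho>" by (rule emb_lt[OF \<rho> \<kappa>(1) emb_lt[OF kR \<kappa>(2,3)]])
  have c': "c \<in> carrier (B (Suc (Suc k)))" using c carrier_B_mono[of "Suc k" "Suc (Suc k)"] by auto
  have s: "?s \<in> carrier (B (Suc (Suc k)))" by (rule adjacent_swap_in_B) auto
  have "\<rho> (c \<circ> ?s) $$ (emb (Suc k) \<rho> \<mu> b, ?q) = (\<Sum>z<deg \<rho>. \<rho> c $$ (emb (Suc k) \<rho> \<mu> b, z) * \<rho> ?s $$ (z, ?q))"
    by (rule comp_entry[OF \<rho> c' s emb_lt[OF \<rho> \<mu>] q])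
  also have "\<dots> = (\<Sum>y<deg \<mu>. \<mu> c $$ (b, y) * \<rho> ?s $$ (emb (Suc k) \<rho> \<mu> y, ?q))"
    by (rule embeddedD(2)[OF embedded_emb[OF \<rho> \<mu>(1)] c \<mu>(2)])
  also have "\<dots> = (\<Sum>\<theta>'\<in>ch k \<mu>. \<Sum>y<deg \<theta>'. if \<theta>' = \<theta> \<and> y = a then swap_coeff k \<rho> \<mu> \<kappa> \<theta> * \<mu> c $$ (b, emb k \<mu> \<theta> a) else 0)"
    unfolding sum_blocks[OF mR] by (intro sum.cong refl) (auto simp: swap_entry[OF \<rho> \<kappa> \<mu>(1)])
  also have "\<dots> = (\<Sum>\<theta>'\<in>ch k \<mu>. if \<theta>' = \<theta> then swap_coeff k \<rho> \<mu> \<kappa> \<theta> * \<mu> c $$ (b, emb k \<mu> \<theta> a) else 0)"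
    using \<kappa>(3) by (intro sum.cong refl) auto
  also have "\<dots> = (if \<theta> \<in> ch k \<mu> then swap_coeff k \<rho> \<mu> \<kappa> \<theta> * \<mu> c $$ (b, emb k \<mu> \<theta> a) else 0)"
    using finite_ch[OF mR] by simp
  finally show ?thesis .
qed

text \<open>The cosets labelled by the letters m + 1 and -(m + 1) contribute only to the block
  \<open>\<mu> = \<kappa>\<close>. For the others the representative ends in the swap, and the sum
  regroups into transforms one level lower. At m = 0 \<open>children\<close> is empty, so the
  truncated m - 1 does no harm.\<close>

lemma induced_recursion:
  assumes \<rho>: "\<rho> \<in> R (Suc m)" and \<kappa>: "\<kappa> \<in> ch m \<rho>" and \<mu>: "\<mu> \<in> ch m \<rho>" "b < deg \<mu>"
  shows "induced m \<kappa> v \<rho> (emb m \<rho> \<mu> b) f =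
     (if \<mu> = \<kappa> then v (int (Suc m)) b f + flip_eig m \<kappa> \<rho> * v (- int (Suc m)) b f else 0) +
     (\<Sum>\<theta>\<in>children m \<kappa> \<inter> children m \<mu>. swap_coeff (m - 1) \<rho> \<mu> \<kappa> \<theta> *
        induced (m - 1) \<theta> (\<lambda>j a. v j (emb (m - 1) \<kappa> \<theta> a)) \<mu> b f)"
proof -
  let ?x = "emb m \<rho> \<mu> b"
  have x: "?x < deg \<rho>" by (rule emb_lt[OF \<rho> \<mu>])
  have new: "int (Suc m) \<notin> insert (- int (Suc m)) (letters m)" "- int (Suc m) \<notin> letters m"
    by (auto simp: letters_def)
  have "induced m \<kappa> v \<rho> ?x f = (\<Sum>a<deg \<kappa>. \<rho> id $$ (?x, emb m \<rho> \<kappa> a) * v (int (Suc m)) a f)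
     + ((\<Sum>a<deg \<kappa>. \<rho> (last_flip (Suc m)) $$ (?x, emb m \<rho> \<kappa> a) * v (- int (Suc m)) a f)
     + (\<Sum>j\<in>letters m. \<Sum>a<deg \<kappa>. \<rho> (coset_rep (Suc m) j) $$ (?x, emb m \<rho> \<kappa> a) * v j a f))"
    using new unfolding induced_def letters_Suc by simp
  also have "(\<Sum>a<deg \<kappa>. \<rho> id $$ (?x, emb m \<rho> \<kappa> a) * v (int (Suc m)) a f)
     = (\<Sum>a<deg \<kappa>. if a = b then (if \<mu> = \<kappa> then v (int (Suc m)) b f else 0) else 0)"
    using emb_eq_iff[OF \<rho> \<mu> \<kappa>] emb_lt[OF \<rho> \<kappa>] by (intro sum.cong refl) (auto simp: R_id_entry[OF \<rho> x])
  also have "\<dots> = (if \<mu> = \<kappa> then v (int (Suc m)) b f else 0)" using \<mu>(2) by (cases "\<mu> = \<kappa>") auto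
  also have "(\<Sum>a<deg \<kappa>. \<rho> (last_flip (Suc m)) $$ (?x, emb m \<rho> \<kappa> a) * v (- int (Suc m)) a f)
     = (\<Sum>a<deg \<kappa>. if a = b then (if \<mu> = \<kappa> then flip_eig m \<kappa> \<rho> * v (- int (Suc m)) b f else 0) else 0)"
    by (intro sum.cong refl) (auto simp: flip_entry[OF \<rho> \<kappa> _ \<mu>])
  also have "\<dots> = (if \<mu> = \<kappa> then flip_eig m \<kappa> \<rho> * v (- int (Suc m)) b f else 0)" using \<mu>(2) by (cases "\<mu> = \<kappa>") auto
  also have "(\<Sum>j\<in>letters m. \<Sum>a<deg \<kappa>. \<rho> (coset_rep (Suc m) j) $$ (?x, emb m \<rho> \<kappa> a) * v j a f)
     = (\<Sum>\<theta>\<in>children m \<kappa> \<inter> children m \<mu>. swap_coeff (m - 1) \<rho> \<mu> \<kappa> \<theta> *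
        induced (m - 1) \<theta> (\<lambda>j a. v j (emb (m - 1) \<kappa> \<theta> a)) \<mu> b f)"
  proof (cases m)
    case 0
    then show ?thesis by (simp add: children_def)
  next
    case (Suc k)
    note \<rho>' = \<rho>[unfolded Suc] and \<kappa>' = \<kappa>[unfolded Suc] and \<mu>' = \<mu>[unfolded Suc]
    note kR = ch_in_R[OF \<rho>' \<kappa>']
    have cr: "coset_rep (Suc m) j = coset_rep m j \<circ> adjacent_swap m" if "j \<in> letters m" for j
      using that by (auto simp: letters_def)
    have "(\<Sum>j\<in>letters m. \<Sum>a<deg \<kappa>. \<rho> (coset_rep (Suc m) j) $$ (?x, emb m \<rho> \<kappa> a) * v j a f)
      = (\<Sum>j\<in>letters (Suc k). \<Sum>\<theta>\<in>ch k \<kappa>. \<Sum>a<deg \<theta>. (if \<theta> \<in> ch k \<mu>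
          then swap_coeff k \<rho> \<mu> \<kappa> \<theta> * \<mu> (coset_rep (Suc k) j) $$ (b, emb k \<mu> \<theta> a) else 0) * v j (emb k \<kappa> \<theta> a) f)"
    proof (rule sum.cong)
      fix j assume j: "j \<in> letters (Suc k)"
      have c: "coset_rep (Suc k) j \<in> carrier (B (Suc k))" by (rule coset_rep(1)[OF j])
      show "(\<Sum>a<deg \<kappa>. \<rho> (coset_rep (Suc m) j) $$ (?x, emb m \<rho> \<kappa> a) * v j a f)
        = (\<Sum>\<theta>\<in>ch k \<kappa>. \<Sum>a<deg \<theta>. (if \<theta> \<in> ch k \<mu>
          then swap_coeff k \<rho> \<mu> \<kappa> \<theta> * \<mu> (coset_rep (Suc k) j) $$ (b, emb k \<mu> \<theta> a) else 0) * v j (emb k \<kappa> \<theta> a) f)"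
        unfolding sum_blocks[OF kR] cr[unfolded Suc, OF j] Suc
        by (intro sum.cong refl) (simp add: coset_swap_entry[OF \<rho>' \<kappa>' _ _ \<mu>' c] del: coset_rep.simps)
    qed (simp add: Suc)
    also have "\<dots> = (\<Sum>\<theta>\<in>ch k \<kappa>. \<Sum>j\<in>letters (Suc k). \<Sum>a<deg \<theta>. (if \<theta> \<in> ch k \<mu>
          then swap_coeff k \<rho> \<mu> \<kappa> \<theta> * \<mu> (coset_rep (Suc k) j) $$ (b, emb k \<mu> \<theta> a) else 0) * v j (emb k \<kappa> \<theta> a) f)"
      by (rule sum.swap)
    also have "\<dots> = (\<Sum>\<theta>\<in>ch k \<kappa>. if \<theta> \<in> ch k \<mu> then swap_coeff k \<rho> \<mu> \<kappa> \<theta> * induced k \<theta> (\<lambda>j a. v j (emb k \<kappa> \<theta> a)) \<mu> b f else 0)"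
      unfolding induced_def by (intro sum.cong refl) (simp add: sum_distrib_left mult.assoc del: coset_rep.simps)
    also have "\<dots> = (\<Sum>\<theta>\<in>ch k \<kappa> \<inter> ch k \<mu>. swap_coeff k \<rho> \<mu> \<kappa> \<theta> * induced k \<theta> (\<lambda>j a. v j (emb k \<kappa> \<theta> a)) \<mu> b f)"
      by (rule sum.inter_restrict[OF finite_ch[OF kR], symmetric])
    finally show ?thesis by (simp add: Suc children_def)
  qed
  finally show ?thesis by simp
qed

lemma finite_children: "\<kappa> \<in> R m \<Longrightarrow> finite (children m \<kappa>)"
  by (cases m) (auto simp: children_def finite_ch)

lemma card_children: "card (children m \<kappa>) = child_count m \<kappa>"
  by (cases m) (auto simp: children_def child_count_def)

lemma card_children_inter_le:
  assumes "\<kappa> \<in> R m" "\<mu> \<in> R m" "\<kappa> \<noteq> \<mu>"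
  shows "card (children m \<kappa> \<inter> children m \<mu>) \<le> 1"
  using assms common_children_le_1 by (cases m) (auto simp: children_def)

text \<open>The lower transforms are taken as given. A coordinate in the block \<open>\<mu>\<close>
  costs one operation per summand of \<open>induced_recursion\<close> other than the free one; the
  three counting bounds on the parents and children of \<open>\<kappa>\<close> then control the
  total.\<close>

lemma induced_cost_step:
  assumes \<kappa>: "\<kappa> \<in> R m"
  shows "cost_at_most G ((10 * m + 2) * deg \<kappa>)
     ({v j a | j a. j \<in> letters (Suc m) \<and> a < deg \<kappa>} \<union>
      {induced (m - 1) \<theta> (\<lambda>j a. v j (emb (m - 1) \<kappa> \<theta> a)) \<mu> b | \<theta> \<mu> b.
         \<theta> \<in> children m \<kappa> \<and> \<mu> \<in> parents (m - 1) \<theta> \<and> b < deg \<mu>})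
     {induced m \<kappa> v \<rho> x | \<rho> x. \<rho> \<in> parents m \<kappa> \<and> x < deg \<rho>}"
    (is "cost_at_most G _ (?S \<union> ?T) ?U")
proof -
  let ?c = "child_count m \<kappa>"
  define I where "I = (SIGMA \<rho>:parents m \<kappa>. SIGMA \<mu>:ch m \<rho>. {..<deg \<mu>})"
  define C where "C z = (case z of (\<rho>, \<mu>, b) \<Rightarrow> if \<mu> = \<kappa> then 1 + ?c else 1)" for z :: "B_rep \<times> B_rep \<times> nat"
  define V where "V z = (case z of (\<rho>, \<mu>, b) \<Rightarrow> {induced m \<kappa> v \<rho> (emb m \<rho> \<mu> b)})" for z
  have fin: "finite I" unfolding I_def using finite_parents parentsD finite_ch by (intro finite_SigmaI) blast+
  have "cost_at_most G (\<Sum>z\<in>I. C z) (?S \<union> ?T) (\<Union>z\<in>I. V z)"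
  proof (rule cost_at_most_UN[OF fin])
    fix z assume "z \<in> I"
    then obtain \<rho> \<mu> b where z: "z = (\<rho>, \<mu>, b)" and \<rho>: "\<rho> \<in> parents m \<kappa>" and \<mu>: "\<mu> \<in> ch m \<rho>" "b < deg \<mu>"
      by (auto simp: I_def)
    note \<rho>R = parentsD[OF \<rho>]
    note mR = ch_in_R[OF \<rho>R(1) \<mu>(1)]
    \<comment> \<open>\<open>None\<close> stands for the sign change term, which is present only for
      \<open>\<mu> = \<kappa>\<close>, and \<open>Some \<theta>\<close> for the recursive term of a
      common child.\<close>
    define K where "K = (if \<mu> = \<kappa> then {None} else {}) \<union> Some ` (children m \<kappa> \<inter> children m \<mu>)"
    define c where "c i = (case i of None \<Rightarrow> flip_eig m \<kappa> \<rho> | Some \<theta> \<Rightarrow> swap_coeff (m - 1) \<rho> \<mu> \<kappa> \<theta>)" for i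
    define \<phi> where "\<phi> i = (case i of None \<Rightarrow> v (- int (Suc m)) b
      | Some \<theta> \<Rightarrow> induced (m - 1) \<theta> (\<lambda>j a. v j (emb (m - 1) \<kappa> \<theta> a)) \<mu> b)" for i
    define \<phi>0 where "\<phi>0 = (if \<mu> = \<kappa> then v (int (Suc m)) b else (\<lambda>_. 0))"
    have finK: "finite K" using finite_children[OF \<kappa>] by (auto simp: K_def)
    have c: "cost_at_most G (card K) (?S \<union> ?T) {\<lambda>f. \<phi>0 f + (\<Sum>i\<in>K. c i * \<phi> i f)}"
    proof (rule cost_linear_combination[OF finK])
      have S: "v (int (Suc m)) b \<in> ?S" "v (- int (Suc m)) b \<in> ?S" if "\<mu> = \<kappa>"
        using that \<mu>(2) by (force simp: letters_Suc)+
      then show "\<phi>0 \<in> insert (\<lambda>_. 0) (?S \<union> ?T)" by (auto simp: \<phi>0_def)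
      fix i assume i: "i \<in> K"
      show "\<phi> i \<in> ?S \<union> ?T"
      proof (cases i)
        case None
        then have "\<mu> = \<kappa>" using i by (auto simp: K_def split: if_splits)
        then show ?thesis using None S(2) by (auto simp: \<phi>_def)
      next
        case (Some \<theta>)
        then have t: "\<theta> \<in> children m \<kappa>" "\<theta> \<in> children m \<mu>" using i by (auto simp: K_def split: if_splits)
        then have "\<mu> \<in> parents (m - 1) \<theta>" using mR by (cases m) (auto simp: children_def parents_def)
        then show ?thesis using t(1) \<mu>(2) Some by (auto simp: \<phi>_def)
      qed
    qed
    have le: "card K \<le> C z"
    proof (cases "\<mu> = \<kappa>")
      case True
      have "card K = Suc (card (children m \<kappa>))"
        using finite_children[OF \<kappa>] by (simp add: K_def True card_image)
      then show ?thesis by (simp add: C_def z True card_children)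
    next
      case False
      then have "card K = card (children m \<kappa> \<inter> children m \<mu>)" by (simp add: K_def card_image)
      then show ?thesis using card_children_inter_le[OF \<kappa> mR] False by (simp add: C_def z)
    qed
    have eq: "(\<lambda>f. \<phi>0 f + (\<Sum>i\<in>K. c i * \<phi> i f)) = induced m \<kappa> v \<rho> (emb m \<rho> \<mu> b)"
    proof
      fix f
      have "(\<Sum>i\<in>K. c i * \<phi> i f) = (\<Sum>i\<in>(if \<mu> = \<kappa> then {None} else {}). c i * \<phi> i f)
          + (\<Sum>i\<in>Some ` (children m \<kappa> \<inter> children m \<mu>). c i * \<phi> i f)"
        unfolding K_def using finite_children[OF \<kappa>] by (intro sum.union_disjoint) auto
      also have "(\<Sum>i\<in>Some ` (children m \<kappa> \<inter> children m \<mu>). c i * \<phi> i f)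
          = (\<Sum>\<theta>\<in>children m \<kappa> \<inter> children m \<mu>. c (Some \<theta>) * \<phi> (Some \<theta>) f)"
        by (subst sum.reindex) (auto simp: comp_apply)
      finally show "\<phi>0 f + (\<Sum>i\<in>K. c i * \<phi> i f) = induced m \<kappa> v \<rho> (emb m \<rho> \<mu> b) f"
        unfolding induced_recursion[OF \<rho>R \<mu>] by (auto simp: \<phi>0_def c_def \<phi>_def)
    qed
    show "cost_at_most G (C z) (?S \<union> ?T) (V z)"
      by (rule cost_at_most_mono[OF c[unfolded eq] order_refl _ le]) (simp add: V_def z)
  qed
  then show ?thesis
  proof (rule cost_at_most_mono)
    show "?U \<subseteq> (\<Union>z\<in>I. V z)"
    proof safe
      fix \<rho> x assume \<rho>: "\<rho> \<in> parents m \<kappa>" and x: "x < deg \<rho>"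
      obtain \<mu> b where "\<mu> \<in> ch m \<rho>" "b < deg \<mu>" "x = emb m \<rho> \<mu> b"
        by (rule emb_cases[OF parentsD(1)[OF \<rho>] x])
      then have "(\<rho>, \<mu>, b) \<in> I" "induced m \<kappa> v \<rho> x \<in> V (\<rho>, \<mu>, b)" using \<rho> by (auto simp: I_def V_def)
      then show "induced m \<kappa> v \<rho> x \<in> (\<Union>z\<in>I. V z)" by blast
    qed
    show "(\<Sum>z\<in>I. C z) \<le> (10 * m + 2) * deg \<kappa>"
    proof -
      have inner: "(\<Sum>\<mu>\<in>ch m \<rho>. \<Sum>b<deg \<mu>. C (\<rho>, \<mu>, b)) = deg \<rho> + ?c * deg \<kappa>" if \<rho>: "\<rho> \<in> parents m \<kappa>" for \<rho>
      proof -
        have "(\<Sum>\<mu>\<in>ch m \<rho>. \<Sum>b<deg \<mu>. C (\<rho>, \<mu>, b)) = (\<Sum>\<mu>\<in>ch m \<rho>. deg \<mu> + (if \<mu> = \<kappa> then ?c * deg \<kappa> else 0))"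
          by (intro sum.cong refl) (simp add: C_def algebra_simps id_apply)
        also have "\<dots> = deg \<rho> + ?c * deg \<kappa>"
          using finite_ch[OF parentsD(1)[OF \<rho>]] parentsD(2)[OF \<rho>] sum_deg_ch[OF parentsD(1)[OF \<rho>]] by (simp add: sum.distrib)
        finally show ?thesis .
      qed
      have "(\<Sum>z\<in>I. C z) = (\<Sum>\<rho>\<in>parents m \<kappa>. \<Sum>\<mu>\<in>ch m \<rho>. \<Sum>b<deg \<mu>. C (\<rho>, \<mu>, b))"
      proof -
        have "(\<Sum>z\<in>I. C z) = (\<Sum>\<rho>\<in>parents m \<kappa>. \<Sum>y\<in>(SIGMA \<mu>:ch m \<rho>. {..<deg \<mu>}). C (\<rho>, y))"
          unfolding I_def using finite_parents finite_ch parentsD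
          by (subst sum.Sigma) (auto simp: case_prod_unfold)
        also have "\<dots> = (\<Sum>\<rho>\<in>parents m \<kappa>. \<Sum>\<mu>\<in>ch m \<rho>. \<Sum>b<deg \<mu>. C (\<rho>, \<mu>, b))"
          using finite_ch parentsD by (intro sum.cong refl, subst sum.Sigma) (auto simp: case_prod_unfold)
        finally show ?thesis .
      qed
      also have "\<dots> = (\<Sum>\<rho>\<in>parents m \<kappa>. deg \<rho>) + card (parents m \<kappa>) * (?c * deg \<kappa>)"
        by (simp add: inner sum.distrib id_apply)
      \<comment> \<open>The sum of the degrees of the parents is bounded by
        \<open>sum_deg_parents_le\<close>, their number by \<open>card_parents_le\<close>; what
        remains, c^2 + 2 c, is at most 8 m by \<open>child_count_bound\<close>.\<close>
      also have "\<dots> \<le> 2 * Suc m * deg \<kappa> + (?c + 2) * (?c * deg \<kappa>)"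
        by (intro add_mono mult_right_mono sum_deg_parents_le[OF \<kappa>] card_parents_le[OF \<kappa>]) auto
      also have "\<dots> = (2 * Suc m + (?c\<^sup>2 + 2 * ?c)) * deg \<kappa>" by (simp add: power2_eq_square algebra_simps)
      also have "\<dots> \<le> (10 * m + 2) * deg \<kappa>"
        using child_count_bound[OF \<kappa>] by (intro mult_right_mono) auto
      finally show ?thesis .
    qed
  qed simp
qed

text \<open>The degrees of the children add up to \<open>deg \<kappa>\<close>, so passing to lower
  levels keeps this factor, and the level costs 10 k + 2 simply add up.\<close>

lemma induced_cost:
  assumes "\<kappa> \<in> R m"
  shows "cost_at_most G (Suc m * (5 * m + 2) * deg \<kappa>) {v j a | j a. j \<in> letters (Suc m) \<and> a < deg \<kappa>}
     {induced m \<kappa> v \<rho> x | \<rho> x. \<rho> \<in> parents m \<kappa> \<and> x < deg \<rho>}"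
  using assms
proof (induction m arbitrary: \<kappa> v)
  case 0
  show ?case using induced_cost_step[OF 0, of G v] by (simp add: children_def)
next
  case (Suc k)
  note kR = Suc.prems
  let ?S = "{v j a | j a. j \<in> letters (Suc (Suc k)) \<and> a < deg \<kappa>}"
  let ?v = "\<lambda>\<theta> j a. v j (emb k \<kappa> \<theta> a)"
  let ?T = "\<lambda>\<theta>. {induced k \<theta> (?v \<theta>) \<mu> b | \<mu> b. \<mu> \<in> parents k \<theta> \<and> b < deg \<mu>}"
  have 1: "cost_at_most G (\<Sum>\<theta>\<in>ch k \<kappa>. Suc k * (5 * k + 2) * deg \<theta>) ?S (\<Union>\<theta>\<in>ch k \<kappa>. ?T \<theta>)"
  proof (rule cost_at_most_UN[OF finite_ch[OF kR]])
    fix \<theta> assume t: "\<theta> \<in> ch k \<kappa>"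
    have "{?v \<theta> j a | j a. j \<in> letters (Suc k) \<and> a < deg \<theta>} \<subseteq> ?S"
      using emb_lt[OF kR t] by (auto simp: letters_Suc)
    then show "cost_at_most G (Suc k * (5 * k + 2) * deg \<theta>) ?S (?T \<theta>)"
      by (intro cost_at_most_mono[OF Suc.IH[OF ch_in_R[OF kR t], of "?v \<theta>"]]) auto
  qed
  have "{induced (Suc k - 1) \<theta> (\<lambda>j a. v j (emb (Suc k - 1) \<kappa> \<theta> a)) \<mu> b | \<theta> \<mu> b.
         \<theta> \<in> children (Suc k) \<kappa> \<and> \<mu> \<in> parents (Suc k - 1) \<theta> \<and> b < deg \<mu>} = (\<Union>\<theta>\<in>ch k \<kappa>. ?T \<theta>)"
    by (auto simp: children_def)
  from cost_at_most_trans[OF 1 induced_cost_step[OF kR, of G v, unfolded this]]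
  show ?case
  proof (rule cost_at_most_mono)
    have "(\<Sum>\<theta>\<in>ch k \<kappa>. Suc k * (5 * k + 2) * deg \<theta>) = Suc k * (5 * k + 2) * deg \<kappa>"
      by (simp only: sum_distrib_left[symmetric] sum_deg_ch[OF kR])
    then show "(\<Sum>\<theta>\<in>ch k \<kappa>. Suc k * (5 * k + 2) * deg \<theta>) + (10 * Suc k + 2) * deg \<kappa> \<le> Suc (Suc k) * (5 * Suc k + 2) * deg \<kappa>"
      by (simp add: algebra_simps)
  qed auto
qed

text \<open>An entry of the transform at \<open>\<kappa>\<close> of the function h |-> f (g h) on
  \<open>B m\<close>, as a linear form in f. For g = \<open>id\<close> and the full group it is the
  required output.\<close>

definition coset_fourier :: "nat \<Rightarrow> (int \<Rightarrow> int) \<Rightarrow> B_rep \<Rightarrow> nat \<Rightarrow> nat \<Rightarrow> ((int \<Rightarrow> int) \<Rightarrow> complex) \<Rightarrow> complex" where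
  "coset_fourier m g \<kappa> i j f = (\<Sum>h\<in>carrier (B m). f (g \<circ> h) * \<kappa> h $$ (i, j))"

text \<open>In the column \<open>emb m \<rho> \<kappa> b\<close> an element h of \<open>B m\<close>
  acts through \<open>\<kappa>\<close> alone. Each column b thus has its own instance of
  \<open>induced\<close>, fed with column b of the transforms on the cosets.\<close>

lemma coset_fourier_Suc:
  assumes \<rho>: "\<rho> \<in> R (Suc m)" and \<kappa>: "\<kappa> \<in> ch m \<rho>" "b < deg \<kappa>" and x: "x < deg \<rho>"
  shows "coset_fourier (Suc m) g \<rho> x (emb m \<rho> \<kappa> b)
     = induced m \<kappa> (\<lambda>j a. coset_fourier m (g \<circ> coset_rep (Suc m) j) \<kappa> a b) \<rho> x"
proof
  fix f
  have "coset_fourier (Suc m) g \<rho> x (emb m \<rho> \<kappa> b) f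
     = (\<Sum>j\<in>letters (Suc m). \<Sum>h\<in>carrier (B m). f (g \<circ> (coset_rep (Suc m) j \<circ> h)) * \<rho> (coset_rep (Suc m) j \<circ> h) $$ (x, emb m \<rho> \<kappa> b))"
    unfolding coset_fourier_def by (rule sum_cosets)
  also have "\<dots> = (\<Sum>j\<in>letters (Suc m). \<Sum>h\<in>carrier (B m). \<Sum>a<deg \<kappa>.
      \<rho> (coset_rep (Suc m) j) $$ (x, emb m \<rho> \<kappa> a) * (f (g \<circ> coset_rep (Suc m) j \<circ> h) * \<kappa> h $$ (a, b)))"
  proof (intro sum.cong refl)
    fix j h assume j: "j \<in> letters (Suc m)" and h: "h \<in> carrier (B m)"
    have h': "h \<in> carrier (B (Suc m))" using h carrier_B_mono[of m "Suc m"] by auto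
    have "\<rho> (coset_rep (Suc m) j \<circ> h) $$ (x, emb m \<rho> \<kappa> b)
        = (\<Sum>z<deg \<rho>. \<rho> (coset_rep (Suc m) j) $$ (x, z) * \<rho> h $$ (z, emb m \<rho> \<kappa> b))"
      by (rule comp_entry[OF \<rho> coset_rep(1)[OF j] h' x emb_lt[OF \<rho> \<kappa>]])
    also have "\<dots> = (\<Sum>a<deg \<kappa>. \<rho> (coset_rep (Suc m) j) $$ (x, emb m \<rho> \<kappa> a) * \<kappa> h $$ (a, b))"
      by (rule embeddedD(3)[OF embedded_emb[OF \<rho> \<kappa>(1)] h \<kappa>(2)])
    finally show "f (g \<circ> (coset_rep (Suc m) j \<circ> h)) * \<rho> (coset_rep (Suc m) j \<circ> h) $$ (x, emb m \<rho> \<kappa> b)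
      = (\<Sum>a<deg \<kappa>. \<rho> (coset_rep (Suc m) j) $$ (x, emb m \<rho> \<kappa> a) * (f (g \<circ> coset_rep (Suc m) j \<circ> h) * \<kappa> h $$ (a, b)))"
      by (simp add: sum_distrib_left mult_ac comp_assoc del: coset_rep.simps)
  qed
  also have "\<dots> = (\<Sum>j\<in>letters (Suc m). \<Sum>a<deg \<kappa>. \<Sum>h\<in>carrier (B m).
      \<rho> (coset_rep (Suc m) j) $$ (x, emb m \<rho> \<kappa> a) * (f (g \<circ> coset_rep (Suc m) j \<circ> h) * \<kappa> h $$ (a, b)))"
    by (intro sum.cong[OF refl] sum.swap)
  also have "\<dots> = induced m \<kappa> (\<lambda>j a. coset_fourier m (g \<circ> coset_rep (Suc m) j) \<kappa> a b) \<rho> x f"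
    unfolding induced_def coset_fourier_def sum_distrib_left ..
  finally show "coset_fourier (Suc m) g \<rho> x (emb m \<rho> \<kappa> b) f
    = induced m \<kappa> (\<lambda>j a. coset_fourier m (g \<circ> coset_rep (Suc m) j) \<kappa> a b) \<rho> x f" .
qed

text \<open>Arbitrary g is allowed because the induction calls the lower level on all cosets g c.
  The inputs are always values of f on the large group \<open>B n\<close>.\<close>

lemma coset_fourier_cost:
  assumes "m \<le> n" "g \<in> carrier (B n)"
  shows "cost_at_most (B n) (m * (2 * m - 1) * Coset.order (B m)) {\<lambda>f. f w | w. w \<in> carrier (B n)}
     {coset_fourier m g \<kappa> i j | \<kappa> i j. \<kappa> \<in> R m \<and> i < deg \<kappa> \<and> j < deg \<kappa>}"
  using assms
proof (induction m arbitrary: g)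
  case 0
  \<comment> \<open>Every member of \<open>R 0\<close> has degree 1, since its square is at most |B
    0| = 1; the transform on the trivial group is the input itself and costs nothing.\<close>
  have "coset_fourier 0 g \<kappa> i j = (\<lambda>f. f g)" if \<kappa>: "\<kappa> \<in> R 0" "i < deg \<kappa>" "j < deg \<kappa>" for \<kappa> i j
  proof -
    have "(\<Sum>\<rho>\<in>{\<kappa>}. (rep_degree (B 0) \<rho>)\<^sup>2) \<le> card (carrier (B 0))"
      by (rule finite_group_irreps.sum_degree_squares_le[OF irreps]) (use \<kappa> in auto)
    then have "(deg \<kappa>)\<^sup>2 \<le> 1" by (simp add: carrier_B_0)
    then have "deg \<kappa> \<le> 1" using power_le_one_iff[of "deg \<kappa>" 2] by (simp add: power2_eq_square)
    then have "i = j" using \<kappa> by simp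
    then show ?thesis
      using R_id_entry[OF \<kappa>] by (auto simp: coset_fourier_def carrier_B_0)
  qed
  then show ?case using 0 by (intro cost_at_most_subset) auto
next
  case (Suc m)
  let ?I = "{\<lambda>f. f w | w. w \<in> carrier (B n)}"
  let ?g = "\<lambda>j. g \<circ> coset_rep (Suc m) j"
  let ?T = "\<lambda>j. {coset_fourier m (?g j) \<kappa> i l | \<kappa> i l. \<kappa> \<in> R m \<and> i < deg \<kappa> \<and> l < deg \<kappa>}"
  let ?U = "\<lambda>(\<kappa>, b). {induced m \<kappa> (\<lambda>j a. coset_fourier m (?g j) \<kappa> a b) \<rho> x | \<rho> x. \<rho> \<in> parents m \<kappa> \<and> x < deg \<rho>}"
  let ?J = "SIGMA \<kappa>:R m. {..<deg \<kappa>}"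
  have g: "?g j \<in> carrier (B n)" if "j \<in> letters (Suc m)" for j
    using coset_rep(1)[OF that] carrier_B_mono[OF Suc.prems(1)] B_comp[OF Suc.prems(2)] by blast
  have 1: "cost_at_most (B n) (\<Sum>j\<in>letters (Suc m). m * (2 * m - 1) * Coset.order (B m)) ?I (\<Union>j\<in>letters (Suc m). ?T j)"
    by (rule cost_at_most_UN[OF finite_letters]) (use Suc.IH[OF _ g] Suc.prems(1) in auto)
  have 2: "cost_at_most (B n) (\<Sum>z\<in>?J. Suc m * (5 * m + 2) * deg (fst z)) (?I \<union> (\<Union>j\<in>letters (Suc m). ?T j)) (\<Union>z\<in>?J. ?U z)"
  proof (rule cost_at_most_UN)
    show "finite ?J" using finite_R by auto
    fix z assume "z \<in> ?J"
    then obtain \<kappa> b where z: "z = (\<kappa>, b)" "\<kappa> \<in> R m" "b < deg \<kappa>" by auto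
    show "cost_at_most (B n) (Suc m * (5 * m + 2) * deg (fst z)) (?I \<union> (\<Union>j\<in>letters (Suc m). ?T j)) (?U z)"
      unfolding z(1) fst_conv case_prod_conv
      by (rule cost_at_most_mono[OF induced_cost[OF z(2), where v = "\<lambda>j a. coset_fourier m (?g j) \<kappa> a b"] _ order_refl order_refl])
        (use z in blast)
  qed
  from cost_at_most_trans[OF 1 2] show ?case
  proof (rule cost_at_most_mono)
    show "{coset_fourier (Suc m) g \<rho> x y | \<rho> x y. \<rho> \<in> R (Suc m) \<and> x < deg \<rho> \<and> y < deg \<rho>}
       \<subseteq> (\<Union>j\<in>letters (Suc m). ?T j) \<union> (\<Union>z\<in>?J. ?U z)"
    proof safe
      fix \<rho> x y assume \<rho>: "\<rho> \<in> R (Suc m)" and x: "x < deg \<rho>" and y: "y < deg \<rho>"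
        and no: "coset_fourier (Suc m) g \<rho> x y \<notin> (\<Union>z\<in>?J. ?U z)"
      obtain \<kappa> b where k: "\<kappa> \<in> ch m \<rho>" "b < deg \<kappa>" "y = emb m \<rho> \<kappa> b" by (rule emb_cases[OF \<rho> y])
      have "(\<kappa>, b) \<in> ?J" using k ch_in_R[OF \<rho>] by auto
      moreover have "coset_fourier (Suc m) g \<rho> x y \<in> ?U (\<kappa>, b)"
        unfolding k(3) coset_fourier_Suc[OF \<rho> k(1,2) x] using \<rho> k x by (auto simp: parents_def)
      ultimately have False using no by blast
      then show "coset_fourier (Suc m) g \<rho> x y \<in> (\<Union>j\<in>letters (Suc m). ?T j)" ..
    qed
    have regroup: "2 * a * (d * e) + a * c * e = a * (2 * d + c) * e" for a c d e :: nat by (simp add: algebra_simps)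
    have sq: "(\<Sum>\<kappa>\<in>R m. (deg \<kappa>)\<^sup>2) \<le> Coset.order (B m)"
      using finite_group_irreps.sum_degree_squares_le[OF irreps finite_R order_refl, of m] by (simp add: Coset.order_def)
    \<comment> \<open>The columns of \<open>\<kappa>\<close> are summed over as well, so
      \<open>deg \<kappa>\<close> enters squared, and the sum of the squares is at most the group
      order.\<close>
    have "(\<Sum>z\<in>?J. Suc m * (5 * m + 2) * deg (fst z)) = (\<Sum>\<kappa>\<in>R m. \<Sum>b<deg \<kappa>. Suc m * (5 * m + 2) * deg \<kappa>)"
      using finite_R by (subst sum.Sigma) (auto simp: case_prod_unfold)
    also have "\<dots> = Suc m * (5 * m + 2) * (\<Sum>\<kappa>\<in>R m. (deg \<kappa>)\<^sup>2)"
      unfolding sum_distrib_left by (intro sum.cong refl) (simp add: power2_eq_square id_apply algebra_simps)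
    also have "\<dots> \<le> Suc m * (5 * m + 2) * Coset.order (B m)" using sq by (rule mult_left_mono) simp
    finally have "(\<Sum>z\<in>?J. Suc m * (5 * m + 2) * deg (fst z)) \<le> Suc m * (5 * m + 2) * Coset.order (B m)" .
    moreover have "(\<Sum>j\<in>letters (Suc m). m * (2 * m - 1) * Coset.order (B m)) = 2 * Suc m * (m * (2 * m - 1) * Coset.order (B m))"
      unfolding sum_constant card_letters by (simp add: id_apply)
    ultimately have "(\<Sum>j\<in>letters (Suc m). m * (2 * m - 1) * Coset.order (B m)) + (\<Sum>z\<in>?J. Suc m * (5 * m + 2) * deg (fst z))
       \<le> 2 * Suc m * (m * (2 * m - 1) * Coset.order (B m)) + Suc m * (5 * m + 2) * Coset.order (B m)"
      by linarith
    also have "\<dots> = Suc m * (2 * (m * (2 * m - 1)) + (5 * m + 2)) * Coset.order (B m)" by (rule regroup)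
    \<comment> \<open>The induction closes with room to spare: 2 m (2 m - 1) + 5 m + 2 equals 4 m^2
      + 3 m + 2, whereas 2 (m + 1) (2 m + 1) equals 4 m^2 + 6 m + 2. The factor 2 (m + 1) then
      passes into the order of the next group.\<close>
    also have "\<dots> \<le> Suc m * (2 * Suc m * (2 * m + 1)) * Coset.order (B m)"
      by (intro mult_right_mono mult_left_mono) (auto simp: algebra_simps diff_mult_distrib2)
    also have "\<dots> = Suc m * (2 * Suc m - 1) * Coset.order (B (Suc m))"
      unfolding order_B_Suc by (simp add: algebra_simps)
    finally show "(\<Sum>j\<in>letters (Suc m). m * (2 * m - 1) * Coset.order (B m)) + (\<Sum>z\<in>?J. Suc m * (5 * m + 2) * deg (fst z))
       \<le> Suc m * (2 * Suc m - 1) * Coset.order (B (Suc m))" .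
  qed auto
qed

lemma fourier_program_exists:
  "\<exists>p. computes_fourier (B n) (R n) p \<and> additions p \<le> n * (2 * n - 1) * Coset.order (B n) \<and>
     multiplications p \<le> n * (2 * n - 1) * Coset.order (B n)"
proof -
  let ?C = "n * (2 * n - 1) * Coset.order (B n)" and ?inp = "\<lambda>f :: (int \<Rightarrow> int) \<Rightarrow> complex. (Some \<circ> f) |` carrier (B n)"
  have start: "insert (\<lambda>_. 0) {\<lambda>f. f w | w. w \<in> carrier (B n)} \<subseteq> available (B n) []"
  proof -
    have "(\<lambda>_. 0) \<in> available (B n) []"
      unfolding available_def by (rule CollectI, rule exI[of _ "Const 0"]) simp
    moreover have "(\<lambda>f. f w) \<in> available (B n) []" if "w \<in> carrier (B n)" for w
      unfolding available_def by (rule CollectI, rule exI[of _ "Input w"]) (use that in \<open>simp add: comp_apply\<close>)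
    ultimately show ?thesis by blast
  qed
  obtain p where p: "available (B n) [] \<union> {coset_fourier n id \<kappa> i j | \<kappa> i j. \<kappa> \<in> R n \<and> i < deg \<kappa> \<and> j < deg \<kappa>} \<subseteq> available (B n) p"
    and le: "additions p \<le> additions ([] :: (int \<Rightarrow> int) instr list) + ?C" "multiplications p \<le> multiplications ([] :: (int \<Rightarrow> int) instr list) + ?C"
    using coset_fourier_cost[of n n id, OF order_refl id_in_B, unfolded cost_at_most_def, rule_format, OF start]
    by (elim exE conjE)
  have "\<exists>x. \<forall>f. \<exists>vs. run (?inp f) [] p = Some vs \<and> operand_val (?inp f) vs x = Some (fourier (B n) (R n) f \<rho> $$ (i, j))"
    if \<rho>: "\<rho> \<in> R n" "i < deg \<rho>" "j < deg \<rho>" for \<rho> i j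
  proof -
    have "coset_fourier n id \<rho> i j \<in> available (B n) p" using p \<rho> by blast
    moreover have "coset_fourier n id \<rho> i j f = fourier (B n) (R n) f \<rho> $$ (i, j)" for f
      using fourier_at_entry[OF rep_R[OF \<rho>(1)] group_hyperoctahedral finite_carrier_B \<rho>(2,3), of f] \<rho>(1)
      by (simp add: fourier_def coset_fourier_def)
    ultimately show ?thesis unfolding available_def by simp
  qed
  note ex = this
  define out where "out \<rho> i j = (SOME x. \<forall>f. \<exists>vs. run (?inp f) [] p = Some vs \<and>
      operand_val (?inp f) vs x = Some (fourier (B n) (R n) f \<rho> $$ (i, j)))" for \<rho> i j
  have out: "\<exists>vs. run (?inp f) [] p = Some vs \<and> operand_val (?inp f) vs (out \<rho> i j) = Some (fourier (B n) (R n) f \<rho> $$ (i, j))"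
    if "\<rho> \<in> R n" "i < deg \<rho>" "j < deg \<rho>" for \<rho> i j f
    using someI_ex[OF ex[OF that]] unfolding out_def by (rule spec)
  \<comment> \<open>A single run has to serve all entries at once. Its success is taken from the
    zero form, and since \<open>run\<close> is a function it is the run supplied for each
    entry.\<close>
  have zero: "\<exists>vs. run (?inp f) [] p = Some vs" for f
  proof -
    have "(\<lambda>_. 0) \<in> available (B n) p" using start p by (meson insertI1 subsetD Un_upper1)
    then show ?thesis unfolding available_def by (simp, elim exE allE[of _ f]) auto
  qed
  have "computes_fourier (B n) (R n) p"
    unfolding computes_fourier_def Let_def
  proof (intro exI[of _ out] allI)
    fix f
    obtain vs where vs: "run (?inp f) [] p = Some vs" using zero by blast
    have "operand_val (?inp f) vs (out \<rho> i j) = Some (fourier (B n) (R n) f \<rho> $$ (i, j))"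
      if "\<rho> \<in> R n" "i < deg \<rho>" "j < deg \<rho>" for \<rho> i j
    proof -
      from out[OF that, of f] obtain vs' where "run (?inp f) [] p = Some vs'"
        "operand_val (?inp f) vs' (out \<rho> i j) = Some (fourier (B n) (R n) f \<rho> $$ (i, j))" by (elim exE conjE)
      with vs show ?thesis by simp
    qed
    then show "\<exists>vs. run (?inp f) [] p = Some vs \<and> (\<forall>\<rho>\<in>R n. \<forall>i<rep_degree (B n) \<rho>. \<forall>j<rep_degree (B n) \<rho>.
        operand_val (?inp f) vs (out \<rho> i j) = Some (fourier (B n) (R n) f \<rho> $$ (i, j)))"
      using vs by auto
  qed
  then show ?thesis using le by (intro exI[of _ p]) (auto simp: additions_def multiplications_def)
qed

end

theorem theorem1p1:
  fixes n :: nat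
  assumes "n \<ge> 1"
  shows "group_complexity (hyperoctahedral n)
           \<le> enat (n * (2 * n - 1) * Coset.order (hyperoctahedral n))"
proof -
  obtain R ch emb where "tower R ch emb" using tower_exists by blast
  then interpret tower R ch emb .
  obtain p where p: "computes_fourier (B n) (R n) p"
    "additions p \<le> n * (2 * n - 1) * Coset.order (B n)" "multiplications p \<le> n * (2 * n - 1) * Coset.order (B n)"
    using fourier_program_exists by blast
  have "min_additions (B n) (R n) \<le> enat (additions p)" "min_multiplications (B n) (R n) \<le> enat (multiplications p)"
    unfolding min_additions_def min_multiplications_def using p(1) by (auto intro!: INF_lower)
  then have "arith_complexity (B n) (R n) \<le> enat (n * (2 * n - 1) * Coset.order (B n))"
    unfolding arith_complexity_def using p(2,3) by (simp add: order_trans[OF _ enat_ord_simps(1)[THEN iffD2]])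
  moreover have "group_complexity (B n) \<le> arith_complexity (B n) (R n)"
    unfolding group_complexity_def using complete by (intro INF_lower) simp
  ultimately show ?thesis by (rule order_trans[rotated])
qed

end
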